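(* Let $H$ be a fixed non-matching graph with $e(H)\ge 3$, and fix an integer $\ell\ge e(H)$. For every $\delta>0$ there are constants $a=a(H,\ell,\delta)>0$ and $A=A(H,\ell,\delta)>0$ such that, for $G=G(n,p)$ with $p=p(n)\in[0,1]$, the following hold. (i) If $p\le a n^{-1/m_2(H)}$, then with high probability $$\ell^{(1-\delta)e(G)}\le R_{H,\ell}(G)\le \ell^{e(G)}.$$ (ii) If $p\ge A n^{-1/m_2(H)}$, then with high probability $$\exp\bigl((\lambda(H,\ell)-\delta)e(G)\bigr)\le R_{H,\ell}(G)\le \exp\bigl((\lambda(H,\ell)+\delta)e(G)\bigr).$$
   Context: All graphs are finite and simple; $v(G)$, $e(G)$ denote numbers of vertices and edges. $H$ has no isolated vertices (isolated vertices play no role and are deleted). $H$ is non-matching if it contains two adjacent edges. Logarithms are natural. $[s]=\{1,\dots,s\}$. $G(n,p)$ is the binomial random graph on $[n]$, each edge present independently with probability $p$. "With high probability" means with probability tending to $1$ as $n\to\infty$. A copy of $H$ (as a not necessarily induced subgraph) in an edge-coloured graph is rainbow if its edges receive pairwise distinct colours. $R_{H,\ell}(G)$ is the number of maps $\chi:E(G)\to[\ell]$ such that $G$ coloured by $\chi$ contains no rainbow copy of $H$. The maximum 2-density is $m_2(H)=\max\{\frac{e(F)-1}{v(F)-2}: F\subseteq H,\ v(F)\ge 3\}$. An $\ell$-palette template on $K_n$ is a map $\mathcal P:E(K_n)\to 2^{[\ell]}\setminus\{\emptyset\}$. A finite family of sets $A_1,\dots,A_q$ has a system of distinct representatives (SDR)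 if there are pairwise distinct $a_i\in A_i$. The template $\mathcal P$ is $H$-SDR-free if on every copy of $H$ in $K_n$ the palettes assigned to its edges have no SDR. Let $\operatorname{ex}_{\log}(n;H,\ell)$ be the maximum of $\sum_{e\in E(K_n)}\log|\mathcal P(e)|$ over all $H$-SDR-free $\ell$-palette templates $\mathcal P$ on $K_n$, and define $$\lambda(H,\ell)=\inf_{n\ge v(H)}\frac{\operatorname{ex}_{\log}(n;H,\ell)}{\binom n2}.$$ *)

theory Defs
  imports "HOL-Probability.Probability" "HOL-Probability.Product_PMF" "HOL-Library.Ramsey"
begin

section \<open>Finite simple graphs\<close>

datatype 'a graph = Graph (verts: "'a set") (edges: "'a set set")

abbreviation nv :: "'a graph \<Rightarrow> nat" where
  "nv G \<equiv> card (verts G)"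

abbreviation ne :: "'a graph \<Rightarrow> nat" where
  "ne G \<equiv> card (edges G)"

definition simple_graph :: "'a graph \<Rightarrow> bool" where
  "simple_graph G \<longleftrightarrow> finite (verts G) \<and> edges G \<subseteq> [verts G]\<^bsup>2\<^esup>"

definition no_isolated_vertices :: "'a graph \<Rightarrow> bool" where
  "no_isolated_vertices G \<longleftrightarrow> (\<forall>v\<in>verts G. \<exists>e\<in>edges G. v \<in> e)"

definition non_matching :: "'a graph \<Rightarrow> bool" where
  "non_matching G \<longleftrightarrow> (\<exists>e\<in>edges G. \<exists>f\<in>edges G. e \<noteq> f \<and> e \<inter> f \<noteq> {})"

definition subgraph :: "'a graph \<Rightarrow> 'a graph \<Rightarrow> bool" where
  "subgraph F G \<longleftrightarrow> simple_graph F \<and> verts F \<subseteq> verts G \<and> edges F \<subseteq> edges G"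

definition isomorphic :: "'a graph \<Rightarrow> 'b graph \<Rightarrow> bool" where
  "isomorphic F G \<longleftrightarrow>
     (\<exists>\<phi>. bij_betw \<phi> (verts F) (verts G) \<and> edges G = (\<lambda>e. \<phi> ` e) ` edges F)"

definition is_copy :: "'a graph \<Rightarrow> 'b graph \<Rightarrow> 'b graph \<Rightarrow> bool" where
  "is_copy H F G \<longleftrightarrow> subgraph F G \<and> isomorphic H F"

definition complete_graph :: "nat \<Rightarrow> nat graph" where
  "complete_graph n = Graph {1..n} ([{1..n}]\<^bsup>2\<^esup>)"

definition m2 :: "'a graph \<Rightarrow> real" where
  "m2 H = Max {(real (ne F) - 1) / (real (nv F) - 2) | F. subgraph F H \<and> nv F \<ge> 3}"

section \<open>Rainbow-free colourings\<close>

text \<open>Colourings are extensional functions on the edge set, so that they can be counted.\<close>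

definition rainbow_free_colourings :: "'a graph \<Rightarrow> nat \<Rightarrow> 'b graph \<Rightarrow> ('b set \<Rightarrow> nat) set" where
  "rainbow_free_colourings H l G =
     {c \<in> edges G \<rightarrow>\<^sub>E {1..l}. \<not> (\<exists>F. is_copy H F G \<and> inj_on c (edges F))}"

definition R :: "'a graph \<Rightarrow> nat \<Rightarrow> 'b graph \<Rightarrow> nat" where
  "R H l G = card (rainbow_free_colourings H l G)"

section \<open>Palette templates\<close>

definition has_SDR :: "'i set \<Rightarrow> ('i \<Rightarrow> 'c set) \<Rightarrow> bool" where
  "has_SDR I A \<longleftrightarrow> (\<exists>a. (\<forall>i\<in>I. a i \<in> A i) \<and> inj_on a I)"

definition palette_templates :: "nat \<Rightarrow> nat \<Rightarrow> (nat set \<Rightarrow> nat set) set" where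
  "palette_templates l n = edges (complete_graph n) \<rightarrow>\<^sub>E (Pow {1..l} - {{}})"

definition SDR_free :: "'a graph \<Rightarrow> nat \<Rightarrow> (nat set \<Rightarrow> nat set) \<Rightarrow> bool" where
  "SDR_free H n P \<longleftrightarrow> (\<forall>F. is_copy H F (complete_graph n) \<longrightarrow> \<not> has_SDR (edges F) P)"

definition ex_log :: "nat \<Rightarrow> 'a graph \<Rightarrow> nat \<Rightarrow> real" where
  "ex_log n H l =
     Max {(\<Sum>e\<in>edges (complete_graph n). ln (real (card (P e)))) | P.
            P \<in> palette_templates l n \<and> SDR_free H n P}"

definition lambda_H :: "'a graph \<Rightarrow> nat \<Rightarrow> real" where
  "lambda_H H l = (INF n\<in>{nv H..}. ex_log n H l / real (n choose 2))"

section \<open>The binomial random graph\<close>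

definition gnp :: "nat \<Rightarrow> real \<Rightarrow> nat graph pmf" where
  "gnp n p =
     map_pmf (\<lambda>b. Graph {1..n} {e \<in> edges (complete_graph n). b e})
       (Pi_pmf (edges (complete_graph n)) False (\<lambda>_. bernoulli_pmf p))"

definition whp_gnp :: "(nat \<Rightarrow> real) \<Rightarrow> (nat graph \<Rightarrow> bool) \<Rightarrow> bool" where
  "whp_gnp p Q \<longleftrightarrow> (\<lambda>n. measure_pmf.prob (gnp n (p n)) {G. Q G}) \<longlonglongrightarrow> 1"

end

theory Submission
  imports Defs "HOL-Combinatorics.Permutations"
begin

text \<open>
  Upper bound in (ii): take as vertices the pairs (edge of \<open>K\<^sub>n\<close>, colour) and as hyperedges the rainbow
  copies of \<open>H\<close>. A rainbow-free colouring of \<open>G\<close> is an independent set, hence lies in a container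
  that spans few rainbow copies and is determined by fingerprints, i.e. boundedly many subsets of the
  colouring of size \<open>O(n\<^sup>2 \<tau>)\<close> with \<open>\<tau> = n powr (- 1 / m2 H)\<close>. Read as a palette template, a container has
  logarithmic weight at most \<open>(\<lambda> + o(1)) (n choose 2)\<close> by supersaturation (averaging over the vertex sets
  of a fixed large size), so in \<open>G(n,p)\<close> it typically holds only \<open>exp ((\<lambda> + o(1)) e(G))\<close> colourings. A
  fingerprint \<open>S\<close> matters only if its edges lie in \<open>G\<close>, which has probability \<open>p ^ |S|\<close>; this makes the
  union bound over fingerprints affordable as soon as \<open>p \<ge> A \<tau>\<close> with \<open>A\<close> large. For the lower bound in
  (ii), colour the edges of \<open>G\<close> from the palettes of an optimal template.

  For (i), a subgraph \<open>J\<close> of \<open>H\<close> attaining \<open>m2 H\<close> has at most a small multiple of \<open>e(G)\<close> copies in \<open>G\<close>.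
  Giving one colour to all edges in such copies destroys every rainbow \<open>H\<close>, and all other edges are free.
\<close>

section \<open>Hypergraph containers\<close>

text \<open>One estimate drives both halves: by the definition of \<open>m2 H\<close>, only
  O(n^(v-2) \<tau>^(|T|-1)) embeddings of \<open>H\<close> contain a given nonempty edge set T. This
  is precisely the codegree condition of the container theorem with fingerprints of size O(\<tau>
  |V|), and for \<open>J\<close> it is also the variance bound below the threshold. Hypergraphs
  carry weights because the container algorithm adds up the links of many vertices, where the same
  edge may arise repeatedly, and because several coloured embeddings share one image; with weights
  no multiplicity has to be divided out. Two orders of quantifiers shape the rest.
  \<open>\<lambda>\<close> is an infimum, so every \<open>n \<ge> nv H\<close> gives the lower bound
  at once, and a single good size \<open>m\<close> suffices for supersaturation; convergence of the
  ratio never enters. In (i) the constant \<open>a\<close> is fixed before the failure probability,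
  so near p = a \<tau> Markov's inequality yields only a constant, and the copies of
  \<open>J\<close> need a second moment.\<close>

definition deg :: "'v set \<Rightarrow> ('v set \<Rightarrow> real) \<Rightarrow> 'v set \<Rightarrow> real" where
  "deg V w T = (\<Sum>e | e \<subseteq> V \<and> T \<subseteq> e. w e)"

text \<open>The codegree hypothesis of the container method. \<open>m\<close> is only a lower bound
  for the total mass \<open>deg V w {}\<close>, so that link hypergraphs qualify whose mass is known
  from below; \<open>m / card V\<close> plays the role of the average degree, and each further
  vertex of \<open>T\<close> must gain a factor \<open>\<tau>\<close>.\<close>

definition spread :: "'v set \<Rightarrow> nat \<Rightarrow> real \<Rightarrow> real \<Rightarrow> real \<Rightarrow> ('v set \<Rightarrow> real) \<Rightarrow> bool" where
  "spread V r K \<tau> m w \<longleftrightarrow>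
     (\<forall>e. 0 \<le> w e) \<and> (\<forall>e. w e \<noteq> 0 \<longrightarrow> e \<subseteq> V \<and> card e = r) \<and> 0 < m \<and> m \<le> deg V w {} \<and>
     (\<forall>T. T \<subseteq> V \<longrightarrow> T \<noteq> {} \<longrightarrow> deg V w T \<le> K * \<tau> ^ (card T - 1) * m / card V)"

lemma spreadD:
  assumes "spread V r K \<tau> m w"
  shows "\<And>e. 0 \<le> w e" "\<And>e. w e \<noteq> 0 \<Longrightarrow> e \<subseteq> V \<and> card e = r" "0 < m" "m \<le> deg V w {}"
    "\<And>T. T \<subseteq> V \<Longrightarrow> T \<noteq> {} \<Longrightarrow> deg V w T \<le> K * \<tau> ^ (card T - 1) * m / card V"
  using assms by (simp_all add: spread_def)

definition independent_in :: "('v set \<Rightarrow> real) \<Rightarrow> 'v set \<Rightarrow> bool" where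
  "independent_in w I \<longleftrightarrow> (\<forall>e. e \<subseteq> I \<longrightarrow> w e = 0)"

lemma deg_nonneg: "(\<And>e. 0 \<le> w e) \<Longrightarrow> 0 \<le> deg V w T"
  unfolding deg_def by (rule sum_nonneg) auto

lemma finite_edge_set: "finite V \<Longrightarrow> finite {e. e \<subseteq> V \<and> P e}"
  by (rule finite_subset[of _ "Pow V"]) auto

lemma deg_mono:
  assumes "finite V" "\<And>e. e \<subseteq> V \<Longrightarrow> T \<subseteq> e \<Longrightarrow> w e \<le> w' e"
  shows "deg V w T \<le> deg V w' T"
  unfolding deg_def using assms by (intro sum_mono) auto

lemma sum_deg_vertices:
  assumes "finite V" "\<And>e. w e \<noteq> 0 \<Longrightarrow> e \<subseteq> V \<and> card e = r"
  shows "(\<Sum>v\<in>V. deg V w {v}) = real r * deg V w {}"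
proof -
  have "(\<Sum>v\<in>V. deg V w {v}) = (\<Sum>v\<in>V. \<Sum>e | e \<subseteq> V. if v \<in> e then w e else 0)"
    unfolding deg_def using finite_edge_set[OF assms(1)]
    by (intro sum.cong refl sum.mono_neutral_cong_left) (auto simp: assms(1))
  also have "\<dots> = (\<Sum>e | e \<subseteq> V. \<Sum>v\<in>V. if v \<in> e then w e else 0)"
    by (rule sum.swap)
  also have "\<dots> = (\<Sum>e | e \<subseteq> V. real r * w e)"
  proof (rule sum.cong[OF refl])
    fix e assume "e \<in> {e. e \<subseteq> V}"
    then have "V \<inter> e = e" by auto
    then have "(\<Sum>v\<in>V. if v \<in> e then w e else 0) = real (card e) * w e"
      using assms(1) by (simp add: sum.If_cases Int_def[symmetric])
    then show "(\<Sum>v\<in>V. if v \<in> e then w e else 0) = real r * w e"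
      using assms(2)[of e] by (cases "w e = 0") auto
  qed
  finally show ?thesis by (simp add: deg_def sum_distrib_left)
qed

lemma sum_deg_sets:
  assumes "finite V" "\<And>e. w e \<noteq> 0 \<Longrightarrow> e \<subseteq> V \<and> card e = r"
  shows "(\<Sum>T\<in>Pow V. deg V w T) = 2 ^ r * deg V w {}"
proof -
  have "(\<Sum>T\<in>Pow V. deg V w T) = (\<Sum>T\<in>Pow V. \<Sum>e | e \<subseteq> V. if T \<subseteq> e then w e else 0)"
    unfolding deg_def using finite_edge_set[OF assms(1)]
    by (intro sum.cong refl sum.mono_neutral_cong_left) (auto simp: assms(1))
  also have "\<dots> = (\<Sum>e | e \<subseteq> V. \<Sum>T\<in>Pow V. if T \<subseteq> e then w e else 0)"
    by (rule sum.swap)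
  also have "\<dots> = (\<Sum>e | e \<subseteq> V. 2 ^ r * w e)"
  proof (rule sum.cong[OF refl])
    fix e assume e: "e \<in> {e. e \<subseteq> V}"
    then have "Pow V \<inter> {T. T \<subseteq> e} = Pow e" by auto
    moreover have "finite e" using e assms(1) finite_subset by auto
    ultimately have "(\<Sum>T\<in>Pow V. if T \<subseteq> e then w e else 0) = 2 ^ card e * w e"
      using assms(1) by (simp add: sum.If_cases card_Pow)
    then show "(\<Sum>T\<in>Pow V. if T \<subseteq> e then w e else 0) = 2 ^ r * w e"
      using assms(2)[of e] by (cases "w e = 0") auto
  qed
  finally show ?thesis by (simp add: deg_def sum_distrib_left)
qed

lemma deg_link:
  assumes "finite V" "v \<in> V"
  shows "deg V (\<lambda>f. if v \<notin> f then w (insert v f) else 0) T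
    = (if v \<in> T then 0 else deg V w (insert v T))"
proof (cases "v \<in> T")
  case True
  then show ?thesis unfolding deg_def by (auto intro!: sum.neutral)
next
  case False
  have "deg V (\<lambda>f. if v \<notin> f then w (insert v f) else 0) T
      = (\<Sum>f | f \<subseteq> V \<and> T \<subseteq> f \<and> v \<notin> f. w (insert v f))"
    unfolding deg_def using finite_edge_set[OF assms(1)]
    by (intro sum.mono_neutral_cong_right) (auto simp: assms(1))
  also have "\<dots> = (\<Sum>e | e \<subseteq> V \<and> insert v T \<subseteq> e. w e)"
    using False assms(2)
    by (intro sum.reindex_bij_witness[of _ "\<lambda>e. e - {v}" "insert v"]) auto
  finally show ?thesis using False by (simp add: deg_def)
qed

lemma deg_add: "deg V (\<lambda>f. w f + w' f) T = deg V w T + deg V w' T"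
  unfolding deg_def by (rule sum.distrib)

text \<open>A union bound for mass: \<open>A\<close> may lose weight only on edges that contain a
  member of \<open>B\<close>, and each member of \<open>B\<close> accounts for at most its own
  degree.\<close>

lemma deg_cover:
  assumes fin: "finite V" and nn: "\<And>e. 0 \<le> w e" and B: "B \<subseteq> Pow V"
    and A: "\<And>e. 0 \<le> A e" "\<And>e. e \<subseteq> V \<Longrightarrow> \<not> (\<exists>T\<in>B. T \<subseteq> e) \<Longrightarrow> A e = w e"
  shows "deg V w {} \<le> deg V A {} + (\<Sum>T\<in>B. deg V w T)"
proof -
  have finB: "finite B" using B fin finite_subset by (metis finite_Pow_iff)
  have "w e \<le> A e + (\<Sum>T\<in>B. if T \<subseteq> e then w e else 0)" if e: "e \<subseteq> V" for e
  proof (cases "\<exists>T\<in>B. T \<subseteq> e")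
    case True
    then obtain T where T: "T \<in> B" "T \<subseteq> e" by blast
    have "w e = (if T \<subseteq> e then w e else 0)" using T by simp
    also have "\<dots> \<le> (\<Sum>T\<in>B. if T \<subseteq> e then w e else 0)"
      by (rule member_le_sum) (use T finB nn in auto)
    finally show ?thesis using A(1)[of e] by simp
  next
    case False
    then have "0 \<le> (\<Sum>T\<in>B. if T \<subseteq> e then w e else 0)" by (intro sum_nonneg) (auto simp: nn)
    then show ?thesis using A(2)[OF e False] by simp
  qed
  then have "(\<Sum>e | e \<subseteq> V. w e) \<le> (\<Sum>e | e \<subseteq> V. A e + (\<Sum>T\<in>B. if T \<subseteq> e then w e else 0))"
    by (intro sum_mono) auto
  also have "\<dots> = deg V A {} + (\<Sum>T\<in>B. \<Sum>e | e \<subseteq> V. if T \<subseteq> e then w e else 0)"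
    by (simp add: sum.distrib deg_def sum.swap[of _ B])
  also have "(\<Sum>T\<in>B. \<Sum>e | e \<subseteq> V. if T \<subseteq> e then w e else 0) = (\<Sum>T\<in>B. deg V w T)"
    unfolding deg_def using finite_edge_set[OF fin]
    by (intro sum.cong refl sum.mono_neutral_cong_right) (auto simp: fin)
  finally show ?thesis by (simp add: deg_def)
qed

lemma spread_nonempty:
  assumes "spread V (Suc r) K \<tau> m w" "finite V"
  shows "0 < card V"
proof (rule ccontr)
  assume "\<not> 0 < card V"
  then have "V = {}" using assms(2) by auto
  then have "w {} \<noteq> 0" using assms(1) by (auto simp: spread_def deg_def)
  then show False using assms(1) unfolding spread_def by fastforce
qed

section \<open>One level of the container algorithm: accumulated links and the decision tree\<close>

text \<open>
  Discarding the edges that contain a set whose degree in the link hypergraph \<open>w'\<close> is already saturated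
  keeps the codegrees of \<open>w'\<close> bounded.
\<close>

definition active :: "'v set \<Rightarrow> ('v set \<Rightarrow> real) \<Rightarrow> (nat \<Rightarrow> real) \<Rightarrow> 'v set \<Rightarrow> ('v set \<Rightarrow> real) \<Rightarrow> 'v set \<Rightarrow> real" where
  "active V w \<theta> S w' e =
     (if e \<inter> S = {} \<and> (\<forall>T. T \<subseteq> e \<longrightarrow> T \<noteq> {} \<longrightarrow> deg V w' T \<le> \<theta> (card T)) then w e else 0)"

text \<open>This is what a stuck decision tree yields. Edges meeting \<open>S\<close> and edges
  containing a saturated set weigh at most \<open>m / 4\<close> each, so active edges keep mass
  \<open>m / 2\<close>. Vertices of small active degree contribute at most \<open>m / 4\<close> to
  the degree sum, so \<open>X\<close> contributes the rest, and one vertex contributes at most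
  \<open>K * m / card V\<close>.\<close>

lemma excluded_large:
  fixes K \<tau> m :: real
  assumes fin: "finite V" and w: "spread V (Suc r) K \<tau> m w"
    and K: "0 < K" and \<tau>: "0 < \<tau>" "\<tau> \<le> 1 / (8 * K)"
    and \<theta>: "\<And>t. \<theta> t = 2 ^ (r + 3) * K\<^sup>2 * \<tau> ^ t * m / card V"
    and S: "S \<subseteq> V" "real (card S) \<le> 2 * \<tau> * card V"
    and w': "\<And>e. 0 \<le> w' e" "\<And>e. w' e \<noteq> 0 \<Longrightarrow> e \<subseteq> V \<and> card e = r"
      "deg V w' {} \<le> card S * (K * m / card V)"
    and X: "X \<subseteq> V" and small: "\<And>v. v \<in> V - S - X \<Longrightarrow> deg V (active V w \<theta> S w') {v} < m / (4 * card V)"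
  shows "card V / (4 * K) \<le> card X"
proof -
  define N where "N = real (card V)"
  have N: "0 < N" unfolding N_def using spread_nonempty[OF w fin] by simp
  have wnn: "\<And>e. 0 \<le> w e" and wsupp: "\<And>e. w e \<noteq> 0 \<Longrightarrow> e \<subseteq> V \<and> card e = Suc r"
    and m: "0 < m" "m \<le> deg V w {}"
    and codeg: "\<And>T. T \<subseteq> V \<Longrightarrow> T \<noteq> {} \<Longrightarrow> deg V w T \<le> K * \<tau> ^ (card T - 1) * m / N"
    using spreadD[OF w] unfolding N_def by blast+
  define A where "A = active V w \<theta> S w'"
  have Ann: "0 \<le> A e" and Ale: "A e \<le> w e" for e by (auto simp: A_def active_def wnn)
  have Asupp: "e \<subseteq> V \<and> card e = Suc r" if "A e \<noteq> 0" for e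
    using that wsupp[of e] by (auto simp: A_def active_def split: if_splits)
  define sat where "sat = {T\<in>Pow V. T \<noteq> {} \<and> \<theta> (card T) < deg V w' T}"
  have finsat: "finite sat" unfolding sat_def using fin by auto
  have "deg V w {} \<le> deg V A {} + (\<Sum>T\<in>(\<lambda>v. {v}) ` S \<union> sat. deg V w T)"
  proof (rule deg_cover[OF fin wnn _ Ann])
    show "(\<lambda>v. {v}) ` S \<union> sat \<subseteq> Pow V" using S(1) by (auto simp: sat_def)
    fix e assume e: "e \<subseteq> V" "\<not> (\<exists>T\<in>(\<lambda>v. {v}) ` S \<union> sat. T \<subseteq> e)"
    have "e \<inter> S = {}" using e(2) by auto
    moreover have "\<forall>T. T \<subseteq> e \<longrightarrow> T \<noteq> {} \<longrightarrow> deg V w' T \<le> \<theta> (card T)"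
    proof (intro allI impI)
      fix T assume T: "T \<subseteq> e" "T \<noteq> {}"
      then have "T \<in> Pow V" "T \<notin> sat" using e by auto
      then show "deg V w' T \<le> \<theta> (card T)" using T(2) by (simp add: sat_def del: Pow_iff)
    qed
    ultimately show "A e = w e" by (simp add: A_def active_def)
  qed
  also have "(\<Sum>T\<in>(\<lambda>v. {v}) ` S \<union> sat. deg V w T)
      \<le> (\<Sum>T\<in>(\<lambda>v. {v}) ` S. deg V w T) + (\<Sum>T\<in>sat. deg V w T)"
    using finsat finite_subset[OF S(1) fin]
    by (subst sum_Un) (auto intro!: sum_nonneg deg_nonneg wnn)
  also have "(\<Sum>T\<in>(\<lambda>v. {v}) ` S. deg V w T) \<le> m / 4"
  proof -
    have "(\<Sum>T\<in>(\<lambda>v. {v}) ` S. deg V w T) = (\<Sum>v\<in>S. deg V w {v})"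
      by (subst sum.reindex) auto
    also have "\<dots> \<le> (\<Sum>v\<in>S. K * m / N)"
    proof (rule sum_mono)
      fix v assume "v \<in> S"
      then show "deg V w {v} \<le> K * m / N" using codeg[of "{v}"] S(1) by auto
    qed
    also have "\<dots> = card S * (K * m / N)" by simp
    also have "\<dots> \<le> 2 * \<tau> * N * (K * m / N)"
      using S(2) K m N by (intro mult_right_mono) (auto simp: N_def)
    also have "\<dots> = 2 * (\<tau> * K) * m" using N by simp
    also have "\<dots> \<le> 2 * (1/8) * m"
      using \<tau> K m by (intro mult_right_mono mult_left_mono) (auto simp: field_simps)
    finally show ?thesis by simp
  qed
  \<comment> \<open>The constant in \<open>\<theta>\<close> is made for this step: the codegree
    bound of \<open>w\<close> equals \<open>\<theta> (card T)\<close> divided by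
    \<open>2 ^ (r + 3) * K * \<tau>\<close>, so a saturated set is paid for by its degree in
    \<open>w'\<close>. The factor \<open>2 ^ r\<close> cancels the number of subsets of an edge of
    \<open>w'\<close>.\<close>
  also have "(\<Sum>T\<in>sat. deg V w T) \<le> m / 4"
  proof -
    have "(\<Sum>T\<in>sat. deg V w T) \<le> (\<Sum>T\<in>sat. deg V w' T * (1 / (2 ^ (r + 3) * K * \<tau>)))"
    proof (rule sum_mono)
      fix T assume T: "T \<in> sat"
      then have "finite T" "T \<noteq> {}" using fin finite_subset by (auto simp: sat_def)
      then have "card T \<noteq> 0" by simp
      then have ct: "\<tau> ^ card T = \<tau> * \<tau> ^ (card T - 1)" by (cases "card T") auto
      have "deg V w T \<le> K * \<tau> ^ (card T - 1) * m / N" using T codeg by (auto simp: sat_def)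
      also have "\<dots> = \<theta> (card T) * (1 / (2 ^ (r + 3) * K * \<tau>))"
        unfolding \<theta> ct N_def[symmetric] using K \<tau> N by (simp add: field_simps power2_eq_square)
      also have "\<dots> \<le> deg V w' T * (1 / (2 ^ (r + 3) * K * \<tau>))"
        using T K \<tau> by (intro mult_right_mono) (auto simp: sat_def)
      finally show "deg V w T \<le> deg V w' T * (1 / (2 ^ (r + 3) * K * \<tau>))" .
    qed
    also have "\<dots> \<le> (\<Sum>T\<in>Pow V. deg V w' T * (1 / (2 ^ (r + 3) * K * \<tau>)))"
      using fin K \<tau> by (intro sum_mono2) (auto simp: sat_def intro!: divide_nonneg_pos deg_nonneg w'(1))
    also have "\<dots> = 2 ^ r * deg V w' {} * (1 / (2 ^ (r + 3) * K * \<tau>))"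
      by (subst sum_distrib_right[symmetric], subst sum_deg_sets[OF fin w'(2)]) auto
    also have "\<dots> = deg V w' {} * (1 / (8 * K * \<tau>))" by (simp add: power_add)
    also have "\<dots> \<le> (2 * \<tau> * N * (K * m / N)) * (1 / (8 * K * \<tau>))"
    proof (rule mult_right_mono)
      have "card S * (K * m / N) \<le> 2 * \<tau> * N * (K * m / N)"
        using S(2) K m N by (intro mult_right_mono) (auto simp: N_def)
      then show "deg V w' {} \<le> 2 * \<tau> * N * (K * m / N)" using w'(3) by (simp add: N_def)
    qed (use K \<tau> in auto)
    also have "\<dots> = m / 4" using K \<tau> N by (simp add: field_simps)
    finally show ?thesis .
  qed
  finally have massA: "m / 2 \<le> deg V A {}" using m by simp
  have "m / 2 \<le> real (Suc r) * deg V A {}"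
  proof -
    have "1 * deg V A {} \<le> real (Suc r) * deg V A {}"
      by (intro mult_right_mono deg_nonneg Ann) auto
    then show ?thesis using massA by simp
  qed
  also have "\<dots> = (\<Sum>v\<in>V. deg V A {v})" using sum_deg_vertices[OF fin Asupp] by simp
  also have "\<dots> \<le> (\<Sum>v\<in>V. m / (4 * N) + (if v \<in> X then K * m / N else 0))"
  proof (rule sum_mono)
    fix v assume v: "v \<in> V"
    consider "v \<in> X" | "v \<notin> X" "v \<in> S" | "v \<in> V - S - X" using v by blast
    then show "deg V A {v} \<le> m / (4 * N) + (if v \<in> X then K * m / N else 0)"
    proof cases
      case 1
      have "deg V A {v} \<le> deg V w {v}" by (rule deg_mono[OF fin Ale])
      also have "\<dots> \<le> K * m / N" using codeg[of "{v}"] v by simp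
      also have "\<dots> \<le> m / (4 * N) + K * m / N" using m N by simp
      finally show ?thesis using 1 by simp
    next
      case 2
      then have "deg V A {v} = 0" unfolding deg_def A_def active_def by (intro sum.neutral) auto
      then show ?thesis using 2 m N by simp
    next
      case 3
      then show ?thesis using small[OF 3] unfolding A_def N_def by auto
    qed
  qed
  also have "\<dots> = m / 4 + card X * (K * m / N)"
    using fin X N by (simp add: sum.distrib sum.If_cases Int_absorb1 N_def[symmetric])
  finally have "m / 2 \<le> m / 4 + card X * (K * m / N)" .
  moreover have "card X * (K * m / N) = (card X * K / N) * m" by simp
  ultimately have "1 / 4 * m \<le> (card X * K / N) * m" by linarith
  then have "1 / 4 \<le> card X * K / N" using m(1) by (rule mult_right_le_imp_le)
  then show ?thesis using K N unfolding N_def[symmetric] by (simp add: field_simps)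
qed

text \<open>
  A fingerprint is a list of sets, one for each level of the recursion on the uniformity, so that no
  argument is needed to recover the levels from their union.
\<close>

definition container_for ::
  "'v set \<Rightarrow> nat \<Rightarrow> real \<Rightarrow> real \<Rightarrow> ('v set list \<Rightarrow> 'v set) \<Rightarrow> 'v set \<Rightarrow> bool" where
  "container_for V k s M f I \<longleftrightarrow>
     (\<exists>Ss. length Ss = k \<and> (\<forall>S\<in>set Ss. S \<subseteq> I \<and> real (card S) \<le> s) \<and>
       I \<subseteq> f Ss \<and> f Ss \<subseteq> V \<and> real (card (f Ss)) \<le> M)"

lemma container_for_mono:
  assumes "container_for V k s M f I" "s \<le> s'" "M \<le> M'"
  shows "container_for V k s' M' f I"
proof -
  from assms(1) obtain Ss where "length Ss = k" "\<forall>S\<in>set Ss. S \<subseteq> I \<and> real (card S) \<le> s"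
    "I \<subseteq> f Ss" "f Ss \<subseteq> V" "real (card (f Ss)) \<le> M"
    unfolding container_for_def by blast
  then show ?thesis
    unfolding container_for_def using assms(2,3) by (intro exI[of _ Ss]) force
qed

text \<open>The invariant of the decision tree: \<open>w'\<close> is the sum of the active links of
  the vertices of \<open>S\<close>. Each edge of \<open>w'\<close> together with \<open>S\<close>
  covers an edge of \<open>w\<close>, so a set that contains \<open>S\<close> and is independent in
  \<open>w\<close> is independent in \<open>w'\<close>. Every vertex of \<open>S\<close> has added
  mass between \<open>m / (4 * card V)\<close> and \<open>K * m / card V\<close>. The codegree bound
  is the saturation level \<open>\<theta>\<close> plus one overshoot.\<close>

definition link_state :: "'v set \<Rightarrow> nat \<Rightarrow> real \<Rightarrow> real \<Rightarrow> real \<Rightarrow> (nat \<Rightarrow> real) \<Rightarrow> ('v set \<Rightarrow> real) \<Rightarrow> 'v set \<Rightarrow> ('v set \<Rightarrow> real) \<Rightarrow> bool" where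
  "link_state V r K \<tau> m \<theta> w S w' \<longleftrightarrow>
     S \<subseteq> V \<and> (\<forall>e. 0 \<le> w' e) \<and>
     (\<forall>f. w' f \<noteq> 0 \<longrightarrow> f \<subseteq> V \<and> card f = r \<and> (\<exists>e. w e \<noteq> 0 \<and> e \<subseteq> f \<union> S)) \<and>
     deg V w' {} \<le> card S * (K * m / card V) \<and> card S * (m / (4 * card V)) \<le> deg V w' {} \<and>
     (\<forall>T. T \<subseteq> V \<longrightarrow> T \<noteq> {} \<longrightarrow> deg V w' T \<le> \<theta> (card T) + K * \<tau> ^ card T * m / card V)"

lemma link_stateD:
  assumes "link_state V r K \<tau> m \<theta> w S w'"
  shows "S \<subseteq> V" "\<And>e. 0 \<le> w' e"
    "\<And>f. w' f \<noteq> 0 \<Longrightarrow> f \<subseteq> V \<and> card f = r" "\<And>f. w' f \<noteq> 0 \<Longrightarrow> \<exists>e. w e \<noteq> 0 \<and> e \<subseteq> f \<union> S"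
    "deg V w' {} \<le> card S * (K * m / card V)" "card S * (m / (4 * card V)) \<le> deg V w' {}"
    "\<And>T. T \<subseteq> V \<Longrightarrow> T \<noteq> {} \<Longrightarrow> deg V w' T \<le> \<theta> (card T) + K * \<tau> ^ card T * m / card V"
  using assms by (simp_all add: link_state_def)

text \<open>A set \<open>T\<close> gains weight only if it avoids \<open>v\<close> and is not yet
  saturated, because active edges contain no saturated set. A single gain is at most the codegree of
  \<open>insert v T\<close>, whose exponent is \<open>card T\<close>; this is the overshoot that the
  invariant allows.\<close>

lemma link_state_step:
  assumes fin: "finite V" and w: "spread V (Suc r) K \<tau> m w" and KN: "0 \<le> K" "0 \<le> \<tau>"
    and st: "link_state V r K \<tau> m \<theta> w S w'"
    and v: "v \<in> V" "v \<notin> S" "m / (4 * card V) \<le> deg V (active V w \<theta> S w') {v}"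
  shows "link_state V r K \<tau> m \<theta> w (insert v S)
    (\<lambda>f. w' f + (if v \<notin> f then active V w \<theta> S w' (insert v f) else 0))"
proof -
  note wnn = spreadD(1)[OF w] and wsupp = spreadD(2)[OF w] and m = spreadD(3)[OF w] and codeg = spreadD(5)[OF w]
  note S = link_stateD(1)[OF st] and w'nn = link_stateD(2)[OF st] and w'supp = link_stateD(3,4)[OF st]
    and mass = link_stateD(5,6)[OF st] and codeg' = link_stateD(7)[OF st]
  define A where "A = active V w \<theta> S w'"
  define w2 where "w2 = (\<lambda>f. w' f + (if v \<notin> f then A (insert v f) else 0))"
  have Ann: "0 \<le> A e" and Ale: "A e \<le> w e" for e by (auto simp: A_def active_def wnn)
  have deg2: "deg V w2 T = deg V w' T + (if v \<in> T then 0 else deg V A (insert v T))" for T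
    unfolding w2_def by (simp add: deg_add deg_link[OF fin v(1)])
  have cS: "card (insert v S) = Suc (card S)" using v(2) finite_subset[OF S fin] by simp
  have dA: "deg V A {v} \<le> K * m / card V"
    using deg_mono[where w = A and w' = w and T = "{v}", OF fin Ale] codeg[of "{v}"] v(1) by fastforce
  have "f \<subseteq> V \<and> card f = r \<and> (\<exists>e. w e \<noteq> 0 \<and> e \<subseteq> f \<union> insert v S)" if f: "w2 f \<noteq> 0" for f
  proof (cases "w' f = 0")
    case False
    then show ?thesis using w'supp[of f] by blast
  next
    case True
    with f have vf: "v \<notin> f" "A (insert v f) \<noteq> 0" by (simp_all add: w2_def split: if_splits)
    then have wf: "w (insert v f) \<noteq> 0" using Ann[of "insert v f"] Ale[of "insert v f"] by linarith
    then have e: "insert v f \<subseteq> V" "card (insert v f) = Suc r" using wsupp by blast+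
    have "finite f" by (rule finite_subset[OF _ fin]) (use e(1) in simp)
    then have "card f = r" using e(2) vf(1) by simp
    moreover have "insert v f \<subseteq> f \<union> insert v S" by blast
    ultimately show ?thesis using e(1) wf by blast
  qed
  moreover have "deg V w2 T \<le> \<theta> (card T) + K * \<tau> ^ card T * m / card V" if T: "T \<subseteq> V" "T \<noteq> {}" for T
  proof (cases "v \<in> T \<or> \<theta> (card T) < deg V w' T")
    \<comment> \<open>Such a \<open>T\<close> gains nothing: link edges avoid \<open>v\<close>, and
      no active edge contains a saturated set.\<close>
    case True
    have "deg V A (insert v T) = 0" if "v \<notin> T"
    proof -
      have sat: "\<not> deg V w' T \<le> \<theta> (card T)" using True that by simp
      have "A e = 0" if "T \<subseteq> e" for e
      proof -
        have "\<not> (\<forall>T. T \<subseteq> e \<longrightarrow> T \<noteq> {} \<longrightarrow> deg V w' T \<le> \<theta> (card T))"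
          by (intro notI, drule spec[of _ T]) (use that T(2) sat in simp)
        then show ?thesis unfolding A_def active_def by (simp only: simp_thms if_False)
      qed
      then show ?thesis unfolding deg_def by (intro sum.neutral) blast
    qed
    then show ?thesis using codeg'[OF T] deg2[of T] by auto
  next
    case False
    have "finite T" by (rule finite_subset[OF T(1) fin])
    then have "card (insert v T) - 1 = card T" using False by simp
    then have "deg V w (insert v T) \<le> K * \<tau> ^ card T * m / card V"
      using codeg[of "insert v T"] T(1) v(1) by auto
    then show ?thesis using False deg2[of T] deg_mono[where w = A and w' = w and T = "insert v T", OF fin Ale] by simp
  qed
  moreover have "deg V w2 {} \<le> card (insert v S) * (K * m / card V)"
    using deg2[of "{}"] mass(1) dA unfolding cS of_nat_Suc distrib_right by simp
  moreover have "card (insert v S) * (m / (4 * card V)) \<le> deg V w2 {}"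
    using deg2[of "{}"] mass(2) v(3)[folded A_def] unfolding cS of_nat_Suc distrib_right by simp
  moreover have "0 \<le> w2 e" for e using w'nn Ann by (simp add: w2_def)
  ultimately have "link_state V r K \<tau> m \<theta> w (insert v S) w2"
    using S v(1) unfolding link_state_def by blast
  then show ?thesis unfolding w2_def A_def .
qed

text \<open>
  Here \<open>X\<close> collects vertices known to lie outside the independent set and \<open>S\<close> vertices known to
  lie inside it; the induction is a decision tree that queries a vertex of large active degree.
\<close>

lemma container_tree:
  fixes K \<tau> m s \<delta> :: real
  assumes fin: "finite V" and w: "spread V (Suc r) K \<tau> m w"
    and K: "1 \<le> K" and \<tau>: "0 < \<tau>" "\<tau> \<le> 1 / (8 * K)"
    and \<theta>: "\<And>t. \<theta> t = 2 ^ (r + 3) * K\<^sup>2 * \<tau> ^ t * m / card V"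
    and b: "real b \<le> 2 * \<tau> * card V"
    and \<delta>: "\<delta> \<le> 1 / (4 * K)"
    and full: "\<And>S w'. link_state V r K \<tau> m \<theta> w S w' \<Longrightarrow> card S = b \<Longrightarrow>
      \<exists>f. \<forall>I. I \<subseteq> V \<longrightarrow> independent_in w' I \<longrightarrow> container_for V r (2 * \<tau> * card V) ((1 - \<delta>) * card V) f I"
    and st: "link_state V r K \<tau> m \<theta> w S w'" "card S \<le> b" and X: "X \<subseteq> V"
  shows "\<exists>f. \<forall>I. I \<subseteq> V \<longrightarrow> S \<subseteq> I \<longrightarrow> X \<inter> I = {} \<longrightarrow> independent_in w I \<longrightarrow>
     (\<exists>S'. S \<subseteq> S' \<and> S' \<subseteq> I \<and> card S' \<le> b \<and>
        container_for V r (2 * \<tau> * card V) ((1 - \<delta>) * card V) (f S') I)"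
  using st X
proof (induction "card (V - (S \<union> X))" arbitrary: S X w' rule: less_induct)
  case less
  have S: "S \<subseteq> V" using less.prems(1) by (simp add: link_state_def)
  \<comment> \<open>Either \<open>S\<close> is large enough for \<open>w'\<close> to be handed to
    uniformity \<open>r\<close>, or some undecided vertex has large active degree and is queried, or
    the tree is stuck and \<open>V - X\<close> is already a small container.\<close>
  consider "card S = b"
    | "card S < b" "\<exists>v\<in>V - S - X. m / (4 * card V) \<le> deg V (active V w \<theta> S w') {v}"
    | "\<And>v. v \<in> V - S - X \<Longrightarrow> deg V (active V w \<theta> S w') {v} < m / (4 * card V)"
    using less.prems(2) by force
  then show ?case
  proof cases
    case 1
    from full[OF less.prems(1) 1] obtain f where
      f: "\<And>I. I \<subseteq> V \<Longrightarrow> independent_in w' I \<Longrightarrow> container_for V r (2 * \<tau> * card V) ((1 - \<delta>) * card V) f I"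
      by blast
    show ?thesis
    proof (intro exI[of _ "\<lambda>_. f"] allI impI exI[of _ S] conjI)
      fix I assume I: "I \<subseteq> V" "S \<subseteq> I" "X \<inter> I = {}" "independent_in w I"
      have "independent_in w' I" unfolding independent_in_def
      proof (intro allI impI)
        fix e assume "e \<subseteq> I"
        then show "w' e = 0" using less.prems(1) I(2,4) unfolding link_state_def independent_in_def
          by (meson Un_least order_trans)
      qed
      then show "container_for V r (2 * \<tau> * card V) ((1 - \<delta>) * card V) f I"
        using f[OF I(1)] by (simp add: container_for_def)
    qed (use 1 in auto)
  next
    case 2
    then obtain v where v: "v \<in> V" "v \<notin> S" "v \<notin> X" "m / (4 * card V) \<le> deg V (active V w \<theta> S w') {v}"
      by blast
    have cS: "card (insert v S) = Suc (card S)" using v(2) finite_subset[OF S fin] by simp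
    have less1: "card (V - (insert v S \<union> X)) < card (V - (S \<union> X))"
      "card (V - (S \<union> insert v X)) < card (V - (S \<union> X))"
      by (rule psubset_card_mono; use fin v in blast)+
    obtain f1 where f1: "\<And>I. I \<subseteq> V \<Longrightarrow> insert v S \<subseteq> I \<Longrightarrow> X \<inter> I = {} \<Longrightarrow> independent_in w I \<Longrightarrow>
     (\<exists>S'. insert v S \<subseteq> S' \<and> S' \<subseteq> I \<and> card S' \<le> b \<and>
        container_for V r (2 * \<tau> * card V) ((1 - \<delta>) * card V) (f1 S') I)"
    proof -
      have "0 \<le> K" "0 \<le> \<tau>" "card (insert v S) \<le> b" using K \<tau> 2(1) cS by auto
      from less.hyps[OF less1(1) link_state_step[OF fin w this(1,2) less.prems(1) v(1,2,4)] this(3) less.prems(3)]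
      show ?thesis using that by blast
    qed
    obtain f2 where f2: "\<And>I. I \<subseteq> V \<Longrightarrow> S \<subseteq> I \<Longrightarrow> insert v X \<inter> I = {} \<Longrightarrow> independent_in w I \<Longrightarrow>
     (\<exists>S'. S \<subseteq> S' \<and> S' \<subseteq> I \<and> card S' \<le> b \<and>
        container_for V r (2 * \<tau> * card V) ((1 - \<delta>) * card V) (f2 S') I)"
    proof -
      have "insert v X \<subseteq> V" using less.prems(3) v(1) by auto
      from less.hyps[OF less1(2) less.prems(1,2) this] show ?thesis using that by blast
    qed
    show ?thesis
    \<comment> \<open>The fingerprint remembers the answer to the query: if \<open>v\<close> is in
      \<open>I\<close> it was put into \<open>S'\<close>, and otherwise
      \<open>S' \<subseteq> I\<close> excludes it. So the branch, and hence the container, depends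
      on \<open>S'\<close> alone.\<close>
    proof (intro exI[of _ "\<lambda>S'. if v \<in> S' then f1 S' else f2 S'"] allI impI)
      fix I assume I: "I \<subseteq> V" "S \<subseteq> I" "X \<inter> I = {}" "independent_in w I"
      show "\<exists>S'. S \<subseteq> S' \<and> S' \<subseteq> I \<and> card S' \<le> b \<and> container_for V r (2 * \<tau> * card V)
        ((1 - \<delta>) * card V) (if v \<in> S' then f1 S' else f2 S') I"
      proof (cases "v \<in> I")
        case True
        then obtain S' where "insert v S \<subseteq> S'" "S' \<subseteq> I" "card S' \<le> b"
          "container_for V r (2 * \<tau> * card V) ((1 - \<delta>) * card V) (f1 S') I"
          using f1[of I] I by blast
        moreover have "v \<in> S'" "S \<subseteq> S'" using calculation(1) by auto
        ultimately show ?thesis by (intro exI[of _ S']) simp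
      next
        case False
        then obtain S' where "S \<subseteq> S'" "S' \<subseteq> I" "card S' \<le> b"
          "container_for V r (2 * \<tau> * card V) ((1 - \<delta>) * card V) (f2 S') I"
          using f2[of I] I False by blast
        moreover have "v \<notin> S'" using calculation(2) False by auto
        ultimately show ?thesis by (intro exI[of _ S']) simp
      qed
    qed
  next
    case 3
    have big: "card V / (4 * K) \<le> card X"
    proof (rule excluded_large[where w = w and w' = w' and \<theta> = \<theta> and S = S and X = X])
      show "deg V w' {} \<le> card S * (K * m / card V)" "\<And>e. 0 \<le> w' e"
        "\<And>e. w' e \<noteq> 0 \<Longrightarrow> e \<subseteq> V \<and> card e = r"
        by (fact link_stateD[OF less.prems(1)])+
      show "real (card S) \<le> 2 * \<tau> * card V" using less.prems(2) b by linarith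
      show "0 < K" using K by simp
    qed (fact fin w \<tau> \<theta> S less.prems(3) 3)+
    have "real (card (V - X)) = real (card V) - real (card X)"
    proof -
      have "card (V - X) = card V - card X" "card X \<le> card V"
        using less.prems(3) fin by (auto simp: card_Diff_subset finite_subset card_mono)
      then show ?thesis by (simp only: of_nat_diff)
    qed
    also have "\<dots> \<le> real (card V) - 1 / (4 * K) * card V" using big by simp
    also have "\<dots> \<le> (1 - \<delta>) * card V"
      using mult_right_mono[OF \<delta>, of "card V"] by (simp add: algebra_simps)
    finally have card: "real (card (V - X)) \<le> (1 - \<delta>) * card V" .
    show ?thesis
    proof (intro exI[of _ "\<lambda>_ _. V - X"] allI impI exI[of _ S] conjI)
      fix I assume I: "I \<subseteq> V" "S \<subseteq> I" "X \<inter> I = {}" "independent_in w I"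
      show "container_for V r (2 * \<tau> * card V) ((1 - \<delta>) * card V) (\<lambda>_. V - X) I"
        unfolding container_for_def
      \<comment> \<open>No further fingerprint is required here; empty sets pad the list to the
        prescribed length.\<close>
      proof (intro exI[of _ "replicate r ({} :: 'a set)"] conjI ballI)
        fix T :: "'a set" assume "T \<in> set (replicate r {})"
        then have "T = {}" by simp
        then show "T \<subseteq> I" "real (card T) \<le> 2 * \<tau> * card V" using \<tau> by auto
      qed (use card I(1,3) in auto)
    qed (use less.prems(2) in auto)
  qed
qed

text \<open>By induction on the uniformity, with \<open>K\<close> generalised because the
  accumulated links of a spread hypergraph are spread only for a larger constant. The gain
  \<open>\<delta>\<close> depends on \<open>r\<close> and \<open>K\<close> but not on
  \<open>V\<close>, which is what makes iteration possible.\<close>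

lemma container_one_step:
  fixes K :: real
  assumes "1 \<le> K"
  shows "\<exists>(\<delta>::real) (\<tau>\<^sub>0::real). 0 < \<delta> \<and> \<delta> \<le> 1 \<and> 0 < \<tau>\<^sub>0 \<and>
    (\<forall>V (w :: 'v set \<Rightarrow> real) m (\<tau>::real). finite V \<longrightarrow> spread V r K \<tau> m w \<longrightarrow> 0 < \<tau> \<longrightarrow> \<tau> \<le> \<tau>\<^sub>0 \<longrightarrow> 1 \<le> \<tau> * card V \<longrightarrow>
      (\<exists>f. \<forall>I. I \<subseteq> V \<longrightarrow> independent_in w I \<longrightarrow>
         container_for V r (2 * \<tau> * card V) ((1 - \<delta>) * card V) f I))"
  using assms
proof (induction r arbitrary: K)
  case 0
  \<comment> \<open>In uniformity 0 all the mass sits on the empty edge, which lies in every set;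
    there is no independent set and the claim is vacuous.\<close>
  have "\<not> independent_in w I" if "spread V 0 K \<tau> m w" "finite V" for V I :: "'v set" and w and m \<tau> :: real
  proof
    assume ind: "independent_in w I"
    have "w e = 0" if "e \<subseteq> V" for e
    proof (cases "e = {}")
      case True then show ?thesis using ind by (auto simp: independent_in_def)
    next
      case False
      have "finite e" by (rule finite_subset[OF \<open>e \<subseteq> V\<close> \<open>finite V\<close>])
      then show ?thesis using False \<open>spread V 0 K \<tau> m w\<close> unfolding spread_def by (metis card_0_eq)
    qed
    then have "deg V w {} = 0" by (simp add: deg_def)
    moreover have "0 < m" "m \<le> deg V w {}" using spreadD(3,4)[OF \<open>spread V 0 K \<tau> m w\<close>] by auto
    ultimately show False by simp
  qed
  then show ?case by (intro exI[of _ 1]) auto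
next
  case (Suc r)
  \<comment> \<open>The links have codegrees at most
    \<open>(2 ^ (r + 3) * K\<^sup>2 + K) * \<tau> ^ t * m / card V\<close> and mass at least
    \<open>\<tau> * m / 4\<close>; dividing one by the other gives the factor 4.\<close>
  define K' where "K' = 4 * (2 ^ (r + 3) * K\<^sup>2 + K)"
  have "1 \<le> K'" using Suc.prems by (simp add: K'_def add_increasing)
  from Suc.IH[OF this] obtain \<delta>' \<tau>' :: real where IH0: "0 < \<delta>' \<and> \<delta>' \<le> 1 \<and> 0 < \<tau>' \<and>
    (\<forall>V (w :: 'v set \<Rightarrow> real) m (\<tau>::real). finite V \<longrightarrow> spread V r K' \<tau> m w \<longrightarrow> 0 < \<tau> \<longrightarrow> \<tau> \<le> \<tau>' \<longrightarrow> 1 \<le> \<tau> * card V \<longrightarrow>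
      (\<exists>f. \<forall>I. I \<subseteq> V \<longrightarrow> independent_in w I \<longrightarrow>
         container_for V r (2 * \<tau> * card V) ((1 - \<delta>') * card V) f I))"
    by (elim exE) (rule that)
  note IH = IH0[THEN conjunct1] IH0[THEN conjunct2, THEN conjunct1]
    IH0[THEN conjunct2, THEN conjunct2, THEN conjunct1] IH0[THEN conjunct2, THEN conjunct2, THEN conjunct2]
  \<comment> \<open>\<open>\<delta>'\<close> is the gain when \<open>S\<close> fills up and the
    links take over, \<open>1 / (4 * K)\<close> the share of excluded vertices when the tree is
    stuck.\<close>
  define \<delta> where "\<delta> = min \<delta>' (1 / (4 * K))"
  have \<delta>: "0 < \<delta>" "\<delta> \<le> 1" "\<delta> \<le> \<delta>'" "\<delta> \<le> 1 / (4 * K)"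
    using IH(1,2) Suc.prems by (auto simp: \<delta>_def)
  define \<tau>0 where "\<tau>0 = min \<tau>' (1 / (8 * K))"
  show ?case
  proof (rule exI[of _ \<delta>], rule exI[of _ \<tau>0], intro conjI allI impI)
    show "0 < \<tau>0" using IH(3) Suc.prems by (simp add: \<tau>0_def)
    fix V :: "'v set" and w :: "'v set \<Rightarrow> real" and m \<tau> :: real
    assume fin: "finite V" and w: "spread V (Suc r) K \<tau> m w" and \<tau>: "0 < \<tau>" "\<tau> \<le> \<tau>0" "1 \<le> \<tau> * card V"
    have \<tau>': "\<tau> \<le> \<tau>'" "\<tau> \<le> 1 / (8 * K)" using \<tau>(2) by (auto simp: \<tau>0_def)
    have N: "0 < real (card V)" using spread_nonempty[OF w fin] by simp
    have m: "0 < m" using w by (simp add: spread_def)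
    define \<theta> where "\<theta> = (\<lambda>t::nat. 2 ^ (r + 3) * K\<^sup>2 * \<tau> ^ t * m / card V)"
    \<comment> \<open>Rounding up gives the links mass at least \<open>\<tau> * m / 4\<close>; since
      \<open>1 \<le> \<tau> * card V\<close>, it at most doubles the size of the
      fingerprint.\<close>
    define b where "b = nat \<lceil>\<tau> * card V\<rceil>"
    have b: "\<tau> * card V \<le> b" "real b \<le> 2 * \<tau> * card V"
      unfolding b_def using \<tau>(3) by linarith+
    have full: "\<exists>f. \<forall>I. I \<subseteq> V \<longrightarrow> independent_in w' I \<longrightarrow> container_for V r (2 * \<tau> * card V) ((1 - \<delta>) * card V) f I"
      if st: "link_state V r K \<tau> m \<theta> w S w'" and S: "card S = b" for S w'
    proof -
      have sp: "spread V r K' \<tau> (\<tau> * m / 4) w'"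
        unfolding spread_def
      proof (intro conjI allI impI)
        show "0 < \<tau> * m / 4" using \<tau> m by simp
        have "\<tau> * m / 4 = \<tau> * card V * (m / (4 * card V))" using N by simp
        also have "\<dots> \<le> b * (m / (4 * card V))" using b(1) m N by (intro mult_right_mono) auto
        also have "\<dots> \<le> deg V w' {}" using link_stateD(6)[OF st] S by simp
        finally show "\<tau> * m / 4 \<le> deg V w' {}" .
        fix T assume T: "T \<subseteq> V" "T \<noteq> {}"
        have "finite T" by (rule finite_subset[OF T(1) fin])
        then have "card T \<noteq> 0" using T(2) by simp
        then have ct: "\<tau> ^ card T = \<tau> * \<tau> ^ (card T - 1)" by (cases "card T") auto
        have "deg V w' T \<le> \<theta> (card T) + K * \<tau> ^ card T * m / card V"
          by (rule link_stateD(7)[OF st T])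
        also have "\<dots> = K' * \<tau> ^ (card T - 1) * (\<tau> * m / 4) / card V"
          unfolding \<theta>_def ct K'_def by (simp add: add_divide_distrib[symmetric] algebra_simps)
        finally show "deg V w' T \<le> K' * \<tau> ^ (card T - 1) * (\<tau> * m / 4) / card V" .
      qed (use link_stateD(2,3)[OF st] in auto)
      from IH(4)[rule_format, OF fin sp \<tau>(1) \<tau>'(1) \<tau>(3)] obtain f where
        f: "\<And>I. I \<subseteq> V \<Longrightarrow> independent_in w' I \<Longrightarrow>
          container_for V r (2 * \<tau> * card V) ((1 - \<delta>') * card V) f I" by blast
      have le: "(1 - \<delta>') * card V \<le> (1 - \<delta>) * card V" using \<delta>(3) by (intro mult_right_mono) auto
      show ?thesis
        using container_for_mono[OF f order_refl le] by blast
    qed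
    have "0 \<le> \<theta> t + K * \<tau> ^ t * m / card V" for t
      using Suc.prems \<tau>(1) m by (simp add: \<theta>_def)
    then have init: "link_state V r K \<tau> m \<theta> w {} (\<lambda>_. 0)"
      unfolding link_state_def by (simp add: deg_def)
    have "\<exists>f. \<forall>I. I \<subseteq> V \<longrightarrow> {} \<subseteq> I \<longrightarrow> {} \<inter> I = {} \<longrightarrow> independent_in w I \<longrightarrow>
     (\<exists>S'. {} \<subseteq> S' \<and> S' \<subseteq> I \<and> card S' \<le> b \<and>
        container_for V r (2 * \<tau> * card V) ((1 - \<delta>) * card V) (f S') I)"
    proof (rule container_tree[OF fin w Suc.prems \<tau>(1) \<tau>'(2) _ b(2) \<delta>(4) full init])
      show "\<theta> t = 2 ^ (r + 3) * K\<^sup>2 * \<tau> ^ t * m / card V" for t by (simp add: \<theta>_def)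
    qed auto
    then obtain f where f: "\<And>I. I \<subseteq> V \<Longrightarrow> independent_in w I \<Longrightarrow>
     (\<exists>S'. S' \<subseteq> I \<and> card S' \<le> b \<and>
        container_for V r (2 * \<tau> * card V) ((1 - \<delta>) * card V) (f S') I)"
      by auto
    show "\<exists>f. \<forall>I. I \<subseteq> V \<longrightarrow> independent_in w I \<longrightarrow>
         container_for V (Suc r) (2 * \<tau> * card V) ((1 - \<delta>) * card V) f I"
    proof (intro exI[of _ "\<lambda>Ss. f (hd Ss) (tl Ss)"] allI impI)
      fix I assume I: "I \<subseteq> V" "independent_in w I"
      then obtain S' Ss where "S' \<subseteq> I" "card S' \<le> b" "length Ss = r"
        "\<forall>S\<in>set Ss. S \<subseteq> I \<and> real (card S) \<le> 2 * \<tau> * card V" "I \<subseteq> f S' Ss" "f S' Ss \<subseteq> V"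
        "real (card (f S' Ss)) \<le> (1 - \<delta>) * card V"
        using f[OF I] unfolding container_for_def by blast
      then show "container_for V (Suc r) (2 * \<tau> * card V) ((1 - \<delta>) * card V) (\<lambda>Ss. f (hd Ss) (tl Ss)) I"
        unfolding container_for_def using b(2) by (intro exI[of _ "S' # Ss"]) auto
    qed
  qed (use \<delta> in auto)
qed

section \<open>Iterating the one-step lemma\<close>

lemma deg_restrict:
  assumes "finite V" "C \<subseteq> V" "\<And>e. 0 \<le> w e"
  shows "deg C (\<lambda>e. if e \<subseteq> C then w e else 0) T \<le> deg V w T"
    and "deg C (\<lambda>e. if e \<subseteq> C then w e else 0) T = deg C w T"
proof -
  show eq: "deg C (\<lambda>e. if e \<subseteq> C then w e else 0) T = deg C w T"
    unfolding deg_def by (intro sum.cong) auto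
  show "deg C (\<lambda>e. if e \<subseteq> C then w e else 0) T \<le> deg V w T"
    unfolding eq unfolding deg_def using assms(2,3) finite_edge_set[OF assms(1)]
    by (intro sum_mono2) auto
qed

text \<open>Used in both directions: a container that still carries mass
  \<open>\<epsilon> * m\<close> has at least \<open>\<epsilon> * card V / K\<close> vertices, and a
  sufficiently small container carries little mass.\<close>

lemma induced_mass_le:
  assumes fin: "finite V" and w: "spread V r K \<tau> m w" and r: "0 < r" and C: "C \<subseteq> V"
  shows "deg C w {} \<le> card C * (K * m / card V)"
proof -
  note wnn = spreadD(1)[OF w] and wsupp = spreadD(2)[OF w] and codeg = spreadD(5)[OF w]
  define u where "u = (\<lambda>e. if e \<subseteq> C then w e else 0)"
  have finC: "finite C" by (rule finite_subset[OF C fin])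
  have unn: "0 \<le> u e" for e by (simp add: u_def wnn)
  have uC: "deg C u T = deg C w T" "deg C u T \<le> deg V w T" for T
    unfolding u_def using deg_restrict[where w = w, OF fin C wnn] by blast+
  have usupp: "e \<subseteq> C \<and> card e = r" if "u e \<noteq> 0" for e
    using that wsupp[of e] by (auto simp: u_def split: if_splits)
  have "1 * deg C u {} \<le> real r * deg C u {}"
    using r by (intro mult_right_mono deg_nonneg unn) auto
  also have "\<dots> = (\<Sum>v\<in>C. deg C u {v})" using sum_deg_vertices[OF finC usupp] by simp
  also have "\<dots> \<le> (\<Sum>v\<in>C. K * m / card V)"
  proof (rule sum_mono)
    fix v assume "v \<in> C"
    then show "deg C u {v} \<le> K * m / card V"
      using order_trans[OF uC(2)[of "{v}"] codeg[of "{v}"]] C by auto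
  qed
  finally show ?thesis using uC(1) by simp
qed

text \<open>While a container carries mass at least \<open>\<epsilon> * m\<close>, it is itself
  spread with constant \<open>K / \<epsilon>\<close>, its own mass replacing \<open>m\<close>, and
  so shrinks by the factor \<open>1 - \<delta>\<close>. After \<open>j\<close> rounds with
  \<open>(1 - \<delta>) ^ j < \<epsilon> / K\<close> it is too small to carry such mass. Neither
  \<open>j\<close> nor the thresholds depend on \<open>V\<close>.\<close>

theorem hypergraph_containers:
  fixes K \<epsilon> :: real
  assumes K: "1 \<le> K" and \<epsilon>: "0 < \<epsilon>" "\<epsilon> \<le> 1" and r: "0 < r"
  shows "\<exists>k (\<tau>\<^sub>0::real) (B::real). 0 < \<tau>\<^sub>0 \<and>
    (\<forall>V (w :: 'v set \<Rightarrow> real) m (\<tau>::real). finite V \<longrightarrow> spread V r K \<tau> m w \<longrightarrow> 0 < \<tau> \<longrightarrow> \<tau> \<le> \<tau>\<^sub>0 \<longrightarrow> B \<le> \<tau> * card V \<longrightarrow>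
      (\<exists>f. \<forall>I. I \<subseteq> V \<longrightarrow> independent_in w I \<longrightarrow>
         (\<exists>Ss. length Ss = k \<and> (\<forall>S\<in>set Ss. S \<subseteq> I \<and> real (card S) \<le> 2 * \<tau> * card V) \<and>
            I \<subseteq> f Ss \<and> f Ss \<subseteq> V \<and> deg (f Ss) w {} < \<epsilon> * m)))"
proof -
  have K\<epsilon>: "1 \<le> K / \<epsilon>" using K \<epsilon> by (simp add: field_simps)
  from container_one_step[OF this, of r] obtain \<delta> \<tau>0 :: real where \<delta>0: "0 < \<delta> \<and> \<delta> \<le> 1 \<and> 0 < \<tau>0 \<and>
    (\<forall>V (w :: 'v set \<Rightarrow> real) m (\<tau>::real). finite V \<longrightarrow> spread V r (K / \<epsilon>) \<tau> m w \<longrightarrow> 0 < \<tau> \<longrightarrow> \<tau> \<le> \<tau>0 \<longrightarrow>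
       1 \<le> \<tau> * card V \<longrightarrow> (\<exists>f. \<forall>I. I \<subseteq> V \<longrightarrow> independent_in w I \<longrightarrow>
         container_for V r (2 * \<tau> * card V) ((1 - \<delta>) * card V) f I))"
    by (elim exE) (rule that)
  note \<delta> = \<delta>0[THEN conjunct1] \<delta>0[THEN conjunct2, THEN conjunct1]
    \<delta>0[THEN conjunct2, THEN conjunct2, THEN conjunct1]
  note one = \<delta>0[THEN conjunct2, THEN conjunct2, THEN conjunct2]
  have iter: "\<exists>f. \<forall>I. I \<subseteq> V \<longrightarrow> independent_in w I \<longrightarrow>
         (\<exists>Ss. length Ss = j * r \<and> (\<forall>S\<in>set Ss. S \<subseteq> I \<and> real (card S) \<le> 2 * \<tau> * card V) \<and>
            I \<subseteq> f Ss \<and> f Ss \<subseteq> V \<and> (deg (f Ss) w {} < \<epsilon> * m \<or> card (f Ss) \<le> (1 - \<delta>) ^ j * card V))"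
    if fin: "finite V" and w: "spread V r K \<tau> m w" and \<tau>: "0 < \<tau>" "\<tau> \<le> \<tau>0" "K / \<epsilon> \<le> \<tau> * card V"
    for V :: "'v set" and w and m \<tau> :: real and j
  proof (induction j)
    case 0
    show ?case by (intro exI[of _ "\<lambda>_. V"]) auto
  next
    case (Suc j)
    then obtain f where f: "\<And>I. I \<subseteq> V \<Longrightarrow> independent_in w I \<Longrightarrow>
         (\<exists>Ss. length Ss = j * r \<and> (\<forall>S\<in>set Ss. S \<subseteq> I \<and> real (card S) \<le> 2 * \<tau> * card V) \<and>
            I \<subseteq> f Ss \<and> f Ss \<subseteq> V \<and> (deg (f Ss) w {} < \<epsilon> * m \<or> card (f Ss) \<le> (1 - \<delta>) ^ j * card V))"
      by blast
    note wnn = spreadD(1)[OF w] and wsupp = spreadD(2)[OF w] and m = spreadD(3)[OF w] and codeg = spreadD(5)[OF w]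
    have N: "0 < real (card V)" using spread_nonempty[of V "r - 1" K \<tau> m w] w fin r by simp
    define u where "u = (\<lambda>C e. if e \<subseteq> C then w e else 0)"
    have unn: "0 \<le> u C e" for C e by (simp add: u_def wnn)
    have "\<exists>g. \<forall>I. I \<subseteq> C \<longrightarrow> independent_in w I \<longrightarrow>
        container_for C r (2 * \<tau> * card V) ((1 - \<delta>) * card C) g I"
      if C: "C \<subseteq> V" "\<epsilon> * m \<le> deg C w {}" for C
    proof -
      have finC: "finite C" by (rule finite_subset[OF C(1) fin])
      have uC: "deg C (u C) T = deg C w T" "deg C (u C) T \<le> deg V w T" for T
        unfolding u_def using deg_restrict[where w = w, OF fin C(1) wnn] by blast+
      have cC: "real (card C) \<le> card V" using card_mono[OF fin C(1)] by simp
      have usupp: "e \<subseteq> C \<and> card e = r" if "u C e \<noteq> 0" for e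
        using that wsupp[of e] by (auto simp: u_def split: if_splits)
      note C(2)
      also have "deg C w {} \<le> (card C * K / card V) * m" using induced_mass_le[OF fin w r C(1)] by simp
      finally have "\<epsilon> \<le> card C * K / card V" using m by (rule mult_right_le_imp_le)
      then have lower: "\<epsilon> * card V \<le> card C * K" using N by (simp add: field_simps)
      have Cpos: "0 < real (card C)"
      proof (rule ccontr)
        assume "\<not> 0 < real (card C)"
        then have "real (card C) = 0" by simp
        then have "\<epsilon> * card V \<le> 0" using lower by simp
        then show False using \<epsilon>(1) N by (simp add: mult_le_0_iff)
      qed
      \<comment> \<open>The threshold \<open>K / \<epsilon>\<close> on
        \<open>\<tau> * card V\<close> is chosen so that every container still in play satisfies the
        size condition of the one-step lemma.\<close>
      have "1 = \<epsilon> / K * (K / \<epsilon>)" using K \<epsilon> by simp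
      also have "\<dots> \<le> \<epsilon> / K * (\<tau> * card V)" using \<tau>(3) K \<epsilon> by (intro mult_left_mono) auto
      also have "\<dots> = \<tau> * (\<epsilon> * card V / K)" by simp
      also have "\<dots> \<le> \<tau> * card C" using lower \<tau>(1) K by (intro mult_left_mono) (auto simp: field_simps)
      finally have "1 \<le> \<tau> * card C" .
      moreover have "spread C r (K / \<epsilon>) \<tau> (deg C w {}) (u C)"
        unfolding spread_def
      proof (intro conjI allI impI)
        show "0 < deg C w {}" using C(2) m \<epsilon>(1) by (meson mult_pos_pos less_le_trans)
        show "deg C w {} \<le> deg C (u C) {}" using uC(1) by simp
        fix T assume T: "T \<subseteq> C" "T \<noteq> {}"
        have "deg C (u C) T \<le> K * \<tau> ^ (card T - 1) * m / card V"
          using order_trans[OF uC(2)[of T] codeg[of T]] T C(1) by auto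
        also have "\<dots> = K / \<epsilon> * \<tau> ^ (card T - 1) * (\<epsilon> * m) / card V" using \<epsilon> by simp
        also have "\<dots> \<le> K / \<epsilon> * \<tau> ^ (card T - 1) * deg C w {} / card V"
          using C(2) K \<epsilon> \<tau>(1) by (intro divide_right_mono mult_left_mono) auto
        also have "\<dots> \<le> K / \<epsilon> * \<tau> ^ (card T - 1) * deg C w {} / card C"
          using cC Cpos K \<epsilon> \<tau>(1) by (intro divide_left_mono mult_nonneg_nonneg deg_nonneg wnn mult_pos_pos) auto
        finally show "deg C (u C) T \<le> K / \<epsilon> * \<tau> ^ (card T - 1) * deg C w {} / card C" .
      qed (use unn usupp in blast)+
      ultimately obtain g where g: "\<And>I. I \<subseteq> C \<Longrightarrow> independent_in (u C) I \<Longrightarrow>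
        container_for C r (2 * \<tau> * card C) ((1 - \<delta>) * card C) g I"
        using one[rule_format, OF finC _ \<tau>(1,2)] by blast
      have le: "2 * \<tau> * card C \<le> 2 * \<tau> * card V" using cC \<tau>(1) by (intro mult_left_mono) auto
      have "container_for C r (2 * \<tau> * card V) ((1 - \<delta>) * card C) g I"
        if I: "I \<subseteq> C" "independent_in w I" for I
      proof -
        have ind: "independent_in (u C) I" using I(2) by (auto simp: independent_in_def u_def)
        show ?thesis by (rule container_for_mono[OF g[OF I(1) ind] le order_refl])
      qed
      then show ?thesis by blast
    qed
    then obtain g where g: "\<And>C I. C \<subseteq> V \<Longrightarrow> \<epsilon> * m \<le> deg C w {} \<Longrightarrow> I \<subseteq> C \<Longrightarrow> independent_in w I \<Longrightarrow>
        container_for C r (2 * \<tau> * card V) ((1 - \<delta>) * card C) (g C) I"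
      by metis
    \<comment> \<open>The first \<open>j * r\<close> sets determine the current container, and that
      container determines whether the remaining \<open>r\<close> sets are to be read at
      all.\<close>
    define h where "h = (\<lambda>Ss. let C = f (take (j * r) Ss) in
        if deg C w {} < \<epsilon> * m then C else g C (drop (j * r) Ss))"
    show ?case
    proof (intro exI[of _ h] allI impI)
      fix I assume I: "I \<subseteq> V" "independent_in w I"
      from f[OF I] obtain Ss where Ss: "length Ss = j * r"
        "\<forall>S\<in>set Ss. S \<subseteq> I \<and> real (card S) \<le> 2 * \<tau> * card V" "I \<subseteq> f Ss" "f Ss \<subseteq> V"
        "deg (f Ss) w {} < \<epsilon> * m \<or> card (f Ss) \<le> (1 - \<delta>) ^ j * card V" by blast
      show "\<exists>Ss. length Ss = Suc j * r \<and> (\<forall>S\<in>set Ss. S \<subseteq> I \<and> real (card S) \<le> 2 * \<tau> * card V) \<and>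
            I \<subseteq> h Ss \<and> h Ss \<subseteq> V \<and> (deg (h Ss) w {} < \<epsilon> * m \<or> card (h Ss) \<le> (1 - \<delta>) ^ Suc j * card V)"
      proof (cases "deg (f Ss) w {} < \<epsilon> * m")
        case True
        \<comment> \<open>A container that is already sparse is kept, and the list is padded with
          empty sets.\<close>
        define Ts where "Ts = Ss @ replicate r {}"
        have "h Ts = f Ss" using True Ss(1) by (simp add: h_def Ts_def)
        moreover have "\<forall>S\<in>set Ts. S \<subseteq> I \<and> real (card S) \<le> 2 * \<tau> * card V"
          using Ss(2) \<tau>(1) unfolding Ts_def by (auto simp: set_replicate_conv_if)
        ultimately show ?thesis using Ss True by (intro exI[of _ Ts]) (auto simp: Ts_def)
      next
        case False
        then obtain Rs where Rs: "length Rs = r"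
          "\<forall>S\<in>set Rs. S \<subseteq> I \<and> real (card S) \<le> 2 * \<tau> * card V" "I \<subseteq> g (f Ss) Rs" "g (f Ss) Rs \<subseteq> f Ss"
          "real (card (g (f Ss) Rs)) \<le> (1 - \<delta>) * card (f Ss)"
          using g[OF Ss(4) _ Ss(3) I(2)] unfolding container_for_def by auto
        define Ts where "Ts = Ss @ Rs"
        have h: "h Ts = g (f Ss) Rs" using False Ss(1) by (simp add: h_def Ts_def)
        have "(1 - \<delta>) * card (f Ss) \<le> (1 - \<delta>) * ((1 - \<delta>) ^ j * card V)"
          using Ss(5) False \<delta> by (intro mult_left_mono) auto
        then have "card (h Ts) \<le> (1 - \<delta>) ^ Suc j * card V" using Rs(5) h by simp
        moreover have "length Ts = Suc j * r" using Ss(1) Rs(1) by (simp add: Ts_def)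
        moreover have "\<forall>S\<in>set Ts. S \<subseteq> I \<and> real (card S) \<le> 2 * \<tau> * card V"
          using Ss(2) Rs(2) unfolding Ts_def by auto
        moreover have "I \<subseteq> h Ts" "h Ts \<subseteq> V" using Rs(3,4) Ss(4) h by auto
        ultimately show ?thesis by blast
      qed
    qed
  qed
  have "1 - \<delta> < 1" using \<delta> by simp
  moreover have "0 < \<epsilon> / K" using K \<epsilon> by simp
  ultimately obtain j where j: "(1 - \<delta>) ^ j < \<epsilon> / K" using real_arch_pow_inv by blast
  show ?thesis
  proof (rule exI[of _ "j * r"], rule exI[of _ \<tau>0], rule exI[of _ "K / \<epsilon>"], intro conjI allI impI)
    fix V :: "'v set" and w :: "'v set \<Rightarrow> real" and m \<tau> :: real
    assume fin: "finite V" and w: "spread V r K \<tau> m w" and \<tau>: "0 < \<tau>" "\<tau> \<le> \<tau>0" "K / \<epsilon> \<le> \<tau> * card V"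
    note m = spreadD(3)[OF w]
    have N: "0 < real (card V)" using spread_nonempty[of V "r - 1" K \<tau> m w] w fin r by simp
    have small: "deg C w {} < \<epsilon> * m" if C: "C \<subseteq> V" "card C \<le> (1 - \<delta>) ^ j * card V" for C
    proof -
      have "deg C w {} \<le> card C * (K * m / card V)" by (rule induced_mass_le[OF fin w r C(1)])
      also have "\<dots> \<le> ((1 - \<delta>) ^ j * card V) * (K * m / card V)"
        using C(2) K m by (intro mult_right_mono) auto
      also have "\<dots> = (1 - \<delta>) ^ j * (K * m)" using N by simp
      also have "\<dots> < \<epsilon> / K * (K * m)" using j K m by (intro mult_strict_right_mono) auto
      finally show ?thesis using K by simp
    qed
    from iter[OF fin w \<tau>, of j] obtain f where f: "\<And>I. I \<subseteq> V \<Longrightarrow> independent_in w I \<Longrightarrow>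
         (\<exists>Ss. length Ss = j * r \<and> (\<forall>S\<in>set Ss. S \<subseteq> I \<and> real (card S) \<le> 2 * \<tau> * card V) \<and>
            I \<subseteq> f Ss \<and> f Ss \<subseteq> V \<and> (deg (f Ss) w {} < \<epsilon> * m \<or> card (f Ss) \<le> (1 - \<delta>) ^ j * card V))"
      by blast
    show "\<exists>f. \<forall>I. I \<subseteq> V \<longrightarrow> independent_in w I \<longrightarrow>
         (\<exists>Ss. length Ss = j * r \<and> (\<forall>S\<in>set Ss. S \<subseteq> I \<and> real (card S) \<le> 2 * \<tau> * card V) \<and>
            I \<subseteq> f Ss \<and> f Ss \<subseteq> V \<and> deg (f Ss) w {} < \<epsilon> * m)"
    proof (rule exI[of _ f], intro allI impI)
      fix I assume "I \<subseteq> V" "independent_in w I"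
      from f[OF this] obtain Ss where Ss: "length Ss = j * r"
        "\<forall>S\<in>set Ss. S \<subseteq> I \<and> real (card S) \<le> 2 * \<tau> * card V" "I \<subseteq> f Ss" "f Ss \<subseteq> V"
        "deg (f Ss) w {} < \<epsilon> * m \<or> card (f Ss) \<le> (1 - \<delta>) ^ j * card V" by blast
      then have "deg (f Ss) w {} < \<epsilon> * m" using small[OF Ss(4)] by blast
      then show "\<exists>Ss. length Ss = j * r \<and> (\<forall>S\<in>set Ss. S \<subseteq> I \<and> real (card S) \<le> 2 * \<tau> * card V) \<and>
            I \<subseteq> f Ss \<and> f Ss \<subseteq> V \<and> deg (f Ss) w {} < \<epsilon> * m" using Ss by blast
    qed
  qed (use \<delta> in auto)
qed

section \<open>Copies of a graph and the maximum 2-density\<close>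

text \<open>Labelled injections replace the copies of \<open>is_copy\<close>: each copy arises from
  as many of them as \<open>H\<close> has automorphisms, a constant factor that all later estimates
  absorb.\<close>

definition emb :: "'a graph \<Rightarrow> nat \<Rightarrow> ('a \<Rightarrow> nat) set" where
  "emb H n = {\<phi> \<in> verts H \<rightarrow>\<^sub>E {1..n}. inj_on \<phi> (verts H)}"

definition emap :: "('a \<Rightarrow> 'b) \<Rightarrow> 'a set set \<Rightarrow> 'b set set" where
  "emap \<phi> E = (\<lambda>e. \<phi> ` e) ` E"

lemma simple_graphD:
  assumes "simple_graph H"
  shows "finite (verts H)" "finite (edges H)"
    "\<And>e. e \<in> edges H \<Longrightarrow> e \<subseteq> verts H" "\<And>e. e \<in> edges H \<Longrightarrow> card e = 2"
proof -
  show 1: "finite (verts H)" and "\<And>e. e \<in> edges H \<Longrightarrow> e \<subseteq> verts H" "\<And>e. e \<in> edges H \<Longrightarrow> card e = 2"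
    using assms by (auto simp: simple_graph_def nsets_def)
  have "edges H \<subseteq> Pow (verts H)" using assms by (auto simp: simple_graph_def nsets_def)
  then show "finite (edges H)" using 1 by (simp add: finite_subset)
qed

lemma edges_complete_graph: "edges (complete_graph n) = {e. e \<subseteq> {1..n} \<and> card e = 2}"
  unfolding complete_graph_def nsets_def by (auto intro: card_ge_0_finite)

lemma finite_edges_complete_graph [simp]: "finite (edges (complete_graph n))"
  by (rule finite_subset[of _ "Pow {1..n}"]) (auto simp: edges_complete_graph)

lemma card_edges_complete_graph: "card (edges (complete_graph n)) = n choose 2"
  by (simp add: complete_graph_def)

lemma finite_emb [simp]: "simple_graph H \<Longrightarrow> finite (emb H n)"
  unfolding emb_def by (rule finite_subset[of _ "verts H \<rightarrow>\<^sub>E {1..n}"]) (auto intro!: finite_PiE simp: simple_graphD)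

lemma card_image_edge:
  assumes "simple_graph H" "inj_on \<phi> (verts H)" "e \<in> edges H"
  shows "card (\<phi> ` e) = 2"
  using assms simple_graphD(3,4)[OF assms(1,3)] by (metis card_image inj_on_subset)

lemma inj_on_image_edges:
  assumes "simple_graph H" "inj_on \<phi> (verts H)"
  shows "inj_on (\<lambda>e. \<phi> ` e) (edges H)"
  using assms simple_graphD(3)[OF assms(1)] by (meson inj_onI inj_on_image_eq_iff)

lemma emap_complete:
  assumes "simple_graph H" "\<phi> \<in> emb H n"
  shows "emap \<phi> (edges H) \<subseteq> edges (complete_graph n)"
proof
  fix f assume "f \<in> emap \<phi> (edges H)"
  then obtain e where e: "e \<in> edges H" "f = \<phi> ` e" by (auto simp: emap_def)
  then have "card f = 2" using card_image_edge[OF assms(1)] assms(2) by (auto simp: emb_def)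
  moreover have "f \<subseteq> {1..n}" using e simple_graphD(3)[OF assms(1) e(1)] assms(2) by (auto simp: emb_def)
  ultimately show "f \<in> edges (complete_graph n)" by (simp add: edges_complete_graph)
qed

text \<open>\<open>Q\<close> sees only the edge set of the copy, so the same bridge serves rainbow
  copies in \<open>G\<close> and copies with an SDR in the complete graph.\<close>

lemma is_copy_emb_iff:
  assumes H: "simple_graph H" and G: "verts G = {1..n}"
  shows "(\<exists>F. is_copy H F G \<and> Q (edges F)) \<longleftrightarrow>
    (\<exists>\<phi>\<in>emb H n. emap \<phi> (edges H) \<subseteq> edges G \<and> Q (emap \<phi> (edges H)))"
proof
  assume "\<exists>F. is_copy H F G \<and> Q (edges F)"
  then obtain F \<phi> where F: "subgraph F G" "Q (edges F)" and \<phi>: "bij_betw \<phi> (verts H) (verts F)"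
    "edges F = (\<lambda>e. \<phi> ` e) ` edges H" by (auto simp: is_copy_def isomorphic_def)
  define \<psi> where "\<psi> = restrict \<phi> (verts H)"
  have "\<phi> ` verts H \<subseteq> {1..n}" using \<phi>(1) F(1) G by (auto simp: bij_betw_def subgraph_def)
  then have "\<psi> \<in> emb H n" using \<phi>(1) unfolding emb_def \<psi>_def by (auto simp: bij_betw_def inj_on_def)
  moreover have "emap \<psi> (edges H) = edges F"
    unfolding emap_def \<phi>(2) using simple_graphD(3)[OF H]
    by (intro image_cong refl) (auto simp: \<psi>_def)
  moreover have "edges F \<subseteq> edges G" using F(1) by (simp add: subgraph_def)
  ultimately show "\<exists>\<phi>\<in>emb H n. emap \<phi> (edges H) \<subseteq> edges G \<and> Q (emap \<phi> (edges H))"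
    using F(2) by metis
next
  assume "\<exists>\<phi>\<in>emb H n. emap \<phi> (edges H) \<subseteq> edges G \<and> Q (emap \<phi> (edges H))"
  then obtain \<phi> where \<phi>: "\<phi> \<in> emb H n" "emap \<phi> (edges H) \<subseteq> edges G" "Q (emap \<phi> (edges H))" by blast
  have inj: "inj_on \<phi> (verts H)" and sub: "\<phi> ` verts H \<subseteq> {1..n}" using \<phi>(1) by (auto simp: emb_def)
  define F where "F = Graph (\<phi> ` verts H) (emap \<phi> (edges H))"
  have "simple_graph F"
    using simple_graphD[OF H] card_image_edge[OF H inj] unfolding simple_graph_def F_def emap_def nsets_def
    by (auto intro!: card_ge_0_finite)
  then have "is_copy H F G"
    using sub G \<phi>(2) inj unfolding is_copy_def subgraph_def isomorphic_def F_def
    by (auto simp: bij_betw_def emap_def)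
  then show "\<exists>F. is_copy H F G \<and> Q (edges F)" using \<phi>(3) by (auto simp: F_def)
qed

lemma card_emb_le:
  assumes "simple_graph H"
  shows "real (card (emb H n)) \<le> real n ^ nv H"
proof -
  have "card (emb H n) \<le> card (verts H \<rightarrow>\<^sub>E {1..n})"
    using simple_graphD[OF assms] by (intro card_mono finite_PiE) (auto simp: emb_def)
  also have "\<dots> = n ^ nv H" using simple_graphD[OF assms] by (simp add: card_PiE)
  finally have "card (emb H n) \<le> n ^ nv H" .
  from of_nat_mono[OF this, where 'a = real] show ?thesis by simp
qed

text \<open>When the injection is built up value by value, at least half of \<open>B\<close> is
  still free at each step.\<close>

lemma card_inj_ge:
  assumes "finite A" "2 * card A \<le> card B" "finite B"
  shows "(real (card B) / 2) ^ card A \<le> real (card {f \<in> A \<rightarrow>\<^sub>E B. inj_on f A})"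
  using assms
proof (induction A rule: finite_induct)
  case empty
  then show ?case by simp
next
  case (insert x A)
  let ?I = "\<lambda>A. {f \<in> A \<rightarrow>\<^sub>E B. inj_on f A}"
  have finI: "finite (?I A)" for A' :: "'a set"
    by (rule finite_subset[of _ "A \<rightarrow>\<^sub>E B"]) (use insert in \<open>auto intro!: finite_PiE\<close>)
  have IH: "(real (card B) / 2) ^ card A \<le> real (card (?I A))" using insert by simp
  have "inj_on (\<lambda>(f, y). f(x := y)) (SIGMA f:?I A. B - f ` A)"
  proof (rule inj_onI, clarify)
    fix f g y z assume eq: "f(x := y) = g(x := z)" and f: "f \<in> A \<rightarrow>\<^sub>E B" and g: "g \<in> A \<rightarrow>\<^sub>E B"
    have "f v = g v" for v
    proof (cases "v = x")
      case True
      then show ?thesis using f g insert.hyps(2) by (metis PiE_arb)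
    next
      case False
      then show ?thesis using fun_cong[OF eq, of v] by simp
    qed
    then show "f = g \<and> y = z" using fun_cong[OF eq, of x] by auto
  qed
  moreover have "(\<lambda>(f, y). f(x := y)) ` (SIGMA f:?I A. B - f ` A) \<subseteq> ?I (insert x A)"
  proof clarify
    fix f y assume f: "f \<in> A \<rightarrow>\<^sub>E B" "inj_on f A" and y: "y \<in> B" "y \<notin> f ` A"
    have "inj_on (f(x := y)) A" using f(2) insert.hyps(2) by (auto simp: inj_on_def)
    moreover have "(f(x := y)) ` A = f ` A" using insert.hyps(2) by auto
    ultimately show "f(x := y) \<in> insert x A \<rightarrow>\<^sub>E B \<and> inj_on (f(x := y)) (insert x A)"
      using PiE_fun_upd[OF y(1) f(1)] y(2) by auto
  qed
  moreover have "finite (?I (insert x A))"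
    by (rule finite_subset[of _ "insert x A \<rightarrow>\<^sub>E B"]) (use insert in \<open>auto intro!: finite_PiE\<close>)
  ultimately have "card (SIGMA f:?I A. B - f ` A) \<le> card (?I (insert x A))"
    by (rule card_inj_on_le)
  moreover have "card (SIGMA f:?I A. B - f ` A) = (\<Sum>f\<in>?I A. card B - card A)"
  proof -
    have "card (B - f ` A) = card B - card A" if "f \<in> ?I A" for f
    proof -
      have "f ` A \<subseteq> B" "card (f ` A) = card A" using that by (auto simp: card_image)
      then show ?thesis using insert.prems(2) finite_subset by (subst card_Diff_subset) auto
    qed
    then show ?thesis using finI insert.prems(2) by (subst card_SigmaI) auto
  qed
  ultimately have "card (?I A) * (card B - card A) \<le> card (?I (insert x A))" by simp
  from of_nat_mono[OF this, where 'a = real]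
  have le: "real (card (?I A)) * real (card B - card A) \<le> real (card (?I (insert x A)))"
    by (simp only: of_nat_mult)
  have "(real (card B) / 2) ^ card (insert x A) = (real (card B) / 2) ^ card A * (real (card B) / 2)"
    using insert.hyps by simp
  also have "\<dots> \<le> real (card (?I A)) * real (card B - card A)"
  proof (rule mult_mono[OF IH])
    have "2 * (card A + 1) \<le> card B" using insert.prems(1) insert.hyps by simp
    then show "real (card B) / 2 \<le> real (card B - card A)" by (simp add: of_nat_diff)
  qed simp_all
  finally show ?case using le by linarith
qed

lemma card_emb_ge:
  assumes "simple_graph H" and n: "2 * nv H \<le> n"
  shows "(real n / 2) ^ nv H \<le> real (card (emb H n))"
  using card_inj_ge[of "verts H" "{1..n}"] assms simple_graphD(1)[OF assms(1)] by (simp add: emb_def)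

section \<open>The maximum 2-density and codegrees of copies\<close>

lemma finite_m2_set:
  assumes "simple_graph H"
  shows "finite {(real (ne F) - 1) / (real (nv F) - 2) | F. subgraph F H \<and> nv F \<ge> 3}"
proof -
  have "{(real (ne F) - 1) / (real (nv F) - 2) | F. subgraph F H \<and> nv F \<ge> 3}
     \<subseteq> (\<lambda>(V, E). (real (card E) - 1) / (real (card V) - 2)) ` (Pow (verts H) \<times> Pow (edges H))"
    by (force simp: subgraph_def)
  then show ?thesis using simple_graphD[OF assms] by (meson finite_Pow_iff finite_SigmaI finite_imageI finite_subset)
qed

text \<open>The density inequality in multiplied-out form, for the vertices spanned by
  \<open>L\<close>. This form also covers a single edge, a case that the quotient in
  \<open>m2\<close> has to exclude.\<close>

lemma m2_bound:
  assumes H: "simple_graph H" and L: "L \<subseteq> edges H" "L \<noteq> {}"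
  shows "2 \<le> card (\<Union>L)" "real (card L) - 1 \<le> m2 H * (real (card (\<Union>L)) - 2)"
proof -
  have sub: "\<Union>L \<subseteq> verts H" using L(1) simple_graphD(3)[OF H] by blast
  then have fin: "finite (\<Union>L)" using simple_graphD(1)[OF H] by (rule finite_subset)
  obtain e where e: "e \<in> L" using L(2) by blast
  have ce: "card f = 2" if "f \<in> L" for f using that L(1) simple_graphD(4)[OF H] by blast
  have "card e \<le> card (\<Union>L)" using e fin by (intro card_mono) auto
  then show 2: "2 \<le> card (\<Union>L)" using ce[OF e] by simp
  show "real (card L) - 1 \<le> m2 H * (real (card (\<Union>L)) - 2)"
  proof (cases "card (\<Union>L) = 2")
    \<comment> \<open>Two spanned vertices leave room for only one edge, and both sides are at most
      zero.\<close>
    case True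
    have "f = \<Union>L" if "f \<in> L" for f
      by (rule card_subset_eq[OF fin]) (use that ce True in auto)
    then have "L \<subseteq> {\<Union>L}" by blast
    then have "card L \<le> 1" using card_mono[of "{\<Union>L}" L] by simp
    then show ?thesis using True by simp
  next
    case False
    then have 3: "3 \<le> card (\<Union>L)" using 2 by simp
    define F where "F = Graph (\<Union>L) L"
    have "subgraph F H" using sub fin L(1) ce
      by (auto simp: F_def subgraph_def simple_graph_def nsets_def intro: finite_subset)
    then have "(real (card L) - 1) / (real (card (\<Union>L)) - 2) \<le> m2 H"
      unfolding m2_def using 3 finite_m2_set[OF H]
      by (intro Max_ge) (auto simp: F_def intro!: exI[of _ F])
    then show ?thesis using 3 by (simp add: field_simps)
  qed
qed

text \<open>Two adjacent edges form a path with density quotient 1. The bound matters because it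
  gives \<open>n powr (- 1 / m2 H) \<ge> 1 / n\<close>, so \<tau> n^2 grows at least
  linearly.\<close>

lemma m2_ge_1:
  assumes H: "simple_graph H" and "non_matching H"
  shows "1 \<le> m2 H"
proof -
  obtain e f where ef: "e \<in> edges H" "f \<in> edges H" "e \<noteq> f" "e \<inter> f \<noteq> {}"
    using assms(2) by (auto simp: non_matching_def)
  have c: "card e = 2" "card f = 2" using ef simple_graphD(4)[OF H] by auto
  have fin: "finite e" "finite f" using c by (auto intro: card_ge_0_finite)
  have "card (e \<union> f) + card (e \<inter> f) = 4" using card_Un_Int[OF fin] c by simp
  moreover have "1 \<le> card (e \<inter> f)" using ef(4) fin by (simp add: Suc_le_eq card_gt_0_iff)
  ultimately have "card (e \<union> f) \<le> 3" by simp
  moreover have "real (card {e, f}) - 1 \<le> m2 H * (real (card (\<Union>{e, f})) - 2)"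
    by (rule m2_bound[OF H]) (use ef in auto)
  moreover have "2 \<le> card (\<Union>{e, f})" by (rule m2_bound[OF H]) (use ef in auto)
  ultimately have *: "1 \<le> m2 H * (real (card (e \<union> f)) - 2)" "card (e \<union> f) = 2 \<or> card (e \<union> f) = 3"
    using ef(3) by auto
  then show ?thesis by auto
qed

lemma nv_ge_3:
  assumes H: "simple_graph H" and "non_matching H"
  shows "3 \<le> nv H"
proof -
  obtain e f where ef: "e \<in> edges H" "f \<in> edges H" "e \<noteq> f"
    using assms(2) by (auto simp: non_matching_def)
  have c: "card e = 2" "card f = 2" using ef simple_graphD(4)[OF H] by auto
  have fin: "finite e" "finite f" using c by (auto intro: card_ge_0_finite)
  have sub: "e \<union> f \<subseteq> verts H" using ef simple_graphD(3)[OF H] by auto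
  show ?thesis
  proof (rule ccontr)
    assume "\<not> 3 \<le> nv H"
    then have "card (verts H) \<le> 2" by simp
    then have "e = verts H" "f = verts H"
      using sub c simple_graphD(1)[OF H] by (metis Un_subset_iff card_seteq)+
    then show False using ef(3) by simp
  qed
qed

lemma m2_attained:
  assumes H: "simple_graph H" and "non_matching H"
  obtains J where "subgraph J H" "3 \<le> nv J" "2 \<le> ne J" "real (ne J) - 1 = m2 H * (real (nv J) - 2)"
proof -
  have "3 \<le> nv H" by (rule nv_ge_3[OF assms])
  moreover have "subgraph H H" using H by (simp add: subgraph_def)
  ultimately have ne: "{(real (ne F) - 1) / (real (nv F) - 2) | F. subgraph F H \<and> nv F \<ge> 3} \<noteq> {}" by blast
  have "m2 H \<in> {(real (ne F) - 1) / (real (nv F) - 2) | F. subgraph F H \<and> nv F \<ge> 3}"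
    unfolding m2_def by (rule Max_in[OF finite_m2_set[OF H] ne])
  then obtain J where J: "subgraph J H" "3 \<le> nv J" "m2 H = (real (ne J) - 1) / (real (nv J) - 2)" by blast
  have eq: "real (ne J) - 1 = m2 H * (real (nv J) - 2)" using J(2,3) by (simp add: field_simps)
  moreover have "1 * 1 \<le> m2 H * (real (nv J) - 2)"
    using m2_ge_1[OF assms] J(2) by (intro mult_mono) auto
  ultimately have "2 \<le> ne J" by simp
  then show ?thesis using that J eq by blast
qed

text \<open>If \<open>\<phi>\<close> maps \<open>L\<close> onto \<open>T\<close>, the vertices of
  \<open>L\<close> go to the boundedly many vertices of \<open>T\<close> and only the other
  \<open>nv J - card (\<Union>L)\<close> vertices are free. The density hypothesis converts this
  loss of vertices beyond two into the factor \<open>\<tau> ^ (card T - 1)\<close>. With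
  \<open>\<mu>\<close> left abstract, the lemma applies to \<open>H\<close> and, with the same
  \<open>m2 H\<close>, to its subgraph \<open>J\<close>.\<close>

lemma card_emb_containing:
  assumes J: "simple_graph J"
    and L: "\<And>L. L \<subseteq> edges J \<Longrightarrow> L \<noteq> {} \<Longrightarrow> real (card L) - 1 \<le> \<mu> * (real (card (\<Union>L)) - 2)"
    and \<mu>: "0 < \<mu>" and n: "0 < n" and T: "T \<noteq> {}"
  shows "real (card {\<phi> \<in> emb J n. T \<subseteq> emap \<phi> (edges J)}) \<le>
    2 ^ ne J * real (nv J) ^ nv J * (real n ^ nv J / real n ^ 2) * (real n powr (- 1 / \<mu>)) ^ (card T - 1)"
    (is "_ \<le> _ * ?b")
proof -
  define W where "W = \<Union>T"
  define \<tau> where "\<tau> = real n powr (- 1 / \<mu>)"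
  have finV: "finite (verts J)" and finE: "finite (edges J)" using simple_graphD[OF J] by auto
  \<comment> \<open>Embeddings are sorted by the set \<open>L\<close> of edges of \<open>J\<close>
    that is mapped onto \<open>T\<close>; there are at most \<open>2 ^ ne J\<close> classes.\<close>
  define Q where "Q = (\<lambda>L. {\<phi> \<in> emb J n. emap \<phi> L = T})"
  have QL: "real (card (Q L)) \<le> real (nv J) ^ nv J * (real n ^ nv J / real n ^ 2) * \<tau> ^ (card T - 1)"
    if L': "L \<subseteq> edges J" for L
  proof (cases "Q L = {}")
    case True
    then show ?thesis by (simp add: \<tau>_def)
  next
    case False
    then obtain \<phi>0 where \<phi>0: "\<phi>0 \<in> emb J n" "emap \<phi>0 L = T" by (auto simp: Q_def)
    have sub: "\<Union>L \<subseteq> verts J" using L' simple_graphD(3)[OF J] by blast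
    have Lne: "L \<noteq> {}" using \<phi>0(2) T by (auto simp: emap_def)
    have img: "\<phi> ` \<Union>L = W" if "emap \<phi> L = T" for \<phi>
      unfolding W_def using that by (auto simp: emap_def)
    have "card W \<le> nv J"
    proof -
      have "card W \<le> card (\<Union>L)" using img[OF \<phi>0(2)] finite_subset[OF sub finV] card_image_le by metis
      then show ?thesis using card_mono[OF finV sub] by simp
    qed
    have cT: "card T = card L"
    proof -
      have "inj_on \<phi>0 (verts J)" using \<phi>0(1) by (simp add: emb_def)
      from inj_on_subset[OF inj_on_image_edges[OF J this] L'] show ?thesis
        using \<phi>0(2) card_image unfolding emap_def by blast
    qed
    obtain e where e: "e \<in> L" using Lne by blast
    have "card e = 2" using e L' simple_graphD(4)[OF J] by blast
    then have v2: "2 \<le> card (\<Union>L)"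
      using card_mono[OF finite_subset[OF sub finV], of e] e by auto
    have vle: "card (\<Union>L) \<le> nv J" by (rule card_mono[OF finV sub])
    have finW: "finite W" using img[OF \<phi>0(2)] finite_subset[OF sub finV] by (metis finite_imageI)
    have "Q L \<subseteq> PiE (verts J) (\<lambda>x. if x \<in> \<Union>L then W else {1..n})"
    proof
      fix \<phi> assume "\<phi> \<in> Q L"
      then have \<phi>: "\<phi> \<in> verts J \<rightarrow>\<^sub>E {1..n}" "\<phi> ` \<Union>L = W" using img by (auto simp: Q_def emb_def)
      show "\<phi> \<in> PiE (verts J) (\<lambda>x. if x \<in> \<Union>L then W else {1..n})"
      proof (rule PiE_I)
        fix x assume "x \<in> verts J"
        then show "\<phi> x \<in> (if x \<in> \<Union>L then W else {1..n})" using \<phi> by auto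
      next
        fix x assume "x \<notin> verts J"
        then show "\<phi> x = undefined" using \<phi>(1) by auto
      qed
    qed
    then have "card (Q L) \<le> card (PiE (verts J) (\<lambda>x. if x \<in> \<Union>L then W else {1..n}))"
      using finV finW by (intro card_mono finite_PiE) auto
    also have "\<dots> = (\<Prod>x\<in>verts J. if x \<in> \<Union>L then card W else n)"
      using finV by (subst card_PiE) (auto intro!: prod.cong)
    also have "\<dots> = card W ^ card (\<Union>L) * n ^ (nv J - card (\<Union>L))"
    proof -
      have "verts J \<inter> {x. x \<in> \<Union>L} = \<Union>L" "verts J \<inter> - {x. x \<in> \<Union>L} = verts J - \<Union>L" using sub by auto
      then show ?thesis
        unfolding prod.If_cases[OF finV] using card_Diff_subset[OF finite_subset[OF sub finV] sub] by simp
    qed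
    also have "\<dots> \<le> nv J ^ nv J * n ^ (nv J - card (\<Union>L))"
    proof (rule mult_right_mono)
      have "card W ^ card (\<Union>L) \<le> nv J ^ card (\<Union>L)" using \<open>card W \<le> nv J\<close> by (rule power_mono) simp
      also have "\<dots> \<le> nv J ^ nv J" using vle v2 by (intro power_increasing) auto
      finally show "card W ^ card (\<Union>L) \<le> nv J ^ nv J" .
    qed simp
    finally have "card (Q L) \<le> nv J ^ nv J * n ^ (nv J - card (\<Union>L))" .
    from of_nat_mono[OF this, where 'a = real]
    have e1: "real (card (Q L)) \<le> real (nv J) ^ nv J * real n ^ (nv J - card (\<Union>L))"
      by (simp only: of_nat_mult of_nat_power)
    have e2: "real n ^ (nv J - card (\<Union>L)) = real n ^ nv J / real n ^ 2 * real n powr (- (real (card (\<Union>L)) - 2))"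
    proof -
      have "real n ^ (nv J - card (\<Union>L)) = real n powr (real (nv J) - real (card (\<Union>L)))"
        using n vle by (simp add: powr_realpow[symmetric] of_nat_diff)
      also have "\<dots> = real n powr (real (nv J) - 2 + - (real (card (\<Union>L)) - 2))" by simp
      also have "\<dots> = real n powr (real (nv J) - 2) * real n powr (- (real (card (\<Union>L)) - 2))"
        by (rule powr_add)
      also have "real n powr (real (nv J) - 2) = real n ^ nv J / real n ^ 2"
        using n by (simp add: powr_diff powr_realpow)
      finally show ?thesis .
    qed
    have e3: "real n powr (- (real (card (\<Union>L)) - 2)) \<le> \<tau> ^ (card T - 1)"
    proof -
      have "card L \<noteq> 0" using Lne finite_subset[OF L' finE] by simp
      then have k: "real (card L - 1) = real (card L) - 1" by linarith
      have "\<tau> ^ (card T - 1) = real n powr (real (card L - 1) * (- 1 / \<mu>))"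
        unfolding \<tau>_def cT using n by (subst powr_power) auto
      then have "\<tau> ^ (card T - 1) = real n powr (- 1 / \<mu> * (real (card L) - 1))"
        unfolding k by (simp only: mult.commute)
      moreover have "- (real (card (\<Union>L)) - 2) \<le> - 1 / \<mu> * (real (card L) - 1)"
        using L[OF L' Lne] \<mu> by (simp add: field_simps)
      ultimately show ?thesis using n by (simp only:) (intro powr_mono, auto)
    qed
    have "real (nv J) ^ nv J * (real n ^ nv J / real n ^ 2) * real n powr (- (real (card (\<Union>L)) - 2))
        \<le> real (nv J) ^ nv J * (real n ^ nv J / real n ^ 2) * \<tau> ^ (card T - 1)"
      using e3 by (rule mult_left_mono) auto
    then show ?thesis using e1 unfolding e2 by (simp only: mult.assoc)
  qed
  have "{\<phi> \<in> emb J n. T \<subseteq> emap \<phi> (edges J)} \<subseteq> (\<Union>L\<in>Pow (edges J). Q L)"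
  proof
    fix \<phi> assume \<phi>: "\<phi> \<in> {\<phi> \<in> emb J n. T \<subseteq> emap \<phi> (edges J)}"
    then obtain L where "L \<subseteq> edges J" "T = emap \<phi> L" unfolding emap_def by (auto elim: subset_imageE)
    then show "\<phi> \<in> (\<Union>L\<in>Pow (edges J). Q L)" using \<phi> by (auto simp: Q_def)
  qed
  then have "card {\<phi> \<in> emb J n. T \<subseteq> emap \<phi> (edges J)} \<le> card (\<Union>L\<in>Pow (edges J). Q L)"
  proof (rule card_mono[rotated])
    have "Q L \<subseteq> emb J n" for L by (auto simp: Q_def)
    then have "(\<Union>L\<in>Pow (edges J). Q L) \<subseteq> emb J n" by blast
    then show "finite (\<Union>L\<in>Pow (edges J). Q L)" using finite_emb[OF J] by (rule finite_subset)
  qed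
  also have "\<dots> \<le> (\<Sum>L\<in>Pow (edges J). card (Q L))" using finE by (intro card_UN_le) auto
  finally have "card {\<phi> \<in> emb J n. T \<subseteq> emap \<phi> (edges J)} \<le> (\<Sum>L\<in>Pow (edges J). card (Q L))" .
  from of_nat_mono[OF this, where 'a = real]
  have "real (card {\<phi> \<in> emb J n. T \<subseteq> emap \<phi> (edges J)}) \<le> (\<Sum>L\<in>Pow (edges J). real (card (Q L)))"
    by (simp only: of_nat_sum)
  also have "\<dots> \<le> (\<Sum>L\<in>Pow (edges J). real (nv J) ^ nv J * (real n ^ nv J / real n ^ 2) * \<tau> ^ (card T - 1))"
    using QL by (intro sum_mono) auto
  also have "\<dots> = 2 ^ ne J * real (nv J) ^ nv J * (real n ^ nv J / real n ^ 2) * \<tau> ^ (card T - 1)"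
    using finE by (simp add: card_Pow)
  finally show ?thesis unfolding \<tau>_def .
qed

section \<open>Containers for rainbow-free colourings\<close>

definition coloured_copies :: "'a graph \<Rightarrow> nat \<Rightarrow> nat \<Rightarrow> (('a \<Rightarrow> nat) \<times> ('a set \<Rightarrow> nat)) set" where
  "coloured_copies H l n = emb H n \<times> {\<kappa> \<in> edges H \<rightarrow>\<^sub>E {1..l}. inj_on \<kappa> (edges H)}"

definition coloured_image :: "'a graph \<Rightarrow> ('a \<Rightarrow> nat) \<times> ('a set \<Rightarrow> nat) \<Rightarrow> (nat set \<times> nat) set" where
  "coloured_image H = (\<lambda>(\<phi>, \<kappa>). (\<lambda>e. (\<phi> ` e, \<kappa> e)) ` edges H)"

text \<open>Weighting an image by the number of its coloured embeddings turns every weighted degree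
  into a plain count of coloured embeddings.\<close>

definition copy_weight :: "'a graph \<Rightarrow> nat \<Rightarrow> nat \<Rightarrow> (nat set \<times> nat) set \<Rightarrow> real" where
  "copy_weight H l n x = real (card {\<omega> \<in> coloured_copies H l n. coloured_image H \<omega> = x})"

definition template_of :: "(nat set \<times> nat) set \<Rightarrow> nat set \<Rightarrow> nat set" where
  "template_of C e = {k. (e, k) \<in> C}"

lemma finite_coloured_copies:
  assumes "simple_graph H"
  shows "finite (coloured_copies H l n)"
proof -
  have "finite (edges H \<rightarrow>\<^sub>E {1..l})" using simple_graphD(2)[OF assms] by (simp add: finite_PiE)
  then have "finite {\<kappa> \<in> edges H \<rightarrow>\<^sub>E {1..l}. inj_on \<kappa> (edges H)}" by simp
  then show ?thesis using assms by (simp add: coloured_copies_def)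
qed

lemma coloured_image_subset:
  assumes "simple_graph H" "\<omega> \<in> coloured_copies H l n"
  shows "coloured_image H \<omega> \<subseteq> edges (complete_graph n) \<times> {1..l}"
proof -
  obtain \<phi> \<kappa> where \<omega>: "\<omega> = (\<phi>, \<kappa>)" "\<phi> \<in> emb H n" "\<kappa> \<in> edges H \<rightarrow>\<^sub>E {1..l}"
    using assms(2) by (auto simp: coloured_copies_def)
  have "\<phi> ` e \<in> edges (complete_graph n)" if "e \<in> edges H" for e
    using emap_complete[OF assms(1) \<omega>(2)] that by (auto simp: emap_def)
  then show ?thesis using \<omega>(3) unfolding \<omega>(1) coloured_image_def by auto
qed

lemma inj_on_fst_coloured_image:
  assumes "simple_graph H" "\<omega> \<in> coloured_copies H l n"
  shows "inj_on fst (coloured_image H \<omega>)" "fst ` coloured_image H \<omega> = emap (fst \<omega>) (edges H)"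
    "card (coloured_image H \<omega>) = ne H"
proof -
  obtain \<phi> \<kappa> where \<omega>: "\<omega> = (\<phi>, \<kappa>)" "\<phi> \<in> emb H n"
    using assms(2) by (auto simp: coloured_copies_def)
  have inj: "inj_on (\<lambda>e. \<phi> ` e) (edges H)"
    by (rule inj_on_image_edges[OF assms(1)]) (use \<omega>(2) in \<open>simp add: emb_def\<close>)
  show 1: "inj_on fst (coloured_image H \<omega>)"
    using inj unfolding \<omega>(1) coloured_image_def by (auto simp: inj_on_def)
  show 2: "fst ` coloured_image H \<omega> = emap (fst \<omega>) (edges H)"
    unfolding \<omega>(1) coloured_image_def emap_def by (auto simp: image_image)
  have "card (coloured_image H \<omega>) = card (emap \<phi> (edges H))"
    using card_image[OF 1] 2 \<omega>(1) by simp
  then show "card (coloured_image H \<omega>) = ne H"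
    using card_image[OF inj] by (simp add: emap_def)
qed

lemma deg_copy_weight:
  assumes H: "simple_graph H" and V: "finite V"
  shows "deg V (copy_weight H l n) T =
    real (card {\<omega> \<in> coloured_copies H l n. coloured_image H \<omega> \<subseteq> V \<and> T \<subseteq> coloured_image H \<omega>})"
proof -
  let ?\<Omega> = "coloured_copies H l n"
  have fin: "finite ?\<Omega>" by (rule finite_coloured_copies[OF H])
  have "deg V (copy_weight H l n) T =
      real (\<Sum>x | x \<subseteq> V \<and> T \<subseteq> x. card {\<omega> \<in> ?\<Omega>. coloured_image H \<omega> = x})"
    by (simp add: deg_def copy_weight_def)
  also have "(\<Sum>x | x \<subseteq> V \<and> T \<subseteq> x. card {\<omega> \<in> ?\<Omega>. coloured_image H \<omega> = x})
      = card (\<Union>x\<in>{x. x \<subseteq> V \<and> T \<subseteq> x}. {\<omega> \<in> ?\<Omega>. coloured_image H \<omega> = x})"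
    using fin finite_edge_set[OF V] by (subst card_UN_disjoint) auto
  also have "(\<Union>x\<in>{x. x \<subseteq> V \<and> T \<subseteq> x}. {\<omega> \<in> ?\<Omega>. coloured_image H \<omega> = x})
      = {\<omega> \<in> ?\<Omega>. coloured_image H \<omega> \<subseteq> V \<and> T \<subseteq> coloured_image H \<omega>}" by auto
  finally show ?thesis .
qed

lemma card_coloured_copies:
  assumes H: "simple_graph H" and l: "ne H \<le> l"
  shows "real (card (coloured_copies H l n)) \<le> real l ^ ne H * real n ^ nv H"
    and "2 * nv H \<le> n \<Longrightarrow> (real n / 2) ^ nv H \<le> real (card (coloured_copies H l n))"
proof -
  let ?X = "{\<kappa> \<in> edges H \<rightarrow>\<^sub>E {1..l}. inj_on \<kappa> (edges H)}"
  have finE: "finite (edges H)" by (rule simple_graphD(2)[OF H])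
  have fin: "finite (edges H \<rightarrow>\<^sub>E {1..l})" using finE by (simp add: finite_PiE)
  have eq: "real (card (coloured_copies H l n)) = real (card ?X) * real (card (emb H n))"
    by (simp add: coloured_copies_def card_cartesian_product)
  have "card ?X \<le> card (edges H \<rightarrow>\<^sub>E {1..l})" by (rule card_mono[OF fin]) auto
  also have "\<dots> = l ^ ne H" using finE by (simp add: card_PiE)
  finally have "card ?X \<le> l ^ ne H" .
  from of_nat_mono[OF this, where 'a = real] have "real (card ?X) \<le> real l ^ ne H" by (simp only: of_nat_power)
  then show "real (card (coloured_copies H l n)) \<le> real l ^ ne H * real n ^ nv H"
    unfolding eq by (intro mult_mono card_emb_le[OF H]) auto
  obtain h where h: "inj_on h (edges H)" "h ` edges H \<subseteq> {1..l}"
    using card_le_inj[of "edges H" "{1..l}"] finE l by auto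
  have "restrict h (edges H) \<in> ?X" using h by (auto simp: inj_on_def)
  moreover have "finite ?X" using fin by simp
  ultimately have "0 < card ?X" unfolding card_gt_0_iff by blast
  then have "1 \<le> card ?X" by linarith
  then have "1 * real (card (emb H n)) \<le> real (card ?X) * real (card (emb H n))"
    by (intro mult_right_mono) auto
  then show "(real n / 2) ^ nv H \<le> real (card (coloured_copies H l n))" if "2 * nv H \<le> n"
    using card_emb_ge[OF H that] eq by simp
qed

text \<open>A coloured copy uses each edge of the complete graph in at most one colour, so
  \<open>T\<close> projects injectively to an edge set of the same size and the codegree estimate
  for embeddings applies, at the cost of \<open>l ^ ne H\<close> colourings. The constant also
  absorbs \<open>2 ^ nv H\<close> from the lower bound on the mass and one more \<open>l\<close>
  from the size of the vertex set.\<close>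

lemma spread_copy_weight:
  assumes H: "simple_graph H" "non_matching H" and l: "ne H \<le> l" and n: "2 * nv H \<le> n" "0 < n"
  shows "spread (edges (complete_graph n) \<times> {1..l}) (ne H)
     (1 + real l ^ (ne H + 1) * 2 ^ (ne H + nv H) * real (nv H) ^ nv H) (real n powr (- 1 / m2 H))
     (real (card (coloured_copies H l n))) (copy_weight H l n)" (is "spread ?V _ ?K ?\<tau> ?m ?w")
  unfolding spread_def
proof (intro conjI allI impI)
  have finV: "finite ?V" by simp
  have finE: "finite (edges H)" by (rule simple_graphD(2)[OF H(1)])
  have neH: "1 \<le> ne H"
    using H(2) finE by (auto simp: non_matching_def Suc_le_eq card_gt_0_iff)
  have mlow: "(real n / 2) ^ nv H \<le> ?m" by (rule card_coloured_copies(2)[OF H(1) l n(1)])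
  show "0 \<le> ?w e" for e by (simp add: copy_weight_def)
  show "0 < ?m" by (rule less_le_trans[OF _ mlow]) (use n in simp)
  have "{\<omega> \<in> coloured_copies H l n. coloured_image H \<omega> \<subseteq> ?V} = coloured_copies H l n"
    using coloured_image_subset[OF H(1)] by blast
  then show "?m \<le> deg ?V ?w {}" unfolding deg_copy_weight[OF H(1) finV] by (simp only: empty_subsetI simp_thms order_refl)
  show "e \<subseteq> ?V" "card e = ne H" if "?w e \<noteq> 0" for e
  proof -
    have "{\<omega> \<in> coloured_copies H l n. coloured_image H \<omega> = e} \<noteq> {}"
      using that unfolding copy_weight_def by (metis card.empty of_nat_0)
    then obtain \<omega> where "\<omega> \<in> coloured_copies H l n" "coloured_image H \<omega> = e" by blast
    then show "e \<subseteq> ?V" "card e = ne H"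
      using coloured_image_subset[OF H(1)] inj_on_fst_coloured_image(3)[OF H(1)] by blast+
  qed
  fix T assume T: "T \<subseteq> ?V" "T \<noteq> {}"
  let ?D = "{\<omega> \<in> coloured_copies H l n. coloured_image H \<omega> \<subseteq> ?V \<and> T \<subseteq> coloured_image H \<omega>}"
  have degT: "deg ?V ?w T = real (card ?D)" by (rule deg_copy_weight[OF H(1) finV])
  show "deg ?V ?w T \<le> ?K * ?\<tau> ^ (card T - 1) * ?m / card ?V"
  proof (cases "?D = {}")
    case True
    have "deg ?V ?w T = 0" unfolding degT True by simp
    then show ?thesis by simp
  next
    case False
    then obtain \<omega>0 where \<omega>0: "\<omega>0 \<in> coloured_copies H l n" "T \<subseteq> coloured_image H \<omega>0" by blast
    have cT: "card (fst ` T) = card T"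
      by (rule card_image[OF inj_on_subset[OF inj_on_fst_coloured_image(1)[OF H(1) \<omega>0(1)] \<omega>0(2)]])
    let ?E = "{\<phi> \<in> emb H n. fst ` T \<subseteq> emap \<phi> (edges H)}"
    let ?X = "edges H \<rightarrow>\<^sub>E {1..l}"
    have "?D \<subseteq> ?E \<times> ?X"
    proof
      fix \<omega> assume \<omega>: "\<omega> \<in> ?D"
      then have "fst ` T \<subseteq> emap (fst \<omega>) (edges H)"
        using inj_on_fst_coloured_image(2)[OF H(1), of \<omega> l n] by blast
      then show "\<omega> \<in> ?E \<times> ?X" using \<omega> by (auto simp: coloured_copies_def)
    qed
    then have "card ?D \<le> card (?E \<times> ?X)"
      using finE H(1) by (intro card_mono finite_cartesian_product finite_PiE) auto
    also have "\<dots> = l ^ ne H * card ?E" using finE by (simp add: card_cartesian_product card_PiE)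
    finally have "card ?D \<le> l ^ ne H * card ?E" .
    from of_nat_mono[OF this, where 'a = real]
    have "real (card ?D) \<le> real l ^ ne H * real (card ?E)" by (simp only: of_nat_power of_nat_mult)
    also have "\<dots> \<le> real l ^ ne H * (2 ^ ne H * real (nv H) ^ nv H * (real n ^ nv H / real n ^ 2) * ?\<tau> ^ (card (fst ` T) - 1))"
      using m2_ge_1[OF H] T(2) n(2) m2_bound(2)[OF H(1)]
      by (intro mult_left_mono card_emb_containing[OF H(1)]) auto
    also have "\<dots> = real l ^ ne H * 2 ^ ne H * real (nv H) ^ nv H * ?\<tau> ^ (card T - 1) * (real n ^ nv H / real n ^ 2)"
      unfolding cT by simp
    also have "\<dots> \<le> real l ^ ne H * 2 ^ ne H * real (nv H) ^ nv H * ?\<tau> ^ (card T - 1) *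
        (2 ^ nv H * ?m * (real l / card ?V))"
    proof (rule mult_left_mono)
      have cV: "real (card ?V) = real (n choose 2) * real l"
        by (simp add: card_cartesian_product card_edges_complete_graph)
      have l0: "0 < l" using neH l by linarith
      have "3 \<le> nv H" by (rule nv_ge_3[OF H])
      then have n2: "2 \<le> n" using n by linarith
      have ch: "0 < n choose 2" using n2 by (simp add: zero_less_binomial)
      have "real (n choose 2) \<le> real n ^ 2"
        using of_nat_mono[OF binomial_le_pow[OF n2], where 'a = real] by (simp only: of_nat_power)
      then have "1 / real n ^ 2 \<le> 1 / real (n choose 2)"
        using ch by (intro divide_left_mono) auto
      also have "\<dots> = real l / card ?V" unfolding cV using l0 by simp
      finally have 1: "1 / real n ^ 2 \<le> real l / card ?V" .
      have "real n ^ nv H = 2 ^ nv H * (real n / 2) ^ nv H" by (simp add: power_divide)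
      also have "\<dots> \<le> 2 ^ nv H * ?m" using mlow by (rule mult_left_mono) simp
      finally have 2: "real n ^ nv H \<le> 2 ^ nv H * ?m" .
      have "real n ^ nv H * (1 / real n ^ 2) \<le> 2 ^ nv H * ?m * (real l / card ?V)"
        by (rule mult_mono[OF 2 1]) auto
      then show "real n ^ nv H / real n ^ 2 \<le> 2 ^ nv H * ?m * (real l / card ?V)" by simp
    qed simp
    also have "\<dots> = (real l ^ (ne H + 1) * 2 ^ (ne H + nv H) * real (nv H) ^ nv H) * (?\<tau> ^ (card T - 1) * ?m / card ?V)"
      by (simp add: power_add)
    also have "\<dots> \<le> ?K * (?\<tau> ^ (card T - 1) * ?m / card ?V)"
      by (rule mult_right_mono) auto
    finally show ?thesis unfolding degT by simp
  qed
qed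

lemma powr_tendsto_0:
  assumes "0 < \<mu>"
  shows "(\<lambda>n. real n powr (- 1 / \<mu>)) \<longlonglongrightarrow> 0"
  using assms by (intro tendsto_neg_powr filterlim_real_sequentially) (auto simp: field_simps)

lemma card_choose_two_bounds:
  assumes "2 \<le> n"
  shows "real n ^ 2 / 4 \<le> real (n choose 2)" "real (n choose 2) \<le> real n ^ 2"
proof -
  have eq: "real (n choose 2) = real n * (real n - 1) / 2"
    using assms by (simp add: choose_two real_of_nat_div of_nat_diff)
  have "real n * 1 \<le> real n * (real n - 1)" using assms by (intro mult_left_mono) auto
  then show "real n ^ 2 / 4 \<le> real (n choose 2)" unfolding eq by (simp add: power2_eq_square algebra_simps)
  show "real (n choose 2) \<le> real n ^ 2" unfolding eq by (simp add: power2_eq_square algebra_simps)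
qed

abbreviation SDR_copies :: "'a graph \<Rightarrow> nat \<Rightarrow> (nat set \<Rightarrow> nat set) \<Rightarrow> ('a \<Rightarrow> nat) set" where
  "SDR_copies H n P \<equiv> {\<phi> \<in> emb H n. has_SDR (emap \<phi> (edges H)) P}"

text \<open>An SDR for the palettes on an embedded \<open>H\<close> is a rainbow colouring of it
  whose coloured edges lie in \<open>C\<close>; distinct embeddings give distinct coloured
  copies.\<close>

lemma few_SDR_copies:
  assumes H: "simple_graph H" and C: "C \<subseteq> edges (complete_graph n) \<times> {1..l}"
  shows "real (card (SDR_copies H n (template_of C))) \<le> deg C (copy_weight H l n) {}"
proof -
  have finC: "finite C" by (rule finite_subset[OF C]) simp
  let ?D = "{\<omega> \<in> coloured_copies H l n. coloured_image H \<omega> \<subseteq> C}"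
  have finD: "finite ?D" using finite_coloured_copies[OF H] by simp
  have "SDR_copies H n (template_of C) \<subseteq> fst ` ?D"
  proof
    fix \<phi> assume "\<phi> \<in> SDR_copies H n (template_of C)"
    then have \<phi>: "\<phi> \<in> emb H n" and sdr: "has_SDR (emap \<phi> (edges H)) (template_of C)" by auto
    from sdr obtain a where a: "\<And>f. f \<in> emap \<phi> (edges H) \<Longrightarrow> (f, a f) \<in> C" "inj_on a (emap \<phi> (edges H))"
      by (auto simp: has_SDR_def template_of_def)
    define \<kappa> where "\<kappa> = restrict (\<lambda>e. a (\<phi> ` e)) (edges H)"
    have im: "\<phi> ` e \<in> emap \<phi> (edges H)" if "e \<in> edges H" for e using that by (auto simp: emap_def)
    have injim: "inj_on (\<lambda>e. \<phi> ` e) (edges H)"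
      by (rule inj_on_image_edges[OF H]) (use \<phi> in \<open>simp add: emb_def\<close>)
    have "\<kappa> \<in> edges H \<rightarrow>\<^sub>E {1..l}" using a(1)[OF im] C by (force simp: \<kappa>_def)
    moreover have "inj_on \<kappa> (edges H)"
    proof (rule inj_onI)
      fix e e' assume e: "e \<in> edges H" "e' \<in> edges H" "\<kappa> e = \<kappa> e'"
      then have "\<phi> ` e = \<phi> ` e'" using inj_onD[OF a(2) _ im im] by (simp add: \<kappa>_def)
      then show "e = e'" using inj_onD[OF injim] e by blast
    qed
    moreover have "coloured_image H (\<phi>, \<kappa>) \<subseteq> C"
      using a(1)[OF im] by (auto simp: coloured_image_def \<kappa>_def)
    ultimately have "(\<phi>, \<kappa>) \<in> ?D" using \<phi> by (simp add: coloured_copies_def)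
    then show "\<phi> \<in> fst ` ?D" by force
  qed
  then have "card (SDR_copies H n (template_of C)) \<le> card (fst ` ?D)"
    using finD by (intro card_mono) auto
  also have "\<dots> \<le> card ?D" using finD by (rule card_image_le)
  finally show ?thesis by (simp add: deg_copy_weight[OF H finC])
qed

definition graph_of_colouring :: "nat graph \<Rightarrow> (nat set \<Rightarrow> nat) \<Rightarrow> (nat set \<times> nat) set" where
  "graph_of_colouring G c = (\<lambda>e. (e, c e)) ` edges G"

lemma independent_rainbow_free:
  assumes H: "simple_graph H" and G: "verts G = {1..n}" and c: "c \<in> rainbow_free_colourings H l G"
  shows "independent_in (copy_weight H l n) (graph_of_colouring G c)"
  unfolding independent_in_def
proof (intro allI impI)
  fix x assume x: "x \<subseteq> graph_of_colouring G c"
  have empty: "{\<omega> \<in> coloured_copies H l n. coloured_image H \<omega> = x} = {}"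
  proof (rule ccontr)
    assume "\<not> ?thesis"
    then obtain \<phi> \<kappa> where \<phi>: "\<phi> \<in> emb H n" and \<kappa>: "inj_on \<kappa> (edges H)" and im: "coloured_image H (\<phi>, \<kappa>) = x"
      by (auto simp: coloured_copies_def)
    have e: "\<phi> ` e \<in> edges G \<and> c (\<phi> ` e) = \<kappa> e" if "e \<in> edges H" for e
      using that x unfolding im[symmetric] by (auto simp: coloured_image_def graph_of_colouring_def)
    have "emap \<phi> (edges H) \<subseteq> edges G" using e by (auto simp: emap_def)
    moreover have "inj_on c (emap \<phi> (edges H))"
    proof (rule inj_onI)
      fix f f' assume "f \<in> emap \<phi> (edges H)" "f' \<in> emap \<phi> (edges H)" and eq: "c f = c f'"
      then obtain d d' where d: "d \<in> edges H" "d' \<in> edges H" "f = \<phi> ` d" "f' = \<phi> ` d'" by (auto simp: emap_def)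
      then have "\<kappa> d = \<kappa> d'" using e eq by metis
      then show "f = f'" using d inj_onD[OF \<kappa>] by blast
    qed
    ultimately have "\<exists>F. is_copy H F G \<and> inj_on c (edges F)"
      using \<phi> is_copy_emb_iff[OF H G, where Q = "inj_on c"] by blast
    then show False using c unfolding rainbow_free_colourings_def by blast
  qed
  show "copy_weight H l n x = 0" unfolding copy_weight_def empty by simp
qed

theorem colouring_containers:
  fixes \<epsilon> :: real and H :: "'a graph"
  assumes H: "simple_graph H" "non_matching H" and l: "ne H \<le> l" and \<epsilon>: "0 < \<epsilon>"
  shows "\<exists>k n0. \<forall>n\<ge>n0. \<exists>f. \<forall>G c. verts G = {1..n} \<longrightarrow> edges G \<subseteq> edges (complete_graph n) \<longrightarrow>
      c \<in> rainbow_free_colourings H l G \<longrightarrow>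
      (\<exists>Ss. length Ss = k \<and>
         (\<forall>S\<in>set Ss. S \<subseteq> graph_of_colouring G c \<and> real (card S) \<le> 2 * real l * real n ^ 2 * real n powr (- 1 / m2 H)) \<and>
         graph_of_colouring G c \<subseteq> f Ss \<and> f Ss \<subseteq> edges (complete_graph n) \<times> {1..l} \<and>
         real (card (SDR_copies H n (template_of (f Ss)))) \<le> \<epsilon> * real n ^ nv H)"
proof -
  define K where "K = 1 + real l ^ (ne H + 1) * 2 ^ (ne H + nv H) * real (nv H) ^ nv H"
  have K: "1 \<le> K" by (simp add: K_def)
  have finE: "finite (edges H)" by (rule simple_graphD(2)[OF H(1)])
  have r: "0 < ne H"
    using H(2) finE by (auto simp: non_matching_def card_gt_0_iff)
  have l0: "1 \<le> real l" using r l by simp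
  \<comment> \<open>The container theorem measures sparseness against the number of coloured copies,
    which is at most \<open>l ^ ne H * n ^ nv H\<close>, and asks for a bound of at most 1.\<close>
  define \<epsilon>' where "\<epsilon>' = min 1 (\<epsilon> / real l ^ ne H)"
  have \<epsilon>': "0 < \<epsilon>'" "\<epsilon>' \<le> 1" using \<epsilon> l0 by (auto simp: \<epsilon>'_def)
  have \<epsilon>'': "\<epsilon>' * real l ^ ne H \<le> \<epsilon>"
  proof -
    have "\<epsilon>' * real l ^ ne H \<le> \<epsilon> / real l ^ ne H * real l ^ ne H" by (intro mult_right_mono) (auto simp: \<epsilon>'_def)
    then show ?thesis using l0 by simp
  qed
  from hypergraph_containers[OF K \<epsilon>' r] obtain k and \<tau>0 B :: real where \<tau>0: "0 < \<tau>0 \<and>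
    (\<forall>V (w :: (nat set \<times> nat) set \<Rightarrow> real) m (\<tau>::real). finite V \<longrightarrow> spread V (ne H) K \<tau> m w \<longrightarrow> 0 < \<tau> \<longrightarrow> \<tau> \<le> \<tau>0 \<longrightarrow> B \<le> \<tau> * card V \<longrightarrow>
      (\<exists>f. \<forall>I. I \<subseteq> V \<longrightarrow> independent_in w I \<longrightarrow>
         (\<exists>Ss. length Ss = k \<and> (\<forall>S\<in>set Ss. S \<subseteq> I \<and> real (card S) \<le> 2 * \<tau> * card V) \<and>
            I \<subseteq> f Ss \<and> f Ss \<subseteq> V \<and> deg (f Ss) w {} < \<epsilon>' * m)))"
    by (elim exE) (rule that)
  note cont = \<tau>0[THEN conjunct2, rule_format]
  have m2: "1 \<le> m2 H" by (rule m2_ge_1[OF H])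
  have "\<forall>\<^sub>F n in sequentially. real n powr (- 1 / m2 H) < \<tau>0"
    using powr_tendsto_0[of "m2 H"] m2 \<tau>0 by (intro order_tendstoD(2)) auto
  then obtain n1 where n1: "\<And>n. n1 \<le> n \<Longrightarrow> real n powr (- 1 / m2 H) < \<tau>0" by (auto simp: eventually_sequentially)
  obtain n2 :: nat where n2: "4 * B \<le> real n2" using real_arch_simple by blast
  show ?thesis
  proof (rule exI[of _ k], rule exI[of _ "n1 + n2 + 2 * nv H + 2"], intro allI impI)
    fix n assume n: "n1 + n2 + 2 * nv H + 2 \<le> n"
    define \<tau> where "\<tau> = real n powr (- 1 / m2 H)"
    let ?V = "edges (complete_graph n) \<times> {1..l}"
    have cV: "real (card ?V) = real (n choose 2) * real l"
      by (simp add: card_cartesian_product card_edges_complete_graph)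
    note ch = card_choose_two_bounds[of n]
    \<comment> \<open>Hence \<tau> |V| is at least n / 4, which exceeds the constant
      \<open>B\<close> for large \<open>n\<close>.\<close>
    have "1 / real n \<le> \<tau>"
    proof -
      have "real n powr (- 1) \<le> real n powr (- 1 / m2 H)"
        using n m2 by (intro powr_mono) (auto simp: field_simps)
      then show ?thesis using n by (simp add: \<tau>_def powr_minus_divide)
    qed
    moreover have "real n ^ 2 / 4 \<le> card ?V"
    proof -
      have "real n ^ 2 / 4 * 1 \<le> real (n choose 2) * real l" using ch(1) n l0 by (intro mult_mono) auto
      then show ?thesis unfolding cV by simp
    qed
    ultimately have "1 / real n * (real n ^ 2 / 4) \<le> \<tau> * card ?V"
      by (intro mult_mono) (auto simp: \<tau>_def)
    moreover have "B \<le> 1 / real n * (real n ^ 2 / 4)" using n n2 by (simp add: power2_eq_square)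
    ultimately have B: "B \<le> \<tau> * card ?V" by simp
    have sp: "spread ?V (ne H) K \<tau> (real (card (coloured_copies H l n))) (copy_weight H l n)"
      unfolding K_def \<tau>_def by (rule spread_copy_weight[OF H l]) (use n in auto)
    have "0 < \<tau>" "\<tau> \<le> \<tau>0" using n n1[of n] by (auto simp: \<tau>_def)
    from cont[OF _ sp this B] obtain f where f: "\<And>I. I \<subseteq> ?V \<Longrightarrow> independent_in (copy_weight H l n) I \<Longrightarrow>
         (\<exists>Ss. length Ss = k \<and> (\<forall>S\<in>set Ss. S \<subseteq> I \<and> real (card S) \<le> 2 * \<tau> * card ?V) \<and>
            I \<subseteq> f Ss \<and> f Ss \<subseteq> ?V \<and> deg (f Ss) (copy_weight H l n) {} < \<epsilon>' * real (card (coloured_copies H l n)))"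
      by auto
    show "\<exists>f. \<forall>G c. verts G = {1..n} \<longrightarrow> edges G \<subseteq> edges (complete_graph n) \<longrightarrow>
      c \<in> rainbow_free_colourings H l G \<longrightarrow>
      (\<exists>Ss. length Ss = k \<and>
         (\<forall>S\<in>set Ss. S \<subseteq> graph_of_colouring G c \<and> real (card S) \<le> 2 * real l * real n ^ 2 * real n powr (- 1 / m2 H)) \<and>
         graph_of_colouring G c \<subseteq> f Ss \<and> f Ss \<subseteq> ?V \<and>
         real (card (SDR_copies H n (template_of (f Ss)))) \<le> \<epsilon> * real n ^ nv H)"
    proof (rule exI[of _ f], intro allI impI)
      fix G :: "nat graph" and c
      assume G: "verts G = {1..n}" "edges G \<subseteq> edges (complete_graph n)" and c: "c \<in> rainbow_free_colourings H l G"
      have "graph_of_colouring G c \<subseteq> ?V"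
        using c G(2) by (auto simp: graph_of_colouring_def rainbow_free_colourings_def)
      from f[OF this independent_rainbow_free[OF H(1) G(1) c]] obtain Ss where
        Ss: "length Ss = k" "\<And>S. S\<in>set Ss \<Longrightarrow> S \<subseteq> graph_of_colouring G c \<and> real (card S) \<le> 2 * \<tau> * card ?V"
        "graph_of_colouring G c \<subseteq> f Ss" "f Ss \<subseteq> ?V"
        "deg (f Ss) (copy_weight H l n) {} < \<epsilon>' * real (card (coloured_copies H l n))" by blast
      have "2 * \<tau> * card ?V \<le> 2 * \<tau> * (real n ^ 2 * real l)"
        unfolding cV using ch(2) n by (intro mult_left_mono mult_right_mono) (auto simp: \<tau>_def)
      then have size: "S \<subseteq> graph_of_colouring G c \<and> real (card S) \<le> 2 * real l * real n ^ 2 * real n powr (- 1 / m2 H)"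
        if "S \<in> set Ss" for S using Ss(2)[OF that] by (simp add: \<tau>_def algebra_simps)
      have "real (card (SDR_copies H n (template_of (f Ss))))
          \<le> \<epsilon>' * real (card (coloured_copies H l n))"
        using few_SDR_copies[OF H(1) Ss(4)] Ss(5) by linarith
      also have "\<dots> \<le> \<epsilon>' * (real l ^ ne H * real n ^ nv H)"
        using card_coloured_copies(1)[OF H(1) l] \<epsilon>' by (intro mult_left_mono) auto
      also have "\<dots> = \<epsilon>' * real l ^ ne H * real n ^ nv H" by simp
      also have "\<dots> \<le> \<epsilon> * real n ^ nv H" using \<epsilon>'' by (intro mult_right_mono) auto
      finally show "\<exists>Ss. length Ss = k \<and>
         (\<forall>S\<in>set Ss. S \<subseteq> graph_of_colouring G c \<and> real (card S) \<le> 2 * real l * real n ^ 2 * real n powr (- 1 / m2 H)) \<and>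
         graph_of_colouring G c \<subseteq> f Ss \<and> f Ss \<subseteq> ?V \<and>
         real (card (SDR_copies H n (template_of (f Ss)))) \<le> \<epsilon> * real n ^ nv H"
        using Ss(1,3,4) size by blast
    qed
  qed
qed

section \<open>Supersaturation\<close>

lemma permutes_extending:
  assumes "finite S" "A \<subseteq> S" "B \<subseteq> S" "bij_betw h A B"
  obtains \<sigma> where "\<sigma> permutes S" "\<And>x. x \<in> A \<Longrightarrow> \<sigma> x = h x"
proof -
  have fin: "finite A" "finite B" using assms finite_subset by auto
  have "card (S - A) = card (S - B)"
    using assms fin by (simp add: card_Diff_subset bij_betw_same_card)
  then obtain g where g: "bij_betw g (S - A) (S - B)"
    using assms(1) finite_same_card_bij by (metis finite_Diff)
  define \<sigma> where "\<sigma> = (\<lambda>x. if x \<in> A then h x else if x \<in> S then g x else x)"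
  have "bij_betw \<sigma> A B" using assms(4) by (subst bij_betw_cong[of _ _ h]) (auto simp: \<sigma>_def)
  moreover have "bij_betw \<sigma> (S - A) (S - B)" using g by (subst bij_betw_cong[of _ _ g]) (auto simp: \<sigma>_def)
  ultimately have "bij_betw \<sigma> (A \<union> (S - A)) (B \<union> (S - B))" by (rule bij_betw_combine) auto
  moreover have "A \<union> (S - A) = S" "B \<union> (S - B) = S" using assms by auto
  ultimately have "bij_betw \<sigma> S S" by simp
  then have "\<sigma> permutes S" by (rule bij_imp_permutes) (use assms in \<open>auto simp: \<sigma>_def\<close>)
  then show ?thesis using that by (simp add: \<sigma>_def)
qed

text \<open>By transitivity and right translation the sum over the group does not depend on the base
  point; averaging over all base points and swapping the sums gives the identity. It says that a
  random permutation moves a fixed edge, or a fixed embedding, to a uniformly distributed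
  one.\<close>

lemma sum_permutations_transitive:
  fixes f :: "'x \<Rightarrow> real" and act :: "('s \<Rightarrow> 's) \<Rightarrow> 'x \<Rightarrow> 'x"
  assumes S: "finite S" and X: "finite X" "x0 \<in> X"
    and bij: "\<And>\<pi>. \<pi> permutes S \<Longrightarrow> bij_betw (act \<pi>) X X"
    and comp: "\<And>\<pi> \<sigma> x. \<pi> permutes S \<Longrightarrow> \<sigma> permutes S \<Longrightarrow> x \<in> X \<Longrightarrow> act (\<pi> \<circ> \<sigma>) x = act \<pi> (act \<sigma> x)"
    and trans: "\<And>x y. x \<in> X \<Longrightarrow> y \<in> X \<Longrightarrow> \<exists>\<sigma>. \<sigma> permutes S \<and> act \<sigma> x = y"
  shows "real (card X) * (\<Sum>\<pi> | \<pi> permutes S. f (act \<pi> x0)) = fact (card S) * (\<Sum>x\<in>X. f x)"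
proof -
  have same: "(\<Sum>\<pi> | \<pi> permutes S. f (act \<pi> x)) = (\<Sum>\<pi> | \<pi> permutes S. f (act \<pi> x0))" if x: "x \<in> X" for x
  proof -
    obtain \<sigma> where \<sigma>: "\<sigma> permutes S" "act \<sigma> x0 = x" using trans[OF X(2) x] by blast
    show ?thesis
    proof (rule sum.reindex_bij_witness[of _ "\<lambda>\<pi>. \<pi> \<circ> inv \<sigma>" "\<lambda>\<pi>. \<pi> \<circ> \<sigma>"])
      fix \<pi> assume "\<pi> \<in> {\<pi>. \<pi> permutes S}"
      then have \<pi>: "\<pi> permutes S" by simp
      show "(\<pi> \<circ> \<sigma>) \<circ> inv \<sigma> = \<pi>" using permutes_inv_o(1)[OF \<sigma>(1)] by (simp add: comp_assoc)
      show "\<pi> \<circ> \<sigma> \<in> {\<pi>. \<pi> permutes S}" using permutes_compose[OF \<sigma>(1) \<pi>] by simp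
      show "(\<pi> \<circ> inv \<sigma>) \<circ> \<sigma> = \<pi>" using permutes_inv_o(2)[OF \<sigma>(1)] by (simp add: comp_assoc)
      show "\<pi> \<circ> inv \<sigma> \<in> {\<pi>. \<pi> permutes S}" using permutes_compose[OF permutes_inv[OF \<sigma>(1)] \<pi>] by simp
      show "f (act (\<pi> \<circ> \<sigma>) x0) = f (act \<pi> x)" using comp[OF \<pi> \<sigma>(1) X(2)] \<sigma>(2) by simp
    qed
  qed
  have "real (card X) * (\<Sum>\<pi> | \<pi> permutes S. f (act \<pi> x0)) = (\<Sum>x\<in>X. \<Sum>\<pi> | \<pi> permutes S. f (act \<pi> x))"
    using same by simp
  also have "\<dots> = (\<Sum>\<pi> | \<pi> permutes S. \<Sum>x\<in>X. f (act \<pi> x))" by (rule sum.swap)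
  also have "\<dots> = (\<Sum>\<pi> | \<pi> permutes S. \<Sum>x\<in>X. f x)"
    using bij by (intro sum.cong refl sum.reindex_bij_betw) auto
  also have "\<dots> = fact (card S) * (\<Sum>x\<in>X. f x)" using S by (simp add: card_permutations[OF refl])
  finally show ?thesis .
qed

lemma image_permutes_edge:
  assumes "\<pi> permutes {1..n}" "e \<in> edges (complete_graph n)"
  shows "\<pi> ` e \<in> edges (complete_graph n)"
proof -
  have "card (\<pi> ` e) = card e" by (rule card_image[OF permutes_inj_on[OF assms(1)]])
  moreover have "\<pi> ` e \<subseteq> {1..n}"
    using image_mono[of e "{1..n}" \<pi>] assms(2) permutes_image[OF assms(1)] by (auto simp: edges_complete_graph)
  ultimately show ?thesis using assms(2) by (simp add: edges_complete_graph)
qed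

lemma sum_permutations_edge:
  assumes "e0 \<in> edges (complete_graph n)"
  shows "real (n choose 2) * (\<Sum>\<pi> | \<pi> permutes {1..n}. f (\<pi> ` e0)) = fact n * (\<Sum>e\<in>edges (complete_graph n). f e)"
proof -
  let ?X = "edges (complete_graph n)"
  have "real (card ?X) * (\<Sum>\<pi> | \<pi> permutes {1..n}. f (\<pi> ` e0)) = fact (card {1..n}) * (\<Sum>e\<in>?X. f e)"
  proof (rule sum_permutations_transitive)
    fix \<pi> assume \<pi>: "\<pi> permutes {1..n}"
    show "bij_betw (\<lambda>e. \<pi> ` e) ?X ?X"
    proof (rule bij_betw_imageI)
      show inj: "inj_on (\<lambda>e. \<pi> ` e) ?X"
        using permutes_inj[OF \<pi>] by (intro inj_onI) (simp add: inj_image_eq_iff)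
      show "(\<lambda>e. \<pi> ` e) ` ?X = ?X"
        by (rule endo_inj_surj[OF _ _ inj]) (use image_permutes_edge[OF \<pi>] in auto)
    qed
  next
    fix e f assume e: "e \<in> ?X" "f \<in> ?X"
    then have "finite e" "finite f" "card e = card f" by (auto simp: edges_complete_graph intro: card_ge_0_finite)
    then obtain h where h: "bij_betw h e f" using finite_same_card_bij by blast
    obtain \<sigma> where "\<sigma> permutes {1..n}" "\<And>x. x \<in> e \<Longrightarrow> \<sigma> x = h x"
      using permutes_extending[OF _ _ _ h, of "{1..n}"] e by (auto simp: edges_complete_graph)
    then show "\<exists>\<sigma>. \<sigma> permutes {1..n} \<and> \<sigma> ` e = f" using h by (intro exI[of _ \<sigma>]) (auto simp: bij_betw_def)
  qed (use assms in \<open>auto simp: image_comp\<close>)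
  then show ?thesis by (simp add: card_edges_complete_graph)
qed

lemma permutes_emb:
  assumes \<pi>: "\<pi> permutes {1..n}" and "\<phi> \<in> emb H n"
  shows "restrict (\<pi> \<circ> \<phi>) (verts H) \<in> emb H n"
proof -
  have \<phi>: "\<phi> \<in> verts H \<rightarrow>\<^sub>E {1..n}" "inj_on \<phi> (verts H)" using assms(2) unfolding emb_def by blast+
  have "\<pi> (\<phi> x) \<in> {1..n}" if "x \<in> verts H" for x
    using PiE_mem[OF \<phi>(1) that] by (simp only: permutes_in_image[OF \<pi>])
  then have "restrict (\<pi> \<circ> \<phi>) (verts H) \<in> verts H \<rightarrow>\<^sub>E {1..n}" by simp
  moreover have "inj_on (restrict (\<pi> \<circ> \<phi>) (verts H)) (verts H)"
    using comp_inj_on[OF \<phi>(2) permutes_inj_on[OF \<pi>]] by (simp add: inj_on_restrict_eq)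
  ultimately show ?thesis unfolding emb_def by blast
qed

lemma sum_permutations_emb:
  assumes H: "simple_graph H" and \<phi>0: "\<phi>0 \<in> emb H n"
  shows "real (card (emb H n)) * (\<Sum>\<pi> | \<pi> permutes {1..n}. f (restrict (\<pi> \<circ> \<phi>0) (verts H)))
    = fact n * (\<Sum>\<phi>\<in>emb H n. f \<phi>)"
proof -
  have "real (card (emb H n)) * (\<Sum>\<pi> | \<pi> permutes {1..n}. f (restrict (\<pi> \<circ> \<phi>0) (verts H)))
    = fact (card {1..n}) * (\<Sum>\<phi>\<in>emb H n. f \<phi>)"
  proof (rule sum_permutations_transitive)
    fix \<pi> assume \<pi>: "\<pi> permutes {1..n}"
    show "bij_betw (\<lambda>\<phi>. restrict (\<pi> \<circ> \<phi>) (verts H)) (emb H n) (emb H n)"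
    proof (rule bij_betw_imageI)
      show inj: "inj_on (\<lambda>\<phi>. restrict (\<pi> \<circ> \<phi>) (verts H)) (emb H n)"
      proof (rule inj_onI)
        fix \<phi> \<psi> assume a: "\<phi> \<in> emb H n" "\<psi> \<in> emb H n" and
          eq: "restrict (\<pi> \<circ> \<phi>) (verts H) = restrict (\<pi> \<circ> \<psi>) (verts H)"
        show "\<phi> = \<psi>"
        proof (rule PiE_ext)
          show "\<phi> \<in> verts H \<rightarrow>\<^sub>E {1..n}" "\<psi> \<in> verts H \<rightarrow>\<^sub>E {1..n}" using a by (auto simp: emb_def)
          fix x assume "x \<in> verts H"
          then have "\<pi> (\<phi> x) = \<pi> (\<psi> x)" using fun_cong[OF eq, of x] by simp
          then show "\<phi> x = \<psi> x" using permutes_inj[OF \<pi>] by (simp add: inj_eq)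
        qed
      qed
      show "(\<lambda>\<phi>. restrict (\<pi> \<circ> \<phi>) (verts H)) ` emb H n = emb H n"
        by (rule endo_inj_surj[OF _ _ inj]) (use permutes_emb[OF \<pi>] H in auto)
    qed
  next
    fix \<phi> \<psi> assume a: "\<phi> \<in> emb H n" "\<psi> \<in> emb H n"
    then have b: "bij_betw \<phi> (verts H) (\<phi> ` verts H)" "bij_betw \<psi> (verts H) (\<psi> ` verts H)"
      "\<phi> ` verts H \<subseteq> {1..n}" "\<psi> ` verts H \<subseteq> {1..n}"
      by (auto simp: emb_def bij_betw_def)
    obtain \<sigma> where \<sigma>: "\<sigma> permutes {1..n}" "\<And>x. x \<in> \<phi> ` verts H \<Longrightarrow> \<sigma> x = (\<psi> \<circ> inv_into (verts H) \<phi>) x"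
      by (rule permutes_extending[OF _ b(3,4) bij_betw_trans[OF bij_betw_inv_into[OF b(1)] b(2)]]) auto
    have "restrict (\<sigma> \<circ> \<phi>) (verts H) = \<psi>"
    proof (rule PiE_ext)
      show "\<psi> \<in> verts H \<rightarrow>\<^sub>E {1..n}" using a by (auto simp: emb_def)
      show "restrict (\<sigma> \<circ> \<phi>) (verts H) \<in> verts H \<rightarrow>\<^sub>E {1..n}"
        using a permutes_in_image[OF \<sigma>(1)] by (auto simp: emb_def PiE_iff simp del: atLeastAtMost_iff)
      fix x assume "x \<in> verts H"
      then show "restrict (\<sigma> \<circ> \<phi>) (verts H) x = \<psi> x"
        using \<sigma>(2)[of "\<phi> x"] a by (simp add: emb_def)
    qed
    then show "\<exists>\<sigma>. \<sigma> permutes {1..n} \<and> restrict (\<sigma> \<circ> \<phi>) (verts H) = \<psi>" using \<sigma>(1) by blast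
  qed (use assms in \<open>auto simp: fun_eq_iff\<close>)
  then show ?thesis by simp
qed

section \<open>Extremal templates and their limiting density\<close>

lemma finite_palette_templates: "finite (palette_templates l n)"
  unfolding palette_templates_def by (intro finite_PiE) auto

lemma template_weight_bounds:
  assumes "P \<in> palette_templates l n" "e \<in> edges (complete_graph n)"
  shows "0 \<le> ln (real (card (P e)))" "ln (real (card (P e))) \<le> ln (real l)"
proof -
  have P: "P e \<subseteq> {1..l}" "P e \<noteq> {}" using assms by (auto simp: palette_templates_def PiE_iff)
  then have "0 < card (P e)" by (simp add: card_gt_0_iff finite_subset)
  moreover have "card (P e) \<le> l" using card_mono[OF _ P(1)] by simp
  ultimately show "0 \<le> ln (real (card (P e)))" "ln (real (card (P e))) \<le> ln (real l)" by auto
qed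

lemma ex_log_upper:
  assumes "P \<in> palette_templates l n" "SDR_free H n P"
  shows "(\<Sum>e\<in>edges (complete_graph n). ln (real (card (P e)))) \<le> ex_log n H l"
  unfolding ex_log_def
proof (rule Max_ge)
  have "{(\<Sum>e\<in>edges (complete_graph n). ln (real (card (P e)))) | P. P \<in> palette_templates l n \<and> SDR_free H n P}
    \<subseteq> (\<lambda>P. \<Sum>e\<in>edges (complete_graph n). ln (real (card (P e)))) ` palette_templates l n" by auto
  then show "finite {(\<Sum>e\<in>edges (complete_graph n). ln (real (card (P e)))) | P. P \<in> palette_templates l n \<and> SDR_free H n P}"
    using finite_palette_templates finite_subset by blast
qed (use assms in auto)

lemma SDR_free_iff:
  assumes "simple_graph H"
  shows "SDR_free H n P \<longleftrightarrow> (\<forall>\<phi>\<in>emb H n. \<not> has_SDR (emap \<phi> (edges H)) P)"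
proof -
  have "(\<exists>F. is_copy H F (complete_graph n) \<and> has_SDR (edges F) P) \<longleftrightarrow>
    (\<exists>\<phi>\<in>emb H n. emap \<phi> (edges H) \<subseteq> edges (complete_graph n) \<and> has_SDR (emap \<phi> (edges H)) P)"
    by (rule is_copy_emb_iff[OF assms]) (simp add: complete_graph_def)
  then show ?thesis using emap_complete[OF assms] by (auto simp: SDR_free_def)
qed

text \<open>The maximum ranges over a nonempty set: if every palette is \<open>{1}\<close>, no two
  edges have distinct representatives, and \<open>H\<close> has two edges.\<close>

lemma ex_log_attained:
  assumes H: "simple_graph H" "2 \<le> ne H" and l: "1 \<le> l"
  obtains P where "P \<in> palette_templates l n" "SDR_free H n P"
    "ex_log n H l = (\<Sum>e\<in>edges (complete_graph n). ln (real (card (P e))))"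
proof -
  let ?M = "{(\<Sum>e\<in>edges (complete_graph n). ln (real (card (P e)))) | P. P \<in> palette_templates l n \<and> SDR_free H n P}"
  have "?M \<subseteq> (\<lambda>P. \<Sum>e\<in>edges (complete_graph n). ln (real (card (P e)))) ` palette_templates l n" by auto
  then have fin: "finite ?M" using finite_palette_templates finite_subset by blast
  define P0 where "P0 = (\<lambda>e\<in>edges (complete_graph n). {1::nat})"
  have "P0 \<in> palette_templates l n" using l by (auto simp: P0_def palette_templates_def)
  moreover have "SDR_free H n P0"
    unfolding SDR_free_iff[OF H(1)]
  proof (intro ballI notI)
    fix \<phi> assume \<phi>: "\<phi> \<in> emb H n" and "has_SDR (emap \<phi> (edges H)) P0"
    then obtain a where a: "\<And>f. f \<in> emap \<phi> (edges H) \<Longrightarrow> a f \<in> P0 f" "inj_on a (emap \<phi> (edges H))"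
      by (auto simp: has_SDR_def)
    have "a f = 1" if "f \<in> emap \<phi> (edges H)" for f
      using a(1)[OF that] emap_complete[OF H(1) \<phi>] that by (auto simp: P0_def split: if_splits)
    then have "card (emap \<phi> (edges H)) \<le> card {1::nat}"
      by (intro card_inj_on_le[OF a(2)]) auto
    moreover have "card (emap \<phi> (edges H)) = ne H"
      unfolding emap_def by (rule card_image, rule inj_on_image_edges[OF H(1)]) (use \<phi> in \<open>simp add: emb_def\<close>)
    ultimately show False using H(2) by simp
  qed
  ultimately have "?M \<noteq> {}" by blast
  then have "ex_log n H l \<in> ?M" unfolding ex_log_def by (rule Max_in[OF fin])
  then show ?thesis using that by blast
qed

text \<open>The two halves of being an infimum: the first gives the lower bound on colourings for
  each large \<open>n\<close>, the second supplies the fixed size used in supersaturation.\<close>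

lemma lambda_H_approx:
  assumes H: "simple_graph H" "2 \<le> ne H" and l: "1 \<le> l"
  shows "\<And>n. nv H \<le> n \<Longrightarrow> lambda_H H l \<le> ex_log n H l / real (n choose 2)"
    and "0 < \<delta> \<Longrightarrow> \<exists>n\<ge>nv H. ex_log n H l / real (n choose 2) < lambda_H H l + \<delta>"
proof -
  have nonneg: "0 \<le> ex_log n H l" for n
  proof -
    obtain P where "P \<in> palette_templates l n"
      "ex_log n H l = (\<Sum>e\<in>edges (complete_graph n). ln (real (card (P e))))"
      using ex_log_attained[OF assms] by metis
    then show ?thesis using template_weight_bounds(1) by (metis sum_nonneg)
  qed
  have bdd: "bdd_below ((\<lambda>n. ex_log n H l / real (n choose 2)) ` {nv H..})"
    by (rule bdd_belowI2[of _ 0]) (simp add: nonneg)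
  show "lambda_H H l \<le> ex_log n H l / real (n choose 2)" if "nv H \<le> n" for n
    unfolding lambda_H_def by (rule cINF_lower[OF bdd]) (use that in auto)
  show "\<exists>n\<ge>nv H. ex_log n H l / real (n choose 2) < lambda_H H l + \<delta>" if "0 < \<delta>"
    using cINF_less_iff[OF _ bdd, of "lambda_H H l + \<delta>"] that unfolding lambda_H_def by auto
qed

lemma has_SDR_cong: "(\<And>i. i \<in> I \<Longrightarrow> A i = B i) \<Longrightarrow> has_SDR I A \<longleftrightarrow> has_SDR I B"
  by (simp add: has_SDR_def)

lemma lambda_H_nonneg:
  assumes H: "simple_graph H" "2 \<le> ne H" and l: "1 \<le> l"
  shows "0 \<le> lambda_H H l"
  unfolding lambda_H_def
proof (rule cINF_greatest)
  fix n
  obtain P where "P \<in> palette_templates l n"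
    "ex_log n H l = (\<Sum>e\<in>edges (complete_graph n). ln (real (card (P e))))"
    using ex_log_attained[OF assms] by metis
  then show "0 \<le> ex_log n H l / real (n choose 2)"
    using template_weight_bounds(1) by (simp add: sum_nonneg)
qed auto

lemma emap_restrict_comp:
  assumes H: "simple_graph H"
  shows "emap (restrict (\<pi> \<circ> \<phi>) (verts H)) (edges H) = (\<lambda>f. \<pi> ` f) ` emap \<phi> (edges H)"
  unfolding emap_def image_image using simple_graphD(3)[OF H]
  by (intro image_cong refl) (force simp: image_def)

text \<open>Place a fixed complete graph on \<open>m\<close> vertices into \<open>K\<^sub>n\<close>
  by a random permutation. If the induced template is SDR-free, its weight is at most
  \<open>ex_log m H l\<close>; otherwise it contains a bad embedding, which is charged the trivial
  bound \<open>q * ln l\<close>. The expected number of bad embeddings is small, so the average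
  weight is close to the extremal one.\<close>

lemma supersaturation:
  fixes H :: "'a graph" and \<delta> :: real
  assumes H: "simple_graph H" "non_matching H" "2 \<le> ne H" and l: "1 \<le> l" and \<delta>: "0 < \<delta>"
  shows "\<exists>\<epsilon>>0. \<exists>n0. \<forall>n\<ge>n0. \<forall>P\<in>palette_templates l n.
    real (card (SDR_copies H n P)) \<le> \<epsilon> * real n ^ nv H \<longrightarrow>
    (\<Sum>e\<in>edges (complete_graph n). ln (real (card (P e)))) \<le> (lambda_H H l + \<delta>) * real (n choose 2)"
proof -
  obtain m where m: "nv H \<le> m" "ex_log m H l / real (m choose 2) < lambda_H H l + \<delta> / 2"
    using lambda_H_approx(2)[OF H(1,3) l, of "\<delta> / 2"] \<delta> by auto
  have m3: "3 \<le> m" using nv_ge_3[OF H(1,2)] m(1) by simp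
  define q where "q = real (m choose 2)"
  have q: "0 < q" unfolding q_def using m3 by (simp add: zero_less_binomial)
  define v where "v = nv H"
  \<comment> \<open>There are at most \<open>m ^ v\<close> embeddings into the small graph, and each
    becomes bad with probability at most \<open>\<epsilon> * 2 ^ v\<close>. The summand 1 keeps
    \<open>s\<close> positive when \<open>l = 1\<close>.\<close>
  define s where "s = (ln (real l) + 1) * real m ^ v * 2 ^ v"
  define \<epsilon> where "\<epsilon> = \<delta> / (2 * s)"
  have lnl: "0 \<le> ln (real l)" using l by simp
  have s: "0 < s" using lnl m3 by (simp add: s_def)
  have \<epsilon>: "0 < \<epsilon>" using \<delta> s by (simp add: \<epsilon>_def)
  have \<epsilon>_bound: "ln (real l) * real m ^ v * (\<epsilon> * 2 ^ v) \<le> \<delta> / 2"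
  proof -
    have "ln (real l) * real m ^ v * (\<epsilon> * 2 ^ v) \<le> (ln (real l) + 1) * real m ^ v * (\<epsilon> * 2 ^ v)"
      using \<epsilon> by (intro mult_right_mono) auto
    also have "\<dots> = s * \<epsilon>" by (simp add: s_def)
    also have "\<dots> = \<delta> / 2" using s by (simp add: \<epsilon>_def)
    finally show ?thesis .
  qed
  show ?thesis
  proof (rule exI[of _ \<epsilon>], intro conjI \<epsilon>, rule exI[of _ "m + 2 * v"], intro allI ballI impI)
    fix n P assume n: "m + 2 * v \<le> n" and P: "P \<in> palette_templates l n"
    let ?E = "edges (complete_graph n)" and ?M = "edges (complete_graph m)" and ?\<Pi> = "{\<pi>. \<pi> permutes {1..n}}"
    define Bad where "Bad = SDR_copies H n P"
    assume "real (card (SDR_copies H n P)) \<le> \<epsilon> * real n ^ nv H"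
    then have bad: "real (card Bad) \<le> \<epsilon> * real n ^ v" by (simp add: Bad_def v_def)
    define w where "w = (\<lambda>e. ln (real (card (P e))))"
    define ind where "ind = (\<lambda>\<phi>. if \<phi> \<in> Bad then 1 else 0 :: real)"
    have ME: "?M \<subseteq> ?E" using n by (auto simp: edges_complete_graph)
    have embmn: "emb H m \<subseteq> emb H n"
    proof
      fix \<phi> assume "\<phi> \<in> emb H m"
      then show "\<phi> \<in> emb H n" using n by (force simp: emb_def PiE_iff)
    qed
    have one: "(\<Sum>e\<in>?M. w (\<pi> ` e)) \<le> ex_log m H l + q * ln (real l) * (\<Sum>\<phi>\<in>emb H m. ind (restrict (\<pi> \<circ> \<phi>) (verts H)))"
      if \<pi>: "\<pi> permutes {1..n}" for \<pi>
    proof -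
      define Q where "Q = (\<lambda>e\<in>?M. P (\<pi> ` e))"
      have E: "\<pi> ` e \<in> ?E" if "e \<in> ?M" for e using image_permutes_edge[OF \<pi>] ME that by blast
      have Q: "Q \<in> palette_templates l m"
        using P E unfolding palette_templates_def Q_def by (simp add: PiE_iff)
      have ind_nonneg: "0 \<le> ind \<phi>" for \<phi> by (simp add: ind_def)
      have ex0: "0 \<le> ex_log m H l"
      proof -
        obtain P' where P': "P' \<in> palette_templates l m"
          "ex_log m H l = (\<Sum>e\<in>?M. ln (real (card (P' e))))"
          using ex_log_attained[OF H(1,3) l] by metis
        show ?thesis unfolding P'(2) by (intro sum_nonneg template_weight_bounds(1)[OF P'(1)])
      qed
      show ?thesis
      proof (cases "SDR_free H m Q")
        case True
        have "(\<Sum>e\<in>?M. w (\<pi> ` e)) = (\<Sum>e\<in>?M. ln (real (card (Q e))))" by (simp add: Q_def w_def)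
        also have "\<dots> \<le> ex_log m H l" by (rule ex_log_upper[OF Q True])
        finally show ?thesis using q lnl ind_nonneg by (smt (verit) mult_nonneg_nonneg sum_nonneg)
      next
        case False
        then obtain \<phi> where \<phi>: "\<phi> \<in> emb H m" "has_SDR (emap \<phi> (edges H)) Q"
          unfolding SDR_free_iff[OF H(1)] by blast
        then obtain a where a: "\<And>f. f \<in> emap \<phi> (edges H) \<Longrightarrow> a f \<in> Q f" "inj_on a (emap \<phi> (edges H))"
          by (auto simp: has_SDR_def)
        have sub: "emap \<phi> (edges H) \<subseteq> ?M" by (rule emap_complete[OF H(1) \<phi>(1)])
        have inv: "inv \<pi> ` \<pi> ` f = f" for f using permutes_inj[OF \<pi>] by (simp add: image_comp)
        have "has_SDR (emap (restrict (\<pi> \<circ> \<phi>) (verts H)) (edges H)) P"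
          unfolding has_SDR_def emap_restrict_comp[OF H(1)]
        proof (rule exI[of _ "\<lambda>g. a (inv \<pi> ` g)"], intro conjI ballI)
          fix g assume "g \<in> (\<lambda>f. \<pi> ` f) ` emap \<phi> (edges H)"
          then obtain f where f: "f \<in> emap \<phi> (edges H)" "g = \<pi> ` f" by blast
          then have "f \<in> ?M" using sub by blast
          then have "Q f = P g" using f(2) by (simp add: Q_def)
          then show "a (inv \<pi> ` g) \<in> P g" using a(1)[OF f(1)] f(2) inv by simp
        next
          show "inj_on (\<lambda>g. a (inv \<pi> ` g)) ((\<lambda>f. \<pi> ` f) ` emap \<phi> (edges H))"
            using a(2) inv by (auto simp: inj_on_def)
        qed
        moreover have "restrict (\<pi> \<circ> \<phi>) (verts H) \<in> emb H n"
          using permutes_emb[OF \<pi>] \<phi>(1) embmn by blast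
        ultimately have "ind (restrict (\<pi> \<circ> \<phi>) (verts H)) = 1" by (simp add: ind_def Bad_def)
        then have "1 \<le> (\<Sum>\<phi>\<in>emb H m. ind (restrict (\<pi> \<circ> \<phi>) (verts H)))"
          using member_le_sum[OF \<phi>(1), of "\<lambda>\<phi>. ind (restrict (\<pi> \<circ> \<phi>) (verts H))"] ind_nonneg H(1) by simp
        then have "q * ln (real l) * 1 \<le> q * ln (real l) * (\<Sum>\<phi>\<in>emb H m. ind (restrict (\<pi> \<circ> \<phi>) (verts H)))"
          using q lnl by (intro mult_left_mono) auto
        moreover have "(\<Sum>e\<in>?M. w (\<pi> ` e)) \<le> (\<Sum>e\<in>?M. ln (real l))"
          unfolding w_def by (intro sum_mono template_weight_bounds(2)[OF P] E)
        moreover have "(\<Sum>e\<in>?M. ln (real l)) = q * ln (real l)" by (simp add: card_edges_complete_graph q_def)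
        ultimately show ?thesis using ex0 by linarith
      qed
    qed
    have cn: "0 < real (n choose 2)" using m3 n by (simp add: zero_less_binomial)
    have ce: "(real n / 2) ^ v \<le> real (card (emb H n))" unfolding v_def by (rule card_emb_ge[OF H(1)]) (use n v_def in simp)
    have n0: "0 < real n" using m3 n by simp
    have cepos: "0 < real (card (emb H n))" by (rule less_le_trans[OF _ ce]) (use n0 in simp)
    define W where "W = (\<Sum>e\<in>?E. w e)"
    define F :: real where "F = fact n"
    have F: "0 < F" by (simp add: F_def)
    have edge: "(\<Sum>\<pi>\<in>?\<Pi>. w (\<pi> ` e)) = F * W / real (n choose 2)" if "e \<in> ?M" for e
      using sum_permutations_edge[of e n w] that ME cn unfolding W_def F_def by (auto simp: field_simps)
    have copy: "(\<Sum>\<pi>\<in>?\<Pi>. ind (restrict (\<pi> \<circ> \<phi>) (verts H))) = F * real (card Bad) / real (card (emb H n))"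
      if "\<phi> \<in> emb H m" for \<phi>
    proof -
      have "(\<Sum>\<phi>\<in>emb H n. ind \<phi>) = real (card Bad)"
        using H(1) by (simp add: ind_def sum.If_cases Bad_def Int_absorb1 Collect_conj_eq)
      then show ?thesis
        using sum_permutations_emb[OF H(1), of \<phi> n ind] that embmn cepos unfolding F_def by (auto simp: field_simps)
    qed
    \<comment> \<open>Double counting over all permutations: the left side is \<open>fact n\<close>
      times the expected weight seen by the small graph.\<close>
    have "q * (F * W / real (n choose 2)) = (\<Sum>e\<in>?M. \<Sum>\<pi>\<in>?\<Pi>. w (\<pi> ` e))"
      using edge by (simp add: card_edges_complete_graph q_def)
    also have "\<dots> = (\<Sum>\<pi>\<in>?\<Pi>. \<Sum>e\<in>?M. w (\<pi> ` e))" by (rule sum.swap)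
    also have "\<dots> \<le> (\<Sum>\<pi>\<in>?\<Pi>. ex_log m H l + q * ln (real l) * (\<Sum>\<phi>\<in>emb H m. ind (restrict (\<pi> \<circ> \<phi>) (verts H))))"
      by (intro sum_mono one) simp
    also have "\<dots> = F * ex_log m H l + q * ln (real l) * (\<Sum>\<phi>\<in>emb H m. \<Sum>\<pi>\<in>?\<Pi>. ind (restrict (\<pi> \<circ> \<phi>) (verts H)))"
      by (subst sum.swap) (simp add: sum.distrib sum_distrib_left F_def card_permutations[OF refl])
    also have "(\<Sum>\<phi>\<in>emb H m. \<Sum>\<pi>\<in>?\<Pi>. ind (restrict (\<pi> \<circ> \<phi>) (verts H))) = real (card (emb H m)) * (F * real (card Bad) / real (card (emb H n)))"
      using copy by simp
    also have "\<dots> \<le> real m ^ v * (F * (\<epsilon> * 2 ^ v))"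
    proof (rule mult_mono)
      show "real (card (emb H m)) \<le> real m ^ v" unfolding v_def by (rule card_emb_le[OF H(1)])
      have "real (card Bad) / real (card (emb H n)) \<le> \<epsilon> * real n ^ v / (real n / 2) ^ v"
        using bad ce n0 by (intro frac_le) auto
      also have "\<dots> = \<epsilon> * 2 ^ v" using n0 by (simp add: power_divide)
      finally have "F * (real (card Bad) / real (card (emb H n))) \<le> F * (\<epsilon> * 2 ^ v)"
        using F by (intro mult_left_mono) auto
      then show "F * real (card Bad) / real (card (emb H n)) \<le> F * (\<epsilon> * 2 ^ v)" by simp
    qed (use F in auto)
    finally have "q * (F * W / real (n choose 2)) \<le> F * ex_log m H l + q * ln (real l) * (real m ^ v * (F * (\<epsilon> * 2 ^ v)))"
      using q lnl by (simp add: mult_left_mono)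
    then have "(q * F) * (W / real (n choose 2)) \<le> (q * F) * (ex_log m H l / q + ln (real l) * real m ^ v * (\<epsilon> * 2 ^ v))"
      using q by (simp add: algebra_simps)
    then have "W / real (n choose 2) \<le> ex_log m H l / q + ln (real l) * real m ^ v * (\<epsilon> * 2 ^ v)"
      using q F by (subst (asm) mult_le_cancel_left_pos) auto
    also have "\<dots> \<le> lambda_H H l + \<delta>" using m(2) \<epsilon>_bound unfolding q_def by linarith
    finally show "(\<Sum>e\<in>?E. ln (real (card (P e)))) \<le> (lambda_H H l + \<delta>) * real (n choose 2)"
      using cn by (simp add: W_def w_def field_simps)
  qed
qed

section \<open>Containers with empty palettes\<close>

text \<open>
  Palettes of a container may be empty. No colouring inside the container uses such an edge, so it
  may be charged a large negative weight; then many empty palettes only help.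
\<close>

definition container_weight :: "real \<Rightarrow> (nat set \<times> nat) set \<Rightarrow> nat set \<Rightarrow> real" where
  "container_weight L C e = (if template_of C e = {} then - L else ln (real (card (template_of C e))))"

text \<open>If few palettes are empty, replacing them by \<open>{1}\<close> creates few new
  embeddings with an SDR, since each edge lies in O(n^(v-2)) embeddings, and supersaturation still
  applies. If many are empty, their negative weight outweighs everything else.\<close>

lemma container_weight_sum:
  fixes H :: "'a graph" and \<delta> :: real
  assumes H: "simple_graph H" "non_matching H" "2 \<le> ne H" and l: "1 \<le> l" and \<delta>: "0 < \<delta>"
  shows "\<exists>\<epsilon>>0. \<exists>L\<ge>0. \<exists>n0. \<forall>n\<ge>n0. \<forall>C. C \<subseteq> edges (complete_graph n) \<times> {1..l} \<longrightarrow>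
    real (card (SDR_copies H n (template_of C))) \<le> \<epsilon> * real n ^ nv H \<longrightarrow>
    (\<Sum>e\<in>edges (complete_graph n). container_weight L C e) \<le> (lambda_H H l + \<delta>) * real (n choose 2)"
proof -
  obtain \<epsilon> n0 where \<epsilon>: "0 < \<epsilon>" and super: "\<And>n P. n0 \<le> n \<Longrightarrow> P \<in> palette_templates l n \<Longrightarrow>
    real (card (SDR_copies H n P)) \<le> \<epsilon> * real n ^ nv H \<Longrightarrow>
    (\<Sum>e\<in>edges (complete_graph n). ln (real (card (P e)))) \<le> (lambda_H H l + \<delta>) * real (n choose 2)"
    using supersaturation[OF assms] by blast
  define D where "D = (2 ^ ne H * real (nv H) ^ nv H)"
  have D: "0 < D" using nv_ge_3[OF H(1,2)] by (simp add: D_def)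
  \<comment> \<open>With this \<open>\<eta>\<close>, filling \<open>\<eta> * n\<^sup>2\<close> empty
    palettes uses up the other half of \<open>\<epsilon>\<close>. The penalty
    \<open>L = ln l / \<eta>\<close> below makes that many empty palettes cancel the trivial bound
    \<open>n\<^sup>2 * ln l\<close>.\<close>
  define \<eta> where "\<eta> = \<epsilon> / (2 * D)"
  have \<eta>: "0 < \<eta>" using \<epsilon> D by (simp add: \<eta>_def)
  have lnl: "0 \<le> ln (real l)" using l by simp
  define L where "L = ln (real l) / \<eta>"
  have L: "0 \<le> L" using lnl \<eta> by (simp add: L_def)
  show ?thesis
  proof (rule exI[of _ "\<epsilon> / 2"], intro conjI, use \<epsilon> in simp, rule exI[of _ L], intro conjI L, rule exI[of _ "n0 + 2"], intro allI impI)
    fix n C assume n: "n0 + 2 \<le> n" and C: "C \<subseteq> edges (complete_graph n) \<times> {1..l}"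
      and few: "real (card (SDR_copies H n (template_of C))) \<le> \<epsilon> / 2 * real n ^ nv H"
    let ?E = "edges (complete_graph n)"
    define Z where "Z = {e \<in> ?E. template_of C e = {}}"
    have finZ: "finite Z" by (simp add: Z_def)
    have sub: "template_of C e \<subseteq> {1..l}" for e using C by (auto simp: template_of_def)
    have nn: "0 \<le> real n ^ nv H" by simp
    show "(\<Sum>e\<in>?E. container_weight L C e) \<le> (lambda_H H l + \<delta>) * real (n choose 2)"
    proof (cases "real (card Z) \<le> \<eta> * real n ^ 2")
      case True
      define P where "P = (\<lambda>e\<in>?E. if template_of C e = {} then {1} else template_of C e)"
      have P: "P \<in> palette_templates l n" using sub l by (auto simp: P_def palette_templates_def)
      have "SDR_copies H n P \<subseteq>
          SDR_copies H n (template_of C) \<union> (\<Union>f\<in>Z. {\<phi> \<in> emb H n. {f} \<subseteq> emap \<phi> (edges H)})"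
      proof
        fix \<phi> assume "\<phi> \<in> SDR_copies H n P"
        then have \<phi>: "\<phi> \<in> emb H n" "has_SDR (emap \<phi> (edges H)) P" by auto
        show "\<phi> \<in> SDR_copies H n (template_of C) \<union> (\<Union>f\<in>Z. {\<phi> \<in> emb H n. {f} \<subseteq> emap \<phi> (edges H)})"
        proof (cases "emap \<phi> (edges H) \<inter> Z = {}")
          case True
          have "has_SDR (emap \<phi> (edges H)) (template_of C)"
          proof (rule iffD1[OF has_SDR_cong \<phi>(2)])
            fix f assume f: "f \<in> emap \<phi> (edges H)"
            then have "f \<in> ?E" using emap_complete[OF H(1) \<phi>(1)] by blast
            then show "P f = template_of C f" using f True by (auto simp: P_def Z_def)
          qed
          then show ?thesis using \<phi>(1) by simp
        qed (use \<phi>(1) in auto)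
      qed
      then have "card (SDR_copies H n P) \<le>
          card (SDR_copies H n (template_of C) \<union> (\<Union>f\<in>Z. {\<phi> \<in> emb H n. {f} \<subseteq> emap \<phi> (edges H)}))"
        using finZ H(1) by (intro card_mono) auto
      also have "\<dots> \<le> card (SDR_copies H n (template_of C)) + card (\<Union>f\<in>Z. {\<phi> \<in> emb H n. {f} \<subseteq> emap \<phi> (edges H)})"
        by (rule card_Un_le)
      also have "card (\<Union>f\<in>Z. {\<phi> \<in> emb H n. {f} \<subseteq> emap \<phi> (edges H)}) \<le> (\<Sum>f\<in>Z. card {\<phi> \<in> emb H n. {f} \<subseteq> emap \<phi> (edges H)})"
        by (rule card_UN_le[OF finZ])
      finally have "card (SDR_copies H n P) \<le> card (SDR_copies H n (template_of C))
          + (\<Sum>f\<in>Z. card {\<phi> \<in> emb H n. {f} \<subseteq> emap \<phi> (edges H)})" by simp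
      from of_nat_mono[OF this, where 'a = real]
      have "real (card (SDR_copies H n P)) \<le> real (card (SDR_copies H n (template_of C)))
          + (\<Sum>f\<in>Z. real (card {\<phi> \<in> emb H n. {f} \<subseteq> emap \<phi> (edges H)}))" by (simp only: of_nat_add of_nat_sum)
      also have "\<dots> \<le> \<epsilon> / 2 * real n ^ nv H + (\<Sum>f\<in>Z. D * (real n ^ nv H / real n ^ 2))"
      proof (intro add_mono few sum_mono)
        fix f
        have "real (card {\<phi> \<in> emb H n. {f} \<subseteq> emap \<phi> (edges H)}) \<le>
            D * (real n ^ nv H / real n ^ 2) * (real n powr (- 1 / m2 H)) ^ (card {f} - 1)"
          unfolding D_def using m2_bound(2)[OF H(1)] m2_ge_1[OF H(1,2)] n by (intro card_emb_containing[OF H(1)]) auto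
        then show "real (card {\<phi> \<in> emb H n. {f} \<subseteq> emap \<phi> (edges H)}) \<le> D * (real n ^ nv H / real n ^ 2)" by simp
      qed
      also have "(\<Sum>f\<in>Z. D * (real n ^ nv H / real n ^ 2)) = real (card Z) * (D * (real n ^ nv H / real n ^ 2))" by simp
      also have "\<dots> \<le> (\<eta> * real n ^ 2) * (D * (real n ^ nv H / real n ^ 2))"
        using True D by (intro mult_right_mono) auto
      also have "\<dots> = \<epsilon> / 2 * real n ^ nv H" using D n by (simp add: \<eta>_def)
      finally have "real (card (SDR_copies H n P)) \<le> \<epsilon> * real n ^ nv H" by simp
      from super[OF _ P this] have "(\<Sum>e\<in>?E. ln (real (card (P e)))) \<le> (lambda_H H l + \<delta>) * real (n choose 2)"
        using n by simp
      moreover have "(\<Sum>e\<in>?E. container_weight L C e) \<le> (\<Sum>e\<in>?E. ln (real (card (P e))))"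
        using L by (intro sum_mono) (auto simp: container_weight_def P_def)
      ultimately show ?thesis by linarith
    next
      case False
      have "container_weight L C e \<le> ln (real l) - (if e \<in> Z then L else 0)" if "e \<in> ?E" for e
      proof (cases "template_of C e = {}")
        case True
        then show ?thesis using that lnl by (simp add: container_weight_def Z_def)
      next
        case False
        then have "0 < card (template_of C e)" using finite_subset[OF sub] by (simp add: card_gt_0_iff)
        moreover have "card (template_of C e) \<le> l" using card_mono[OF _ sub] by simp
        ultimately show ?thesis using False by (simp add: container_weight_def Z_def)
      qed
      then have "(\<Sum>e\<in>?E. container_weight L C e) \<le> (\<Sum>e\<in>?E. ln (real l) - (if e \<in> Z then L else 0))"
        by (rule sum_mono)
      also have "\<dots> = real (n choose 2) * ln (real l) - real (card Z) * L"
        by (simp add: sum_subtractf card_edges_complete_graph sum.If_cases Z_def Int_absorb1 Collect_conj_eq)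
      also have "\<dots> \<le> real n ^ 2 * ln (real l) - (\<eta> * real n ^ 2) * L"
        using card_choose_two_bounds(2)[of n] n False lnl L by (intro diff_mono mult_right_mono) auto
      also have "\<dots> = 0" using \<eta> by (simp add: L_def)
      also have "0 \<le> (lambda_H H l + \<delta>) * real (n choose 2)"
        using lambda_H_nonneg[OF H(1,3) l] \<delta> by simp
      finally show ?thesis .
    qed
  qed
qed

section \<open>Moments in the binomial random graph\<close>

lemma gnp_support:
  assumes "G \<in> set_pmf (gnp n p)"
  shows "verts G = {1..n}" "edges G \<subseteq> edges (complete_graph n)"
  using assms by (auto simp: gnp_def)

lemma finite_set_gnp: "finite (set_pmf (gnp n p))"
proof (rule finite_subset)
  show "set_pmf (gnp n p) \<subseteq> Graph {1..n} ` Pow (edges (complete_graph n))"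
    by (auto simp: gnp_def)
qed simp

lemma integrable_gnp: "integrable (gnp n p) (f :: nat graph \<Rightarrow> real)"
  by (rule integrable_measure_pmf_finite[OF finite_set_gnp])

lemma expectation_gnp_mono:
  fixes f g :: "nat graph \<Rightarrow> real"
  assumes "\<And>G. G \<in> set_pmf (gnp n p) \<Longrightarrow> f G \<le> g G"
  shows "measure_pmf.expectation (gnp n p) f \<le> measure_pmf.expectation (gnp n p) g"
  using assms by (intro integral_mono_AE integrable_gnp) (auto simp: AE_measure_pmf_iff)

lemma prob_gnp_le_expectation:
  fixes f :: "nat graph \<Rightarrow> real"
  assumes "\<And>G. G \<in> set_pmf (gnp n p) \<Longrightarrow> 0 \<le> f G" "\<And>G. G \<in> set_pmf (gnp n p) \<Longrightarrow> Q G \<Longrightarrow> 1 \<le> f G"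
  shows "measure_pmf.prob (gnp n p) {G. Q G} \<le> measure_pmf.expectation (gnp n p) f"
proof -
  have "measure_pmf.prob (gnp n p) {G. Q G} = measure_pmf.expectation (gnp n p) (indicator {G. Q G})" by simp
  also have "\<dots> \<le> measure_pmf.expectation (gnp n p) f"
    using assms by (intro expectation_gnp_mono) (auto simp: indicator_def)
  finally show ?thesis .
qed

lemma prob_gnp_mono:
  assumes "\<And>G. G \<in> set_pmf (gnp n p) \<Longrightarrow> Q G \<Longrightarrow> Q' G"
  shows "measure_pmf.prob (gnp n p) {G. Q G} \<le> measure_pmf.prob (gnp n p) {G. Q' G}"
  using assms by (intro measure_pmf.finite_measure_mono_AE) (auto simp: AE_measure_pmf_iff)

lemma prob_gnp_disj:
  "measure_pmf.prob (gnp n p) {G. Q G \<or> Q' G} \<le>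
    measure_pmf.prob (gnp n p) {G. Q G} + measure_pmf.prob (gnp n p) {G. Q' G}"
  using measure_Un_le[of "{G. Q G}" "gnp n p" "{G. Q' G}"]
  by (simp add: Collect_disj_eq)

lemma whp_gnpI:
  assumes "\<And>\<epsilon>. 0 < \<epsilon> \<Longrightarrow> \<forall>\<^sub>F n in sequentially. measure_pmf.prob (gnp n (p n)) {G. \<not> Q G} \<le> \<epsilon>"
  shows "whp_gnp p Q"
  unfolding whp_gnp_def
proof (rule LIMSEQ_I)
  fix r :: real assume "0 < r"
  then have "\<forall>\<^sub>F n in sequentially. measure_pmf.prob (gnp n (p n)) {G. \<not> Q G} \<le> r / 2" by (intro assms) simp
  then obtain n0 where n0: "\<And>n. n0 \<le> n \<Longrightarrow> measure_pmf.prob (gnp n (p n)) {G. \<not> Q G} \<le> r / 2"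
    by (auto simp: eventually_sequentially)
  have "norm (measure_pmf.prob (gnp n (p n)) {G. Q G} - 1) < r" if "n0 \<le> n" for n
  proof -
    have "{G. \<not> Q G} = space (gnp n (p n)) - {G. Q G}" by auto
    then have "measure_pmf.prob (gnp n (p n)) {G. \<not> Q G} = 1 - measure_pmf.prob (gnp n (p n)) {G. Q G}"
      using measure_pmf.prob_compl[of "{G. Q G}" "gnp n (p n)"] by simp
    then show ?thesis using n0[OF that] \<open>0 < r\<close> measure_pmf.prob_le_1[of "gnp n (p n)" "{G. Q G}"] by simp
  qed
  then show "\<exists>n0. \<forall>n\<ge>n0. norm (measure_pmf.prob (gnp n (p n)) {G. Q G} - 1) < r" by blast
qed

section \<open>Independence, second moments and Chebyshev's inequality\<close>

lemma expectation_gnp_prod: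
  fixes f :: "nat set \<Rightarrow> bool \<Rightarrow> real"
  assumes p: "0 \<le> p" "p \<le> 1" and nn: "\<And>e b. 0 \<le> f e b"
  shows "measure_pmf.expectation (gnp n p) (\<lambda>G. \<Prod>e\<in>edges (complete_graph n). f e (e \<in> edges G)) =
    (\<Prod>e\<in>edges (complete_graph n). f e True * p + f e False * (1 - p))"
proof -
  let ?E = "edges (complete_graph n)"
  have "measure_pmf.expectation (gnp n p) (\<lambda>G. \<Prod>e\<in>?E. f e (e \<in> edges G)) =
     measure_pmf.expectation (Pi_pmf ?E False (\<lambda>_. bernoulli_pmf p)) (\<lambda>b. \<Prod>e\<in>?E. f e (b e))"
    unfolding gnp_def integral_map_pmf by (intro Bochner_Integration.integral_cong refl prod.cong) auto
  also have "\<dots> = (\<Prod>e\<in>?E. measure_pmf.expectation (bernoulli_pmf p) (f e))"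
    by (intro expectation_prod_Pi_pmf) (auto intro: integrable_measure_pmf_finite nn)
  also have "\<dots> = (\<Prod>e\<in>?E. f e True * p + f e False * (1 - p))" using p by simp
  finally show ?thesis .
qed

lemma expectation_gnp_contains:
  assumes p: "0 \<le> p" "p \<le> 1" and S: "S \<subseteq> edges (complete_graph n)"
  shows "measure_pmf.expectation (gnp n p) (\<lambda>G. of_bool (S \<subseteq> edges G)) = p ^ card S"
proof -
  let ?E = "edges (complete_graph n)"
  have "measure_pmf.expectation (gnp n p) (\<lambda>G. of_bool (S \<subseteq> edges G) :: real) =
    measure_pmf.expectation (gnp n p) (\<lambda>G. \<Prod>e\<in>?E. of_bool (e \<in> S \<longrightarrow> e \<in> edges G))"
  proof (rule Bochner_Integration.integral_cong[OF refl])
    fix G :: "nat graph"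
    show "(of_bool (S \<subseteq> edges G) :: real) = (\<Prod>e\<in>?E. of_bool (e \<in> S \<longrightarrow> e \<in> edges G))"
    proof (cases "S \<subseteq> edges G")
      case True
      have "(\<Prod>e\<in>?E. of_bool (e \<in> S \<longrightarrow> e \<in> edges G) :: real) = 1"
        by (rule prod.neutral) (use True in auto)
      then show ?thesis using True by simp
    next
      case False
      then obtain e where "e \<in> S" "e \<notin> edges G" by blast
      then have "(\<Prod>e\<in>?E. of_bool (e \<in> S \<longrightarrow> e \<in> edges G) :: real) = 0"
        using S by (intro prod_zero) auto
      then show ?thesis using False by simp
    qed
  qed
  also have "\<dots> = (\<Prod>e\<in>?E. of_bool (e \<in> S \<longrightarrow> True) * p + of_bool (e \<in> S \<longrightarrow> False) * (1 - p))"
    by (rule expectation_gnp_prod[OF p]) auto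
  also have "\<dots> = (\<Prod>e\<in>?E. if e \<in> S then p else 1)" by (intro prod.cong) auto
  also have "\<dots> = p ^ card S" using S by (simp add: prod.If_cases Int_absorb1)
  finally show ?thesis .
qed

text \<open>One formula for two uses: single edges with arbitrary weights, and embedded copies of
  \<open>J\<close> with weight 1.\<close>

lemma second_moment_gnp:
  fixes x :: "'i \<Rightarrow> real"
  assumes p: "0 \<le> p" "p \<le> 1" and S: "\<And>i. i \<in> I \<Longrightarrow> S i \<subseteq> edges (complete_graph n)"
  shows "measure_pmf.expectation (gnp n p) (\<lambda>G. ((\<Sum>i\<in>I. x i * of_bool (S i \<subseteq> edges G)) - (\<Sum>i\<in>I. x i * p ^ card (S i)))\<^sup>2)
    = (\<Sum>i\<in>I. \<Sum>j\<in>I. x i * x j * (p ^ card (S i \<union> S j) - p ^ (card (S i) + card (S j))))" (is "?L = ?R")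
proof -
  define b where "b = (\<lambda>i G. of_bool (S i \<subseteq> edges G) :: real)"
  have "?L = measure_pmf.expectation (gnp n p) (\<lambda>G. \<Sum>i\<in>I. \<Sum>j\<in>I. x i * x j * ((b i G - p ^ card (S i)) * (b j G - p ^ card (S j))))"
  proof (rule Bochner_Integration.integral_cong[OF refl])
    fix G :: "nat graph"
    define z where "z = (\<lambda>i. x i * (b i G - p ^ card (S i)))"
    have "(\<Sum>i\<in>I. x i * of_bool (S i \<subseteq> edges G)) - (\<Sum>i\<in>I. x i * p ^ card (S i)) = (\<Sum>i\<in>I. z i)"
      by (simp add: z_def b_def right_diff_distrib sum_subtractf)
    then have "((\<Sum>i\<in>I. x i * of_bool (S i \<subseteq> edges G)) - (\<Sum>i\<in>I. x i * p ^ card (S i)))\<^sup>2 = (\<Sum>i\<in>I. \<Sum>j\<in>I. z i * z j)"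
      by (simp only: power2_eq_square sum_product)
    also have "\<dots> = (\<Sum>i\<in>I. \<Sum>j\<in>I. x i * x j * ((b i G - p ^ card (S i)) * (b j G - p ^ card (S j))))"
      by (intro sum.cong refl) (simp only: z_def mult_ac)
    finally show "((\<Sum>i\<in>I. x i * of_bool (S i \<subseteq> edges G)) - (\<Sum>i\<in>I. x i * p ^ card (S i)))\<^sup>2
      = (\<Sum>i\<in>I. \<Sum>j\<in>I. x i * x j * ((b i G - p ^ card (S i)) * (b j G - p ^ card (S j))))" .
  qed
  also have "\<dots> = (\<Sum>i\<in>I. \<Sum>j\<in>I. measure_pmf.expectation (gnp n p) (\<lambda>G. x i * x j * ((b i G - p ^ card (S i)) * (b j G - p ^ card (S j)))))"
    by (simp add: Bochner_Integration.integral_sum integrable_gnp)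
  also have "\<dots> = ?R"
  proof (intro sum.cong refl)
    fix i j assume ij: "i \<in> I" "j \<in> I"
    have E: "measure_pmf.expectation (gnp n p) (b k) = p ^ card (S k)" if "k \<in> I" for k
      unfolding b_def by (rule expectation_gnp_contains[OF p S[OF that]])
    have "measure_pmf.expectation (gnp n p) (\<lambda>G. (b i G - p ^ card (S i)) * (b j G - p ^ card (S j)))
      = measure_pmf.expectation (gnp n p) (\<lambda>G. of_bool (S i \<union> S j \<subseteq> edges G) - p ^ card (S i) * b j G
          - p ^ card (S j) * b i G + p ^ card (S i) * p ^ card (S j))"
      by (intro Bochner_Integration.integral_cong refl) (auto simp: b_def algebra_simps)
    also have "\<dots> = p ^ card (S i \<union> S j) - p ^ card (S i) * p ^ card (S j) - p ^ card (S j) * p ^ card (S i) + p ^ card (S i) * p ^ card (S j)"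
      using E[OF ij(1)] E[OF ij(2)] expectation_gnp_contains[OF p, of "S i \<union> S j" n] S[OF ij(1)] S[OF ij(2)]
      by (simp add: integrable_gnp)
    finally show "measure_pmf.expectation (gnp n p) (\<lambda>G. x i * x j * ((b i G - p ^ card (S i)) * (b j G - p ^ card (S j))))
        = x i * x j * (p ^ card (S i \<union> S j) - p ^ (card (S i) + card (S j)))"
      by (simp add: power_add)
  qed
  finally show ?thesis .
qed

lemma prob_gnp_Chebyshev:
  fixes X :: "nat graph \<Rightarrow> real"
  assumes "0 < t"
  shows "measure_pmf.prob (gnp n p) {G. t \<le> \<bar>X G - \<mu>\<bar>} \<le> measure_pmf.expectation (gnp n p) (\<lambda>G. (X G - \<mu>)\<^sup>2) / t\<^sup>2"
proof -
  have "measure_pmf.prob (gnp n p) {G. t \<le> \<bar>X G - \<mu>\<bar>} \<le> measure_pmf.expectation (gnp n p) (\<lambda>G. (X G - \<mu>)\<^sup>2 / t\<^sup>2)"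
  proof (rule prob_gnp_le_expectation)
    fix G assume "t \<le> \<bar>X G - \<mu>\<bar>"
    then have "t\<^sup>2 \<le> (X G - \<mu>)\<^sup>2" using assms by (simp add: abs_le_square_iff[symmetric])
    then show "1 \<le> (X G - \<mu>)\<^sup>2 / t\<^sup>2" using assms by simp
  qed simp
  then show ?thesis by simp
qed

text \<open>Distinct edges are independent, so only the diagonal terms of the second moment
  survive.\<close>

lemma edge_sum_Chebyshev:
  fixes x :: "nat set \<Rightarrow> real"
  assumes p: "0 \<le> p" "p \<le> 1" and t: "0 < t"
    and x: "\<And>e. e \<in> edges (complete_graph n) \<Longrightarrow> \<bar>x e\<bar> \<le> M"
  shows "measure_pmf.prob (gnp n p) {G. t \<le> \<bar>(\<Sum>e\<in>edges G. x e) - p * (\<Sum>e\<in>edges (complete_graph n). x e)\<bar>}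
    \<le> p * M\<^sup>2 * real (n choose 2) / t\<^sup>2"
proof -
  let ?E = "edges (complete_graph n)"
  define X where "X = (\<lambda>G. \<Sum>e\<in>?E. x e * of_bool ({e} \<subseteq> edges G))"
  define \<mu> where "\<mu> = (\<Sum>e\<in>?E. x e * p ^ card {e})"
  have \<mu>: "\<mu> = p * (\<Sum>e\<in>?E. x e)" by (simp add: \<mu>_def sum_distrib_left mult.commute)
  have X: "X G = (\<Sum>e\<in>edges G. x e)" if "G \<in> set_pmf (gnp n p)" for G
  proof -
    have "X G = (\<Sum>e\<in>?E. if e \<in> edges G then x e else 0)" unfolding X_def by (intro sum.cong) auto
    also have "\<dots> = (\<Sum>e\<in>?E \<inter> edges G. x e)" by (simp add: sum.If_cases)
    also have "?E \<inter> edges G = edges G" using gnp_support(2)[OF that] by blast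
    finally show ?thesis .
  qed
  have "measure_pmf.prob (gnp n p) {G. t \<le> \<bar>(\<Sum>e\<in>edges G. x e) - p * (\<Sum>e\<in>?E. x e)\<bar>}
      \<le> measure_pmf.prob (gnp n p) {G. t \<le> \<bar>X G - \<mu>\<bar>}"
    by (rule prob_gnp_mono) (simp add: X \<mu>)
  also have "\<dots> \<le> measure_pmf.expectation (gnp n p) (\<lambda>G. (X G - \<mu>)\<^sup>2) / t\<^sup>2"
    by (rule prob_gnp_Chebyshev[OF t])
  also have "measure_pmf.expectation (gnp n p) (\<lambda>G. (X G - \<mu>)\<^sup>2)
      = (\<Sum>e\<in>?E. \<Sum>f\<in>?E. x e * x f * (p ^ card ({e} \<union> {f}) - p ^ (card {e} + card {f})))"
    unfolding X_def \<mu>_def by (rule second_moment_gnp[OF p]) auto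
  also have "\<dots> = (\<Sum>e\<in>?E. x e * x e * (p - p ^ 2))"
  proof (rule sum.cong[OF refl])
    fix e assume e: "e \<in> ?E"
    have "(\<Sum>f\<in>?E. x e * x f * (p ^ card ({e} \<union> {f}) - p ^ (card {e} + card {f})))
      = (\<Sum>f\<in>?E. if f = e then x e * x e * (p - p ^ 2) else 0)"
    proof (rule sum.cong[OF refl])
      fix f
      show "x e * x f * (p ^ card ({e} \<union> {f}) - p ^ (card {e} + card {f})) = (if f = e then x e * x e * (p - p ^ 2) else 0)"
        by (cases "f = e") (auto simp: power2_eq_square)
    qed
    then show "(\<Sum>f\<in>?E. x e * x f * (p ^ card ({e} \<union> {f}) - p ^ (card {e} + card {f}))) = x e * x e * (p - p ^ 2)"
      using e by simp
  qed
  also have "\<dots> \<le> (\<Sum>e\<in>?E. M\<^sup>2 * p)"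
  proof (rule sum_mono)
    fix e assume "e \<in> ?E"
    then have "\<bar>x e\<bar>\<^sup>2 \<le> M\<^sup>2" by (intro power_mono x) auto
    moreover have "0 \<le> p - p ^ 2" "p - p ^ 2 \<le> p" using p by (auto simp: power2_eq_square mult_left_le)
    ultimately show "x e * x e * (p - p ^ 2) \<le> M\<^sup>2 * p"
      by (intro mult_mono) (auto simp: power2_eq_square)
  qed
  also have "\<dots> = p * M\<^sup>2 * real (n choose 2)" by (simp add: card_edges_complete_graph)
  finally show ?thesis using t by (simp add: divide_right_mono)
qed

section \<open>Exponential moments\<close>

text \<open>For negative \<open>y = - z\<close> the bound is inverted: \<open>exp z\<close> is at
  least \<open>1 + z + z\<^sup>2 / 2\<close>, and this polynomial times
  \<open>1 - z + z\<^sup>2\<close> is \<open>1 + z\<^sup>2 / 2 + z ^ 3 / 2 + z ^ 4 / 2\<close>,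
  hence at least 1.\<close>

lemma exp_le_quadratic:
  fixes y :: real
  assumes "\<bar>y\<bar> \<le> 1"
  shows "exp y \<le> 1 + y + y\<^sup>2"
proof (cases "0 \<le> y")
  case True
  then show ?thesis using exp_bound[of y] assms by simp
next
  case False
  define z where "z = - y"
  have z: "0 \<le> z" "z \<le> 1" using False assms by (auto simp: z_def)
  have q: "0 < 1 + z + z\<^sup>2 / 2" using z by (simp add: add_pos_nonneg)
  have "1 \<le> 1 + z\<^sup>2 / 2 + z ^ 3 / 2 + z ^ 4 / 2" using z by simp
  also have "\<dots> = (1 - z + z\<^sup>2) * (1 + z + z\<^sup>2 / 2)"
    by (simp add: algebra_simps power2_eq_square power3_eq_cube power4_eq_xxxx add_divide_distrib diff_divide_distrib)
  finally have "1 / (1 + z + z\<^sup>2 / 2) \<le> 1 - z + z\<^sup>2" using q by (simp add: divide_le_eq)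
  moreover have "1 / exp z \<le> 1 / (1 + z + z\<^sup>2 / 2)"
    using exp_lower_Taylor_quadratic[OF z(1)] q by (intro divide_left_mono) auto
  ultimately have "exp (- z) \<le> 1 - z + z\<^sup>2" by (simp add: exp_minus inverse_eq_divide)
  then show ?thesis by (simp add: z_def)
qed

text \<open>
  The factor \<open>p ^ card S\<close> is what keeps the union bound over fingerprints free of logarithms.
\<close>

lemma expectation_gnp_exp:
  fixes x :: "nat set \<Rightarrow> real"
  assumes p: "0 \<le> p" "p \<le> 1" and S: "S \<subseteq> edges (complete_graph n)"
    and s: "0 \<le> s" "s * M \<le> 1" and x: "\<And>e. e \<in> edges (complete_graph n) \<Longrightarrow> \<bar>x e\<bar> \<le> M"
  shows "measure_pmf.expectation (gnp n p) (\<lambda>G. of_bool (S \<subseteq> edges G) * exp (s * (\<Sum>e\<in>edges G. x e)))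
    \<le> (exp 2 * p) ^ card S * exp (p * (s * (\<Sum>e\<in>edges (complete_graph n). x e) + (s * M)\<^sup>2 * real (n choose 2)))"
proof -
  let ?E = "edges (complete_graph n)"
  define f where "f = (\<lambda>e b. of_bool (e \<in> S \<longrightarrow> b) * exp (of_bool b * (s * x e)) :: real)"
  have "measure_pmf.expectation (gnp n p) (\<lambda>G. of_bool (S \<subseteq> edges G) * exp (s * (\<Sum>e\<in>edges G. x e)))
      \<le> measure_pmf.expectation (gnp n p) (\<lambda>G. \<Prod>e\<in>?E. f e (e \<in> edges G))"
  proof (rule expectation_gnp_mono)
    fix G assume "G \<in> set_pmf (gnp n p)"
    then have G: "edges G \<subseteq> ?E" by (rule gnp_support)
    have "(\<Sum>e\<in>edges G. x e) = (\<Sum>e\<in>?E. of_bool (e \<in> edges G) * x e)"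
      using G by (intro sum.mono_neutral_cong_left) auto
    then have "s * (\<Sum>e\<in>edges G. x e) = (\<Sum>e\<in>?E. of_bool (e \<in> edges G) * (s * x e))"
      by (simp only: sum_distrib_left) (intro sum.cong refl, simp only: mult_ac)
    then have "exp (s * (\<Sum>e\<in>edges G. x e)) = (\<Prod>e\<in>?E. exp (of_bool (e \<in> edges G) * (s * x e)))"
      by (simp only: exp_sum[OF finite_edges_complete_graph])
    moreover have "(of_bool (S \<subseteq> edges G) :: real) \<le> (\<Prod>e\<in>?E. of_bool (e \<in> S \<longrightarrow> e \<in> edges G))"
      by (cases "S \<subseteq> edges G") (auto intro!: prod_nonneg prod_ge_1)
    ultimately show "of_bool (S \<subseteq> edges G) * exp (s * (\<Sum>e\<in>edges G. x e)) \<le> (\<Prod>e\<in>?E. f e (e \<in> edges G))"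
      by (simp add: f_def prod.distrib mult_right_mono prod_nonneg)
  qed
  also have "\<dots> = (\<Prod>e\<in>?E. f e True * p + f e False * (1 - p))"
    by (rule expectation_gnp_prod[OF p]) (simp add: f_def)
  also have "\<dots> \<le> (\<Prod>e\<in>?E. (if e \<in> S then exp 2 * p else 1) * exp (p * (s * x e + (s * M)\<^sup>2)))"
  proof (rule prod_mono, intro conjI)
    fix e assume e: "e \<in> ?E"
    show "0 \<le> f e True * p + f e False * (1 - p)" using p by (simp add: f_def)
    define y where "y = s * x e"
    have y: "\<bar>y\<bar> \<le> s * M" using x[OF e] s(1) by (simp add: y_def abs_mult mult_left_mono)
    then have y1: "\<bar>y\<bar> \<le> 1" using s(2) by simp
    show "f e True * p + f e False * (1 - p) \<le> (if e \<in> S then exp 2 * p else 1) * exp (p * (s * x e + (s * M)\<^sup>2))"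
    proof (cases "e \<in> S")
      case True
      \<comment> \<open>An edge of \<open>S\<close> must be present and contributes only
        \<open>p * exp y\<close>. The factor \<open>exp 2\<close> pays for \<open>exp y\<close>, at
        most \<open>exp 1\<close>, and for the uniform factor of the other edges, which may be as
        small as \<open>exp (- 1)\<close>.\<close>
      have "p * y \<ge> p * (- 1)" using y1 p by (intro mult_left_mono) auto
      moreover have "0 \<le> p * (s * M)\<^sup>2" using p by simp
      ultimately have "y \<le> 2 + p * (y + (s * M)\<^sup>2)"
        unfolding distrib_left using y1 p by linarith
      then have "exp y * p \<le> exp (2 + p * (y + (s * M)\<^sup>2)) * p" using p by (intro mult_right_mono) auto
      then show ?thesis using True by (simp add: f_def y_def exp_add mult_ac)
    next
      case False
      \<comment> \<open>Outside \<open>S\<close> the expectation is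
        \<open>1 + p * (exp y - 1)\<close>, so the quadratic bound on \<open>exp\<close> keeps the
        factor \<open>p\<close> in front of the error.\<close>
      have "y\<^sup>2 \<le> (s * M)\<^sup>2" using y by (metis abs_ge_zero power2_abs power_mono)
      then have "exp y \<le> 1 + (y + (s * M)\<^sup>2)" using exp_le_quadratic[OF y1] by simp
      then have "exp y * p + (1 - p) \<le> 1 + p * (y + (s * M)\<^sup>2)"
        using mult_right_mono[of "exp y" "1 + (y + (s * M)\<^sup>2)" p] p by (simp add: algebra_simps)
      also have "\<dots> \<le> exp (p * (y + (s * M)\<^sup>2))" by (rule exp_ge_add_one_self)
      finally show ?thesis using False by (simp add: f_def y_def)
    qed
  qed
  also have "\<dots> = (exp 2 * p) ^ card S * exp (p * (s * (\<Sum>e\<in>?E. x e) + (s * M)\<^sup>2 * real (n choose 2)))"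
  proof -
    have "(\<Prod>e\<in>?E. exp (p * (s * x e + (s * M)\<^sup>2))) = exp (p * (s * (\<Sum>e\<in>?E. x e) + (s * M)\<^sup>2 * real (n choose 2)))"
      by (simp add: exp_sum[symmetric] sum_distrib_left[symmetric] sum.distrib card_edges_complete_graph mult.commute)
    moreover have "(\<Prod>e\<in>?E. if e \<in> S then exp 2 * p else 1) = (exp 2 * p) ^ card S"
      using S by (simp add: prod.If_cases Int_absorb1)
    ultimately show ?thesis by (simp only: prod.distrib)
  qed
  finally show ?thesis .
qed

section \<open>Above the threshold\<close>

text \<open>As \<open>\<mu> \<ge> 1\<close>, the hypothesis forces p \<ge> A / n, so the expected
  number of edges grows at least linearly.\<close>

lemma choose_two_expected_at_top:
  assumes A: "0 < A" and \<mu>: "1 \<le> \<mu>"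
    and p: "\<forall>\<^sub>F n in sequentially. A * real n powr (- 1 / \<mu>) \<le> p n"
  shows "filterlim (\<lambda>n. p n * real (n choose 2)) at_top sequentially"
proof -
  have "\<forall>\<^sub>F n in sequentially. A / 4 * real n \<le> p n * real (n choose 2)"
    using p eventually_ge_at_top[of 2]
  proof eventually_elim
    fix n :: nat assume pn: "A * real n powr (- 1 / \<mu>) \<le> p n" and n: "2 \<le> n"
    have "real n powr (- 1) \<le> real n powr (- 1 / \<mu>)" using n \<mu> by (intro powr_mono) (auto simp: field_simps)
    then have "A * (1 / real n) \<le> A * real n powr (- 1 / \<mu>)"
      using A n by (intro mult_left_mono) (auto simp: powr_minus_divide)
    then have "A * (1 / real n) \<le> p n" using pn by linarith
    then have "A * (1 / real n) * (real n ^ 2 / 4) \<le> p n * real (n choose 2)"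
      using card_choose_two_bounds(1)[OF n] A by (intro mult_mono) (auto intro: order_trans[of 0 "A * (1 / real n)"])
    then show "A / 4 * real n \<le> p n * real (n choose 2)" using n by (simp add: power2_eq_square)
  qed
  moreover have "filterlim (\<lambda>n. A / 4 * real n) at_top sequentially"
    using A by (intro filterlim_tendsto_pos_mult_at_top[OF tendsto_const _ filterlim_real_sequentially]) simp
  ultimately show ?thesis by (rule filterlim_at_top_mono[rotated])
qed

lemma edge_sum_whp:
  fixes x :: "nat \<Rightarrow> nat set \<Rightarrow> real"
  assumes p: "\<And>n. 0 \<le> p n \<and> p n \<le> 1"
    and lim: "filterlim (\<lambda>n. p n * real (n choose 2)) at_top sequentially"
    and x: "\<And>n e. e \<in> edges (complete_graph n) \<Longrightarrow> \<bar>x n e\<bar> \<le> M" and \<eta>: "0 < \<eta>" and \<epsilon>: "0 < \<epsilon>"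
  shows "\<forall>\<^sub>F n in sequentially. measure_pmf.prob (gnp n (p n))
     {G. \<eta> * (p n * real (n choose 2)) \<le> \<bar>(\<Sum>e\<in>edges G. x n e) - p n * (\<Sum>e\<in>edges (complete_graph n). x n e)\<bar>} \<le> \<epsilon>"
proof -
  \<comment> \<open>The quotient is what Chebyshev's inequality asks for; the summand 1 keeps the
    mean positive also when \<open>M = 0\<close>.\<close>
  have "\<forall>\<^sub>F n in sequentially. M\<^sup>2 / (\<eta>\<^sup>2 * \<epsilon>) + 1 \<le> p n * real (n choose 2)"
    using lim by (simp add: filterlim_at_top)
  then show ?thesis
  proof eventually_elim
    fix n assume n: "M\<^sup>2 / (\<eta>\<^sup>2 * \<epsilon>) + 1 \<le> p n * real (n choose 2)"
    define c where "c = p n * real (n choose 2)"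
    have c: "0 < c" unfolding c_def by (rule less_le_trans[OF _ n]) (use \<epsilon> in \<open>simp add: add_nonneg_pos\<close>)
    have "measure_pmf.prob (gnp n (p n)) {G. \<eta> * c \<le> \<bar>(\<Sum>e\<in>edges G. x n e) - p n * (\<Sum>e\<in>edges (complete_graph n). x n e)\<bar>}
        \<le> p n * M\<^sup>2 * real (n choose 2) / (\<eta> * c)\<^sup>2"
      using p x \<eta> c by (intro edge_sum_Chebyshev) auto
    also have "\<dots> = M\<^sup>2 / (\<eta>\<^sup>2 * c)" using c by (simp add: c_def power2_eq_square)
    also have "\<dots> \<le> \<epsilon>"
    proof -
      have "M\<^sup>2 / (\<eta>\<^sup>2 * \<epsilon>) \<le> c" using n by (simp add: c_def)
      then have "M\<^sup>2 \<le> c * (\<eta>\<^sup>2 * \<epsilon>)" using \<eta> \<epsilon> by (simp add: divide_le_eq)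
      then show ?thesis using \<eta> c by (simp add: divide_le_eq mult_ac)
    qed
    finally show "measure_pmf.prob (gnp n (p n))
     {G. \<eta> * (p n * real (n choose 2)) \<le> \<bar>(\<Sum>e\<in>edges G. x n e) - p n * (\<Sum>e\<in>edges (complete_graph n). x n e)\<bar>} \<le> \<epsilon>"
      by (simp add: c_def)
  qed
qed

lemma edge_count_whp:
  assumes p: "\<And>n. 0 \<le> p n \<and> p n \<le> 1"
    and lim: "filterlim (\<lambda>n. p n * real (n choose 2)) at_top sequentially"
    and \<eta>: "0 < \<eta>" and \<epsilon>: "0 < \<epsilon>"
  shows "\<forall>\<^sub>F n in sequentially. measure_pmf.prob (gnp n (p n))
     {G. \<eta> * (p n * real (n choose 2)) \<le> \<bar>real (ne G) - p n * real (n choose 2)\<bar>} \<le> \<epsilon>"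
proof -
  have "\<forall>\<^sub>F n in sequentially. measure_pmf.prob (gnp n (p n))
     {G. \<eta> * (p n * real (n choose 2)) \<le> \<bar>(\<Sum>e\<in>edges G. 1) - p n * (\<Sum>e\<in>edges (complete_graph n). 1)\<bar>} \<le> \<epsilon>"
    by (rule edge_sum_whp[OF p lim, where M = 1]) (use \<eta> \<epsilon> in auto)
  then show ?thesis by (simp add: card_edges_complete_graph)
qed

lemma finite_rainbow_free: "finite (edges G) \<Longrightarrow> finite (rainbow_free_colourings H l G)"
  unfolding rainbow_free_colourings_def by (auto intro!: finite_PiE)

section \<open>Lower bound from an optimal template\<close>

text \<open>If every edge takes its colour from its palette, the colours on a rainbow copy would
  themselves be an SDR of the palettes.\<close>

lemma template_lower_bound:
  assumes P: "P \<in> palette_templates l n" "SDR_free H n P"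
    and G: "verts G = {1..n}" "edges G \<subseteq> edges (complete_graph n)"
  shows "exp (\<Sum>e\<in>edges G. ln (real (card (P e)))) \<le> real (R H l G)"
proof -
  have finG: "finite (edges G)" by (rule finite_subset[OF G(2)]) simp
  have Pe: "P e \<subseteq> {1..l} \<and> P e \<noteq> {}" if "e \<in> edges G" for e
    using P(1) G(2) that by (auto simp: palette_templates_def PiE_iff)
  have pos: "0 < card (P e)" if "e \<in> edges G" for e
    using Pe[OF that] finite_subset[of "P e" "{1..l}"] by (simp add: card_gt_0_iff)
  have "PiE (edges G) P \<subseteq> rainbow_free_colourings H l G"
  proof
    fix c assume c: "c \<in> PiE (edges G) P"
    have "\<not> (is_copy H F G \<and> inj_on c (edges F))" for F
    proof
      assume F: "is_copy H F G \<and> inj_on c (edges F)"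
      then have "edges F \<subseteq> edges G" by (simp add: is_copy_def subgraph_def)
      then have "has_SDR (edges F) P" unfolding has_SDR_def using c F by (intro exI[of _ c]) auto
      moreover have "is_copy H F (complete_graph n)"
        using F G by (auto simp: is_copy_def subgraph_def complete_graph_def)
      ultimately show False using P(2) by (auto simp: SDR_free_def)
    qed
    moreover have "c \<in> edges G \<rightarrow>\<^sub>E {1..l}" by (rule subsetD[OF PiE_mono c]) (use Pe in blast)
    ultimately show "c \<in> rainbow_free_colourings H l G" by (simp add: rainbow_free_colourings_def)
  qed
  then have "card (PiE (edges G) P) \<le> R H l G"
    unfolding R_def by (rule card_mono[OF finite_rainbow_free[OF finG]])
  then have "(\<Prod>e\<in>edges G. card (P e)) \<le> R H l G" using finG by (simp add: card_PiE)
  then have "real (\<Prod>e\<in>edges G. card (P e)) \<le> real (R H l G)" by (rule of_nat_mono)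
  moreover have "exp (\<Sum>e\<in>edges G. ln (real (card (P e)))) = real (\<Prod>e\<in>edges G. card (P e))"
    using finG pos by (simp add: exp_sum)
  ultimately show ?thesis by simp
qed

lemma colourings_lower_whp:
  assumes H: "simple_graph H" "2 \<le> ne H" and l: "1 \<le> l" and \<delta>: "0 < \<delta>"
    and p: "\<And>n. 0 \<le> p n \<and> p n \<le> 1"
    and lim: "filterlim (\<lambda>n. p n * real (n choose 2)) at_top sequentially" and \<epsilon>: "0 < \<epsilon>"
  shows "\<forall>\<^sub>F n in sequentially. measure_pmf.prob (gnp n (p n))
     {G. \<not> exp ((lambda_H H l - \<delta>) * real (ne G)) \<le> real (R H l G)} \<le> \<epsilon>"
proof -
  have "\<exists>P. P \<in> palette_templates l n \<and> SDR_free H n P \<and>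
    ex_log n H l = (\<Sum>e\<in>edges (complete_graph n). ln (real (card (P e))))" for n
    using ex_log_attained[OF H l] by metis
  then obtain P where P: "\<And>n. P n \<in> palette_templates l n" "\<And>n. SDR_free H n (P n)"
    "\<And>n. ex_log n H l = (\<Sum>e\<in>edges (complete_graph n). ln (real (card (P n e))))" by metis
  define x where "x = (\<lambda>n e. ln (real (card (P n e))))"
  have x: "0 \<le> x n e" "x n e \<le> ln (real l)" if "e \<in> edges (complete_graph n)" for n e
    unfolding x_def using template_weight_bounds[OF P(1) that] by auto
  define \<Lambda> where "\<Lambda> = lambda_H H l"
  have \<Lambda>: "0 \<le> \<Lambda>" unfolding \<Lambda>_def by (rule lambda_H_nonneg[OF H l])
  \<comment> \<open>The weight of \<open>G\<close> may fall short by \<open>\<eta> * c\<close> and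
    its edge count may exceed \<open>c\<close> by \<open>\<eta> * c\<close>; together they cost at
    most \<open>(\<Lambda> + 1) * \<eta> * c = \<delta> * c\<close>.\<close>
  define \<eta> where "\<eta> = \<delta> / (\<Lambda> + 1)"
  have \<eta>: "0 < \<eta>" using \<delta> \<Lambda> by (simp add: \<eta>_def)
  have "\<forall>\<^sub>F n in sequentially. measure_pmf.prob (gnp n (p n))
     {G. \<eta> * (p n * real (n choose 2)) \<le> \<bar>(\<Sum>e\<in>edges G. x n e) - p n * (\<Sum>e\<in>edges (complete_graph n). x n e)\<bar>} \<le> \<epsilon> / 2"
    by (rule edge_sum_whp[OF p lim, where M = "ln (real l)"]) (use x \<eta> \<epsilon> in auto)
  moreover have "\<forall>\<^sub>F n in sequentially. measure_pmf.prob (gnp n (p n))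
     {G. \<eta> * (p n * real (n choose 2)) \<le> \<bar>real (ne G) - p n * real (n choose 2)\<bar>} \<le> \<epsilon> / 2"
    using \<eta> \<epsilon> by (intro edge_count_whp[OF p lim]) auto
  ultimately show ?thesis using eventually_ge_at_top[of "nv H + 2"]
  proof eventually_elim
    fix n assume n: "nv H + 2 \<le> n"
      and 1: "measure_pmf.prob (gnp n (p n))
     {G. \<eta> * (p n * real (n choose 2)) \<le> \<bar>(\<Sum>e\<in>edges G. x n e) - p n * (\<Sum>e\<in>edges (complete_graph n). x n e)\<bar>} \<le> \<epsilon> / 2"
      and 2: "measure_pmf.prob (gnp n (p n))
     {G. \<eta> * (p n * real (n choose 2)) \<le> \<bar>real (ne G) - p n * real (n choose 2)\<bar>} \<le> \<epsilon> / 2"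
    define c where "c = p n * real (n choose 2)"
    have c: "0 \<le> c" using p[of n] by (simp add: c_def)
    have W: "\<Lambda> * real (n choose 2) \<le> (\<Sum>e\<in>edges (complete_graph n). x n e)"
    proof -
      have "\<Lambda> \<le> ex_log n H l / real (n choose 2)" unfolding \<Lambda>_def using n by (intro lambda_H_approx(1)[OF H l]) simp
      moreover have "0 < real (n choose 2)" using n by (simp add: zero_less_binomial)
      ultimately have "\<Lambda> * real (n choose 2) \<le> ex_log n H l" by (simp add: le_divide_eq)
      then show ?thesis using P(3) by (simp add: x_def)
    qed
    have "measure_pmf.prob (gnp n (p n)) {G. \<not> exp ((lambda_H H l - \<delta>) * real (ne G)) \<le> real (R H l G)}
      \<le> measure_pmf.prob (gnp n (p n)) {G. \<eta> * c \<le> \<bar>(\<Sum>e\<in>edges G. x n e) - p n * (\<Sum>e\<in>edges (complete_graph n). x n e)\<bar>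
          \<or> \<eta> * c \<le> \<bar>real (ne G) - c\<bar>}"
    proof (rule prob_gnp_mono, rule ccontr)
      fix G assume G: "G \<in> set_pmf (gnp n (p n))" and not: "\<not> exp ((lambda_H H l - \<delta>) * real (ne G)) \<le> real (R H l G)"
        and "\<not> (\<eta> * c \<le> \<bar>(\<Sum>e\<in>edges G. x n e) - p n * (\<Sum>e\<in>edges (complete_graph n). x n e)\<bar> \<or> \<eta> * c \<le> \<bar>real (ne G) - c\<bar>)"
      then have X: "p n * (\<Sum>e\<in>edges (complete_graph n). x n e) - \<eta> * c \<le> (\<Sum>e\<in>edges G. x n e)" and e: "real (ne G) \<le> c + \<eta> * c"
        by (auto simp: abs_le_iff not_le)
      have low: "\<Lambda> * c - \<eta> * c \<le> (\<Sum>e\<in>edges G. x n e)"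
        using X mult_left_mono[OF W, of "p n"] p[of n] by (simp add: c_def mult_ac)
      have "(\<Lambda> - \<delta>) * real (ne G) \<le> (\<Sum>e\<in>edges G. x n e)"
      proof (cases "\<Lambda> \<le> \<delta>")
        \<comment> \<open>The exponent is then nonpositive, while the weights are nonnegative
          because no palette of a template is empty.\<close>
        case True
        then have "(\<Lambda> - \<delta>) * real (ne G) \<le> 0" by (simp add: mult_nonpos_nonneg)
        also have "0 \<le> (\<Sum>e\<in>edges G. x n e)" using x(1) gnp_support(2)[OF G] by (intro sum_nonneg) auto
        finally show ?thesis .
      next
        case False
        then have "(\<Lambda> - \<delta>) * real (ne G) \<le> (\<Lambda> - \<delta>) * (c + \<eta> * c)" using e by (intro mult_left_mono) auto
        also have "\<dots> = \<Lambda> * c - \<eta> * c + ((\<Lambda> + 1) * \<eta> - \<delta> - \<delta> * \<eta>) * c" by (simp add: algebra_simps)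
        also have "(\<Lambda> + 1) * \<eta> = \<delta>" using \<Lambda> by (simp add: \<eta>_def)
        also have "\<Lambda> * c - \<eta> * c + (\<delta> - \<delta> - \<delta> * \<eta>) * c \<le> \<Lambda> * c - \<eta> * c" using c \<delta> \<eta> by simp
        finally show ?thesis using low by linarith
      qed
      then have "exp ((\<Lambda> - \<delta>) * real (ne G)) \<le> exp (\<Sum>e\<in>edges G. x n e)" by simp
      also have "\<dots> \<le> real (R H l G)"
        unfolding x_def by (rule template_lower_bound[OF P(1,2) gnp_support[OF G]])
      finally show False using not by (simp add: \<Lambda>_def)
    qed
    also have "\<dots> \<le> \<epsilon> / 2 + \<epsilon> / 2"
      by (rule order_trans[OF prob_gnp_disj]) (rule add_mono[OF 1[folded c_def] 2[folded c_def]])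
    finally show "measure_pmf.prob (gnp n (p n)) {G. \<not> exp ((lambda_H H l - \<delta>) * real (ne G)) \<le> real (R H l G)} \<le> \<epsilon>" by simp
  qed
qed

section \<open>Upper bound from containers and a small moment\<close>

lemma sum_Pow_power_card:
  fixes c :: real
  assumes "finite A"
  shows "(\<Sum>U\<in>Pow A. c ^ card U) = (1 + c) ^ card A"
  using assms
proof (induction A rule: finite_induct)
  case (insert x A)
  have disj: "Pow A \<inter> insert x ` Pow A = {}" using insert.hyps(2) by auto
  have inj: "inj_on (insert x) (Pow A)" using insert.hyps(2) by (auto simp: inj_on_def)
  have "(\<Sum>U\<in>Pow (insert x A). c ^ card U) = (\<Sum>U\<in>Pow A. c ^ card U) + (\<Sum>U\<in>insert x ` Pow A. c ^ card U)"
    unfolding Pow_insert using insert.hyps(1) disj by (subst sum.union_disjoint) auto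
  also have "(\<Sum>U\<in>insert x ` Pow A. c ^ card U) = (\<Sum>U\<in>Pow A. c ^ card (insert x U))"
    by (subst sum.reindex[OF inj]) simp
  also have "\<dots> = (\<Sum>U\<in>Pow A. c * c ^ card U)"
  proof (rule sum.cong[OF refl])
    fix U assume "U \<in> Pow A"
    then have "finite U" "x \<notin> U" using insert.hyps finite_subset[of U A] by auto
    then show "c ^ card (insert x U) = c * c ^ card U" by simp
  qed
  finally show ?case using insert.IH insert.hyps by (simp add: sum_distrib_left[symmetric] algebra_simps)
qed simp

text \<open>After division by the total, every summand is some \<open>t\<close> between 0 and 1 and
  satisfies \<open>t \<le> t powr s\<close>.\<close>

lemma sum_powr_le:
  fixes a :: "'i \<Rightarrow> real"
  assumes fin: "finite A" and a: "\<And>i. i \<in> A \<Longrightarrow> 0 \<le> a i" and s: "0 < s" "s \<le> 1"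
  shows "(\<Sum>i\<in>A. a i) powr s \<le> (\<Sum>i\<in>A. a i powr s)"
proof (cases "(\<Sum>i\<in>A. a i) = 0")
  case True
  then show ?thesis using s by (simp add: sum_nonneg)
next
  case False
  define T where "T = (\<Sum>i\<in>A. a i)"
  have T: "0 < T" using False sum_nonneg[OF a] by (simp add: T_def less_le)
  have le: "a i / T \<le> a i powr s / T powr s" if "i \<in> A" for i
  proof -
    have t: "0 \<le> a i / T" "a i / T \<le> 1"
      using a[OF that] member_le_sum[of i A a] that a fin T by (auto simp: T_def)
    have "a i / T \<le> (a i / T) powr s"
    proof (cases "a i / T = 0")
      case True
      then show ?thesis using powr_ge_zero[of "a i / T" s] by linarith
    next
      case False
      have "(a i / T) powr 1 \<le> (a i / T) powr s" using t s False by (intro powr_mono') auto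
      then show ?thesis unfolding powr_one[OF t(1)] .
    qed
    then show ?thesis using a[OF that] T by (simp add: powr_divide)
  qed
  have "1 = (\<Sum>i\<in>A. a i / T)" using T by (simp add: T_def sum_divide_distrib[symmetric])
  also have "\<dots> \<le> (\<Sum>i\<in>A. a i powr s / T powr s)" by (rule sum_mono[OF le])
  also have "\<dots> = (\<Sum>i\<in>A. a i powr s) / T powr s" by (simp add: sum_divide_distrib)
  finally have "T powr s \<le> (\<Sum>i\<in>A. a i powr s)" using T by (simp add: le_divide_eq)
  then show ?thesis by (simp add: T_def)
qed

text \<open>The size limit is traded for a weight: a union \<open>U\<close> of at most
  \<open>k * \<sigma>\<close> elements satisfies
  \<open>1 \<le> (1 / z) powr (k * \<sigma>) * z ^ card U\<close>. With this factor inserted, the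
  sum may run over all subsets of \<open>V\<close> and becomes a power of a binomial, so no binomial
  coefficient has to be estimated. For a fixed small \<open>z\<close> the exponent is O(\<sigma>)
  plus a small multiple of \<open>y * card V\<close>.\<close>

lemma sum_fingerprints_le:
  fixes \<sigma> y z :: real
  assumes V: "finite V" and y: "0 \<le> y" and z: "0 < z" "z \<le> 1"
  shows "(\<Sum>Ss | length Ss = k \<and> (\<forall>S\<in>set Ss. S \<subseteq> V \<and> real (card S) \<le> \<sigma>). y ^ card (\<Union>(set Ss)))
    \<le> exp (real k * \<sigma> * ln (1 / z) + z * 2 ^ k * y * real (card V))"
proof -
  define \<S> where "\<S> = {Ss. length Ss = k \<and> (\<forall>S\<in>set Ss. S \<subseteq> V \<and> real (card S) \<le> \<sigma>)}"
  have fin: "finite \<S>"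
    by (rule finite_subset[OF _ finite_lists_length_eq[of "Pow V" k]]) (use V in \<open>auto simp: \<S>_def\<close>)
  have Un: "\<Union>(set Ss) \<subseteq> V \<and> real (card (\<Union>(set Ss))) \<le> real k * \<sigma>" if "Ss \<in> \<S>" for Ss
  proof
    show "\<Union>(set Ss) \<subseteq> V" using that by (auto simp: \<S>_def)
    have "real (card (\<Union>(set Ss))) \<le> (\<Sum>S\<leftarrow>Ss. real (card S))"
    proof (induction Ss)
      case (Cons S Ss)
      have "real (card (S \<union> \<Union>(set Ss))) \<le> real (card S + card (\<Union>(set Ss)))"
        by (rule of_nat_mono[OF card_Un_le])
      then show ?case using Cons by simp
    qed simp
    also have "\<dots> \<le> (\<Sum>S\<leftarrow>Ss. \<sigma>)" using that by (intro sum_list_mono) (auto simp: \<S>_def)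
    also have "\<dots> = real k * \<sigma>" using that by (simp add: \<S>_def sum_list_triv)
    finally show "real (card (\<Union>(set Ss))) \<le> real k * \<sigma>" .
  qed
  define B where "B = exp (real k * \<sigma> * ln (1 / z))"
  have zU: "1 \<le> B * z ^ card U" if "real (card U) \<le> real k * \<sigma>" for U :: "'a set"
  proof -
    have "z ^ card U = exp (real (card U) * ln z)" using z by (simp add: exp_of_nat_mult)
    moreover have "real k * \<sigma> * ln z \<le> real (card U) * ln z"
      using that z by (intro mult_right_mono_neg) auto
    ultimately show ?thesis using z by (simp add: B_def exp_add[symmetric] ln_div)
  qed
  have "(\<Sum>Ss\<in>\<S>. y ^ card (\<Union>(set Ss))) = (\<Sum>U\<in>Pow V. \<Sum>Ss\<in>{Ss\<in>\<S>. \<Union>(set Ss) = U}. y ^ card (\<Union>(set Ss)))"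
    by (rule sum.group[symmetric, OF fin]) (use V Un in auto)
  also have "\<dots> \<le> (\<Sum>U\<in>Pow V. B * (z * 2 ^ k * y) ^ card U)"
  proof (rule sum_mono)
    fix U assume "U \<in> Pow V"
    then have finU: "finite U" using V finite_subset by auto
    show "(\<Sum>Ss\<in>{Ss\<in>\<S>. \<Union>(set Ss) = U}. y ^ card (\<Union>(set Ss))) \<le> B * (z * 2 ^ k * y) ^ card U"
    proof (cases "{Ss\<in>\<S>. \<Union>(set Ss) = U} = {}")
      case True
      show ?thesis unfolding True using z y by (simp add: B_def)
    next
      case False
      then have small: "real (card U) \<le> real k * \<sigma>" using Un by blast
      have "(\<Sum>Ss\<in>{Ss\<in>\<S>. \<Union>(set Ss) = U}. y ^ card (\<Union>(set Ss))) = real (card {Ss\<in>\<S>. \<Union>(set Ss) = U}) * y ^ card U"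
        by simp
      \<comment> \<open>Each of the \<open>k\<close> sets of a list with union \<open>U\<close> is
        some subset of \<open>U\<close>.\<close>
      also have "\<dots> \<le> (2 ^ k) ^ card U * y ^ card U"
      proof (rule mult_right_mono)
        have "card {Ss\<in>\<S>. \<Union>(set Ss) = U} \<le> card {Ss. set Ss \<subseteq> Pow U \<and> length Ss = k}"
          using finU by (intro card_mono finite_lists_length_eq) (auto simp: \<S>_def)
        also have "\<dots> = (2 ^ k) ^ card U"
          using finU by (simp add: card_lists_length_eq card_Pow power_mult[symmetric] mult.commute)
        finally show "real (card {Ss\<in>\<S>. \<Union>(set Ss) = U}) \<le> (2 ^ k) ^ card U"
          using of_nat_mono[where 'a = real] by fastforce
      qed (use y in simp)
      also have "\<dots> \<le> (B * z ^ card U) * ((2 ^ k) ^ card U * y ^ card U)"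
        using mult_right_mono[OF zU[OF small], of "(2 ^ k) ^ card U * y ^ card U"] y by simp
      also have "\<dots> = B * (z * 2 ^ k * y) ^ card U" by (simp add: power_mult_distrib)
      finally show ?thesis .
    qed
  qed
  also have "\<dots> = B * (1 + z * 2 ^ k * y) ^ card V"
    by (simp add: sum_distrib_left[symmetric] sum_Pow_power_card[OF V])
  also have "\<dots> \<le> B * exp (z * 2 ^ k * y) ^ card V"
  proof -
    have "(1 + z * 2 ^ k * y) ^ card V \<le> exp (z * 2 ^ k * y) ^ card V"
      using z y by (intro power_mono) auto
    then show ?thesis by (intro mult_left_mono) (auto simp: B_def)
  qed
  also have "\<dots> = exp (real k * \<sigma> * ln (1 / z) + z * 2 ^ k * y * real (card V))"
    by (simp add: B_def exp_add exp_of_nat_mult[symmetric] mult.commute)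
  finally show ?thesis by (simp add: \<S>_def)
qed

text \<open>An edge of \<open>G\<close> with an empty palette admits no colour, and 0 lies below
  \<open>exp (- L)\<close> for every \<open>L\<close>; this is why the negative weight is
  legitimate.\<close>

lemma card_colourings_in_container:
  assumes G: "finite (edges G)" and C: "C \<subseteq> UNIV \<times> {1..l}"
  shows "real (card {c \<in> edges G \<rightarrow>\<^sub>E {1..l}. graph_of_colouring G c \<subseteq> C})
    \<le> exp (\<Sum>e\<in>edges G. container_weight L C e)"
proof -
  have sub: "template_of C e \<subseteq> {1..l}" for e using C by (auto simp: template_of_def)
  have fin: "finite (template_of C e)" for e by (rule finite_subset[OF sub]) simp
  have "{c \<in> edges G \<rightarrow>\<^sub>E {1..l}. graph_of_colouring G c \<subseteq> C} \<subseteq> PiE (edges G) (template_of C)"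
  proof clarify
    fix c assume c: "c \<in> edges G \<rightarrow>\<^sub>E {1..l}" "graph_of_colouring G c \<subseteq> C"
    show "c \<in> PiE (edges G) (template_of C)"
    proof (rule PiE_I)
      fix e assume "e \<in> edges G"
      then show "c e \<in> template_of C e" using c(2) by (auto simp: graph_of_colouring_def template_of_def)
    next
      fix e assume "e \<notin> edges G"
      then show "c e = undefined" using c(1) by auto
    qed
  qed
  then have "card {c \<in> edges G \<rightarrow>\<^sub>E {1..l}. graph_of_colouring G c \<subseteq> C} \<le> card (PiE (edges G) (template_of C))"
    using G fin by (intro card_mono finite_PiE) auto
  also have "\<dots> = (\<Prod>e\<in>edges G. card (template_of C e))" using G by (simp add: card_PiE)
  finally have "real (card {c \<in> edges G \<rightarrow>\<^sub>E {1..l}. graph_of_colouring G c \<subseteq> C}) \<le> (\<Prod>e\<in>edges G. real (card (template_of C e)))"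
    using of_nat_mono[where 'a = real] by fastforce
  also have "\<dots> \<le> (\<Prod>e\<in>edges G. exp (container_weight L C e))"
  proof (rule prod_mono, intro conjI)
    fix e
    show "real (card (template_of C e)) \<le> exp (container_weight L C e)"
      using fin[of e] by (cases "template_of C e = {}") (auto simp: container_weight_def card_gt_0_iff)
  qed simp
  also have "\<dots> = exp (\<Sum>e\<in>edges G. container_weight L C e)" using G by (simp add: exp_sum)
  finally show ?thesis .
qed

text \<open>The condition that the fingerprint projects into \<open>edges G\<close> is kept as an
  indicator inside the sum, so that it can be averaged over \<open>G\<close> afterwards.\<close>

lemma card_rainbow_free_containers:
  fixes f :: "(nat set \<times> nat) set list \<Rightarrow> (nat set \<times> nat) set"
  assumes G: "finite (edges G)" and s: "0 < s" "s \<le> 1" and fin: "finite \<S>"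
    and f: "\<And>Ss. Ss \<in> \<S> \<Longrightarrow> f Ss \<subseteq> UNIV \<times> {1..l}"
    and cover: "\<And>c. c \<in> rainbow_free_colourings H l G \<Longrightarrow>
      \<exists>Ss\<in>\<S>. fst ` \<Union>(set Ss) \<subseteq> edges G \<and> graph_of_colouring G c \<subseteq> f Ss"
  shows "real (R H l G) powr s \<le>
    (\<Sum>Ss\<in>\<S>. of_bool (fst ` \<Union>(set Ss) \<subseteq> edges G) * exp (s * (\<Sum>e\<in>edges G. container_weight L (f Ss) e)))"
proof -
  define \<T> where "\<T> = {Ss\<in>\<S>. fst ` \<Union>(set Ss) \<subseteq> edges G}"
  have finT: "finite \<T>" using fin by (simp add: \<T>_def)
  define D where "D = (\<lambda>Ss. {c \<in> edges G \<rightarrow>\<^sub>E {1..l}. graph_of_colouring G c \<subseteq> f Ss})"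
  have finD: "finite (D Ss)" for Ss
    by (rule finite_subset[of _ "edges G \<rightarrow>\<^sub>E {1..l}"]) (use G in \<open>auto simp: D_def intro!: finite_PiE\<close>)
  have "rainbow_free_colourings H l G \<subseteq> (\<Union>Ss\<in>\<T>. D Ss)"
  proof
    fix c assume c: "c \<in> rainbow_free_colourings H l G"
    then have "c \<in> edges G \<rightarrow>\<^sub>E {1..l}" by (simp add: rainbow_free_colourings_def)
    then show "c \<in> (\<Union>Ss\<in>\<T>. D Ss)" using cover[OF c] by (auto simp: \<T>_def D_def)
  qed
  then have "R H l G \<le> card (\<Union>Ss\<in>\<T>. D Ss)"
    unfolding R_def using finT finD by (intro card_mono) auto
  also have "\<dots> \<le> (\<Sum>Ss\<in>\<T>. card (D Ss))" by (rule card_UN_le[OF finT])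
  finally have "R H l G \<le> (\<Sum>Ss\<in>\<T>. card (D Ss))" .
  from of_nat_mono[OF this, where 'a = real] have "real (R H l G) \<le> (\<Sum>Ss\<in>\<T>. real (card (D Ss)))" by (simp only: of_nat_sum)
  also have "\<dots> \<le> (\<Sum>Ss\<in>\<T>. exp (\<Sum>e\<in>edges G. container_weight L (f Ss) e))"
    unfolding D_def by (intro sum_mono card_colourings_in_container[OF G f]) (simp add: \<T>_def)
  finally have "real (R H l G) powr s \<le> (\<Sum>Ss\<in>\<T>. exp (\<Sum>e\<in>edges G. container_weight L (f Ss) e)) powr s"
    using s by (intro powr_mono2) auto
  also have "\<dots> \<le> (\<Sum>Ss\<in>\<T>. exp (\<Sum>e\<in>edges G. container_weight L (f Ss) e) powr s)"
    by (rule sum_powr_le[OF finT _ s]) simp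
  also have "\<dots> = (\<Sum>Ss\<in>\<T>. exp (s * (\<Sum>e\<in>edges G. container_weight L (f Ss) e)))"
    by (simp add: powr_def)
  also have "\<dots> = (\<Sum>Ss\<in>\<S>. of_bool (fst ` \<Union>(set Ss) \<subseteq> edges G) * exp (s * (\<Sum>e\<in>edges G. container_weight L (f Ss) e)))"
    unfolding \<T>_def using fin by (intro sum.mono_neutral_cong_left) auto
  finally show ?thesis .
qed

text \<open>
  Since \<open>x \<mapsto> x powr s\<close> is subadditive for \<open>s \<le> 1\<close>, bounding a small moment of the number of colourings
  performs the counting and the union bound over fingerprints in one step.
\<close>

lemma expectation_rainbow_free_powr:
  fixes f :: "(nat set \<times> nat) set list \<Rightarrow> (nat set \<times> nat) set" and \<Lambda> M L s z \<sigma> :: real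
  assumes p: "0 \<le> p" "p \<le> 1" and s: "0 < s" "s \<le> 1" "s * M \<le> 1" and z: "0 < z" "z \<le> 1"
    and M: "L \<le> M" "ln (real l) \<le> M" "0 \<le> L" and l: "1 \<le> l"
    and cont: "\<And>G c. verts G = {1..n} \<Longrightarrow> edges G \<subseteq> edges (complete_graph n) \<Longrightarrow> c \<in> rainbow_free_colourings H l G \<Longrightarrow>
      \<exists>Ss. length Ss = k \<and> (\<forall>S\<in>set Ss. S \<subseteq> graph_of_colouring G c \<and> real (card S) \<le> \<sigma>) \<and>
         graph_of_colouring G c \<subseteq> f Ss \<and> f Ss \<subseteq> edges (complete_graph n) \<times> {1..l} \<and>
         (\<Sum>e\<in>edges (complete_graph n). container_weight L (f Ss) e) \<le> \<Lambda> * real (n choose 2)"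
  shows "measure_pmf.expectation (gnp n p) (\<lambda>G. real (R H l G) powr s) \<le>
    exp (real k * \<sigma> * ln (1 / z) + z * 2 ^ k * (exp 2 * p) * (real l * real (n choose 2))
       + p * (s * \<Lambda> + (s * M)\<^sup>2) * real (n choose 2))"
proof -
  let ?E = "edges (complete_graph n)"
  define V where "V = ?E \<times> {1..l}"
  have finV: "finite V" by (simp add: V_def)
  define \<S>0 where "\<S>0 = {Ss. length Ss = k \<and> (\<forall>S\<in>set Ss. S \<subseteq> V \<and> real (card S) \<le> \<sigma>)}"
  have fin0: "finite \<S>0"
    by (rule finite_subset[OF _ finite_lists_length_eq[of "Pow V" k]]) (use finV in \<open>auto simp: \<S>0_def\<close>)
  \<comment> \<open>A fingerprint is part of the graph of a colouring, so the projection to edges is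
    injective on it. Hence the number of edges it forces into \<open>G\<close> is the size of the
    union itself, and the probability is the corresponding power of \<open>p\<close>.\<close>
  define \<S> where "\<S> = {Ss\<in>\<S>0. inj_on fst (\<Union>(set Ss)) \<and> f Ss \<subseteq> V \<and>
      (\<Sum>e\<in>?E. container_weight L (f Ss) e) \<le> \<Lambda> * real (n choose 2)}"
  have fin: "finite \<S>" using fin0 by (simp add: \<S>_def)
  define K where "K = exp (p * (s * \<Lambda> + (s * M)\<^sup>2) * real (n choose 2))"
  have "measure_pmf.expectation (gnp n p) (\<lambda>G. real (R H l G) powr s) \<le>
    measure_pmf.expectation (gnp n p) (\<lambda>G. \<Sum>Ss\<in>\<S>. of_bool (fst ` \<Union>(set Ss) \<subseteq> edges G) * exp (s * (\<Sum>e\<in>edges G. container_weight L (f Ss) e)))"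
  proof (rule expectation_gnp_mono)
    fix G assume "G \<in> set_pmf (gnp n p)"
    note G = gnp_support[OF this]
    show "real (R H l G) powr s \<le> (\<Sum>Ss\<in>\<S>. of_bool (fst ` \<Union>(set Ss) \<subseteq> edges G) * exp (s * (\<Sum>e\<in>edges G. container_weight L (f Ss) e)))"
    proof (rule card_rainbow_free_containers[OF _ s(1,2) fin])
      show "finite (edges G)" by (rule finite_subset[OF G(2)]) simp
      show "f Ss \<subseteq> UNIV \<times> {1..l}" if "Ss \<in> \<S>" for Ss using that by (auto simp: \<S>_def V_def)
      fix c assume c: "c \<in> rainbow_free_colourings H l G"
      from cont[OF G c] obtain Ss where Ss: "length Ss = k"
        "\<And>S. S\<in>set Ss \<Longrightarrow> S \<subseteq> graph_of_colouring G c \<and> real (card S) \<le> \<sigma>"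
         "graph_of_colouring G c \<subseteq> f Ss" "f Ss \<subseteq> ?E \<times> {1..l}"
         "(\<Sum>e\<in>?E. container_weight L (f Ss) e) \<le> \<Lambda> * real (n choose 2)" by blast
      have U: "\<Union>(set Ss) \<subseteq> graph_of_colouring G c" using Ss(2) by blast
      have gV: "graph_of_colouring G c \<subseteq> V" using Ss(3,4) by (simp add: V_def)
      have "inj_on fst (graph_of_colouring G c)" by (auto simp: graph_of_colouring_def inj_on_def)
      then have "inj_on fst (\<Union>(set Ss))" using U by (rule inj_on_subset)
      moreover have "Ss \<in> \<S>0" using Ss(1,2) gV by (auto simp: \<S>0_def)
      ultimately have "Ss \<in> \<S>" using Ss(4,5) by (simp add: \<S>_def V_def)
      moreover have "fst ` \<Union>(set Ss) \<subseteq> edges G" using U by (auto simp: graph_of_colouring_def)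
      ultimately show "\<exists>Ss\<in>\<S>. fst ` \<Union>(set Ss) \<subseteq> edges G \<and> graph_of_colouring G c \<subseteq> f Ss" using Ss(3) by blast
    qed
  qed
  also have "\<dots> = (\<Sum>Ss\<in>\<S>. measure_pmf.expectation (gnp n p) (\<lambda>G. of_bool (fst ` \<Union>(set Ss) \<subseteq> edges G) * exp (s * (\<Sum>e\<in>edges G. container_weight L (f Ss) e))))"
    by (intro Bochner_Integration.integral_sum integrable_gnp)
  also have "\<dots> \<le> (\<Sum>Ss\<in>\<S>. (exp 2 * p) ^ card (\<Union>(set Ss)) * K)"
  proof (rule sum_mono)
    fix Ss assume Ss: "Ss \<in> \<S>"
    then have "\<Union>(set Ss) \<subseteq> ?E \<times> {1..l}" unfolding \<S>_def \<S>0_def V_def by blast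
    then have "fst ` \<Union>(set Ss) \<subseteq> fst ` (?E \<times> {1..l})" by (rule image_mono)
    also have "\<dots> \<subseteq> ?E" by auto
    finally have sub: "fst ` \<Union>(set Ss) \<subseteq> ?E" .
    have cU: "card (fst ` \<Union>(set Ss)) = card (\<Union>(set Ss))" using Ss by (intro card_image) (simp add: \<S>_def)
    have fV: "f Ss \<subseteq> ?E \<times> {1..l}" using Ss by (simp add: \<S>_def V_def)
    have w: "\<bar>container_weight L (f Ss) e\<bar> \<le> M" for e
    proof (cases "template_of (f Ss) e = {}")
      case False
      have tsub: "template_of (f Ss) e \<subseteq> {1..l}" using fV by (auto simp: template_of_def)
      then have "0 < card (template_of (f Ss) e)" using False finite_subset[OF tsub] by (simp add: card_gt_0_iff)
      moreover have "card (template_of (f Ss) e) \<le> l" using card_mono[OF _ tsub] by simp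
      ultimately have "0 \<le> ln (real (card (template_of (f Ss) e)))" "ln (real (card (template_of (f Ss) e))) \<le> ln (real l)" by auto
      then show ?thesis using False M by (simp add: container_weight_def)
    qed (use M in \<open>simp add: container_weight_def\<close>)
    have "measure_pmf.expectation (gnp n p) (\<lambda>G. of_bool (fst ` \<Union>(set Ss) \<subseteq> edges G) * exp (s * (\<Sum>e\<in>edges G. container_weight L (f Ss) e)))
      \<le> (exp 2 * p) ^ card (fst ` \<Union>(set Ss)) * exp (p * (s * (\<Sum>e\<in>?E. container_weight L (f Ss) e) + (s * M)\<^sup>2 * real (n choose 2)))"
      using s w by (intro expectation_gnp_exp[OF p sub]) auto
    also have "\<dots> \<le> (exp 2 * p) ^ card (fst ` \<Union>(set Ss)) * K"
    proof (rule mult_left_mono)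
      have "s * (\<Sum>e\<in>?E. container_weight L (f Ss) e) \<le> s * (\<Lambda> * real (n choose 2))"
        using Ss s by (intro mult_left_mono) (auto simp: \<S>_def)
      then have "p * (s * (\<Sum>e\<in>?E. container_weight L (f Ss) e) + (s * M)\<^sup>2 * real (n choose 2))
          \<le> p * (s * (\<Lambda> * real (n choose 2)) + (s * M)\<^sup>2 * real (n choose 2))"
        using p by (intro mult_left_mono) auto
      also have "\<dots> = p * (s * \<Lambda> + (s * M)\<^sup>2) * real (n choose 2)" by (simp add: algebra_simps)
      finally show "exp (p * (s * (\<Sum>e\<in>?E. container_weight L (f Ss) e) + (s * M)\<^sup>2 * real (n choose 2))) \<le> K"
        by (simp add: K_def)
    qed (use p in simp)
    finally show "measure_pmf.expectation (gnp n p) (\<lambda>G. of_bool (fst ` \<Union>(set Ss) \<subseteq> edges G) * exp (s * (\<Sum>e\<in>edges G. container_weight L (f Ss) e)))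
      \<le> (exp 2 * p) ^ card (\<Union>(set Ss)) * K" by (simp add: cU)
  qed
  \<comment> \<open>The special properties of \<open>\<S>\<close> have been used; returning to all
    lists of small sets leaves the sum that \<open>sum_fingerprints_le\<close> bounds.\<close>
  also have "\<dots> \<le> (\<Sum>Ss\<in>\<S>0. (exp 2 * p) ^ card (\<Union>(set Ss)) * K)"
    using fin0 p by (intro sum_mono2) (auto simp: \<S>_def K_def)
  also have "\<dots> = (\<Sum>Ss\<in>\<S>0. (exp 2 * p) ^ card (\<Union>(set Ss))) * K" by (simp add: sum_distrib_right)
  also have "\<dots> \<le> exp (real k * \<sigma> * ln (1 / z) + z * 2 ^ k * (exp 2 * p) * real (card V)) * K"
    unfolding \<S>0_def using p z by (intro mult_right_mono sum_fingerprints_le[OF finV]) (auto simp: K_def)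
  also have "real (card V) = real l * real (n choose 2)"
    by (simp add: V_def card_cartesian_product card_edges_complete_graph)
  finally show ?thesis by (simp add: K_def exp_add)
qed

text \<open>Markov's inequality for the \<open>s\<close>-th moment. The constants are chosen in an
  order without circularity: the error \<open>\<delta>1\<close> fixes the containers and hence
  \<open>k\<close> and \<open>L\<close>, these fix \<open>M\<close> and \<open>s\<close>, then the
  fingerprint weight \<open>z\<close>, and only then \<open>A\<close>.\<close>

lemma colourings_upper_whp:
  fixes H :: "'a graph" and \<delta> :: real
  assumes H: "simple_graph H" "non_matching H" "2 \<le> ne H" and l: "ne H \<le> l" and \<delta>: "0 < \<delta>"
  shows "\<exists>A>0. \<forall>p. (\<forall>n. 0 \<le> p n \<and> p n \<le> 1) \<longrightarrow>
    (\<forall>\<^sub>F n in sequentially. A * real n powr (- 1 / m2 H) \<le> p n) \<longrightarrow>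
    (\<forall>\<epsilon>>0. \<forall>\<^sub>F n in sequentially. measure_pmf.prob (gnp n (p n))
     {G. \<not> real (R H l G) \<le> exp ((lambda_H H l + \<delta>) * real (ne G))} \<le> \<epsilon>)"
proof -
  have l1: "1 \<le> l" using H(3) l by simp
  define \<Lambda> where "\<Lambda> = lambda_H H l"
  have \<Lambda>: "0 \<le> \<Lambda>" unfolding \<Lambda>_def by (rule lambda_H_nonneg[OF H(1,3) l1])
  have m2: "1 \<le> m2 H" by (rule m2_ge_1[OF H(1,2)])
  \<comment> \<open>Four errors of size \<open>\<delta>1\<close> enter the moment: container weight,
    fingerprint size, fingerprint sum and the quadratic term. Markov's inequality takes a fifth. The
    other half of \<open>\<delta>\<close> pays for replacing the expected number of edges by the
    actual one.\<close>
  define \<delta>1 where "\<delta>1 = \<delta> / 10"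
  have \<delta>1: "0 < \<delta>1" using \<delta> by (simp add: \<delta>1_def)
  obtain \<epsilon>c L n1 where \<epsilon>c: "0 < \<epsilon>c" and L: "0 \<le> L" and weight: "\<And>n C. n1 \<le> n \<Longrightarrow> C \<subseteq> edges (complete_graph n) \<times> {1..l} \<Longrightarrow>
    real (card (SDR_copies H n (template_of C))) \<le> \<epsilon>c * real n ^ nv H \<Longrightarrow>
    (\<Sum>e\<in>edges (complete_graph n). container_weight L C e) \<le> (\<Lambda> + \<delta>1) * real (n choose 2)"
    using container_weight_sum[OF H l1 \<delta>1] unfolding \<Lambda>_def by blast
  obtain k n2 where cont: "\<forall>n\<ge>n2. \<exists>f. \<forall>G c. verts G = {1..n} \<longrightarrow> edges G \<subseteq> edges (complete_graph n) \<longrightarrow>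
      c \<in> rainbow_free_colourings H l G \<longrightarrow>
      (\<exists>Ss. length Ss = k \<and>
         (\<forall>S\<in>set Ss. S \<subseteq> graph_of_colouring G c \<and> real (card S) \<le> 2 * real l * real n ^ 2 * real n powr (- 1 / m2 H)) \<and>
         graph_of_colouring G c \<subseteq> f Ss \<and> f Ss \<subseteq> edges (complete_graph n) \<times> {1..l} \<and>
         real (card (SDR_copies H n (template_of (f Ss)))) \<le> \<epsilon>c * real n ^ nv H)"
    using colouring_containers[OF H(1,2) l \<epsilon>c] by (elim exE) (rule that)
  define M where "M = max L (ln (real l)) + 1"
  have M: "L \<le> M" "ln (real l) \<le> M" "1 \<le> M" using L by (auto simp: M_def)
  \<comment> \<open>The first bound allows the quadratic estimate of \<open>exp\<close>, the second
    keeps its error \<open>(s * M)\<^sup>2\<close> below \<open>s * \<delta>1\<close>. Shrinking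
    \<open>s\<close> helps because the main term is only linear in \<open>s\<close>.\<close>
  define s where "s = min (1 / M) (\<delta>1 / M\<^sup>2)"
  have s: "0 < s" "s * M \<le> 1" "s \<le> 1" "(s * M)\<^sup>2 \<le> s * \<delta>1"
  proof -
    show s0: "0 < s" using M(3) \<delta>1 by (simp add: s_def)
    have "s * M \<le> 1 / M * M" using M(3) by (intro mult_right_mono) (auto simp: s_def)
    then show "s * M \<le> 1" using M(3) by simp
    have "s \<le> 1 / M" by (simp add: s_def)
    also have "\<dots> \<le> 1" using M(3) by simp
    finally show "s \<le> 1" .
    have "s * M\<^sup>2 \<le> \<delta>1 / M\<^sup>2 * M\<^sup>2" using M(3) by (intro mult_right_mono) (auto simp: s_def)
    then have "s * M\<^sup>2 \<le> \<delta>1" using M(3) by simp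
    then have "s * (s * M\<^sup>2) \<le> s * \<delta>1" using s0 by (intro mult_left_mono) auto
    then show "(s * M)\<^sup>2 \<le> s * \<delta>1" by (simp add: power2_eq_square mult_ac)
  qed
  define Y where "Y = 2 ^ k * exp 2 * real l"
  have Y: "0 < Y" using l1 by (simp add: Y_def)
  \<comment> \<open>\<open>Y\<close> collects the constants in front of \<open>z\<close> in the
    fingerprint sum, and \<open>z\<close> makes that term at most \<open>s * \<delta>1\<close> per
    expected edge.\<close>
  define z where "z = min 1 (s * \<delta>1 / Y)"
  have z: "0 < z" "z \<le> 1" using s \<delta>1 Y by (auto simp: z_def)
  have zY: "z * Y \<le> s * \<delta>1"
  proof -
    have "z * Y \<le> s * \<delta>1 / Y * Y" using Y by (intro mult_right_mono) (auto simp: z_def)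
    then show ?thesis using Y by simp
  qed
  have lnz: "0 \<le> ln (1 / z)" using z by simp
  \<comment> \<open>As \<open>p n \<ge> A * \<tau>\<close> and
    \<open>n\<^sup>2 \<le> 4 * (n choose 2)\<close>, the fingerprint size is at most
    \<open>8 * l / A\<close> times the expected number of edges. This \<open>A\<close> makes the
    term with \<open>ln (1 / z)\<close> at most \<open>s * \<delta>1\<close> per expected
    edge.\<close>
  define A where "A = 8 * real k * real l * ln (1 / z) / (s * \<delta>1) + 1"
  have A: "0 < A" unfolding A_def using lnz s \<delta>1 by (intro add_nonneg_pos divide_nonneg_pos) auto
  have Abound: "8 * real k * real l * ln (1 / z) \<le> s * \<delta>1 * A"
    using s \<delta>1 by (simp add: A_def field_simps)
  \<comment> \<open>Chosen so that \<open>(\<Lambda> + \<delta>) * \<eta> = \<delta> / 2\<close>,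
    the part of \<open>\<delta>\<close> reserved for the edge count.\<close>
  define \<eta> where "\<eta> = \<delta> / (\<Lambda> + \<delta>) / 2"
  have \<eta>: "0 < \<eta>" using \<delta> \<Lambda> by (simp add: \<eta>_def)
  show ?thesis
  proof (rule exI[of _ A], intro conjI A allI impI)
    fix p :: "nat \<Rightarrow> real" and \<epsilon> :: real
    assume p: "\<forall>n. 0 \<le> p n \<and> p n \<le> 1" and pA: "\<forall>\<^sub>F n in sequentially. A * real n powr (- 1 / m2 H) \<le> p n" and \<epsilon>: "0 < \<epsilon>"
    have lim: "filterlim (\<lambda>n. p n * real (n choose 2)) at_top sequentially"
      by (rule choose_two_expected_at_top[OF A m2 pA])
    have "\<forall>\<^sub>F n in sequentially. measure_pmf.prob (gnp n (p n))
       {G. \<eta> * (p n * real (n choose 2)) \<le> \<bar>real (ne G) - p n * real (n choose 2)\<bar>} \<le> \<epsilon> / 2"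
      using p \<eta> \<epsilon> by (intro edge_count_whp lim) auto
    moreover have "\<forall>\<^sub>F n in sequentially. ln (2 / \<epsilon>) / (s * \<delta>1) \<le> p n * real (n choose 2)"
      using lim by (simp add: filterlim_at_top)
    ultimately show "\<forall>\<^sub>F n in sequentially. measure_pmf.prob (gnp n (p n))
     {G. \<not> real (R H l G) \<le> exp ((lambda_H H l + \<delta>) * real (ne G))} \<le> \<epsilon>"
      using pA eventually_ge_at_top[of "n1 + n2 + 2"]
    proof eventually_elim
      fix n assume edge: "measure_pmf.prob (gnp n (p n)) {G. \<eta> * (p n * real (n choose 2)) \<le> \<bar>real (ne G) - p n * real (n choose 2)\<bar>} \<le> \<epsilon> / 2"
        and big: "ln (2 / \<epsilon>) / (s * \<delta>1) \<le> p n * real (n choose 2)"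
        and pn: "A * real n powr (- 1 / m2 H) \<le> p n" and n: "n1 + n2 + 2 \<le> n"
      define c where "c = p n * real (n choose 2)"
      have pb: "0 \<le> p n" "p n \<le> 1" using p by auto
      have c: "0 \<le> c" using pb by (simp add: c_def)
      define \<sigma> where "\<sigma> = 2 * real l * real n ^ 2 * real n powr (- 1 / m2 H)"
      have "n2 \<le> n" using n by simp
      from cont[rule_format, OF this, folded \<sigma>_def] obtain f where
        "\<forall>G c. verts G = {1..n} \<longrightarrow> edges G \<subseteq> edges (complete_graph n) \<longrightarrow>
          c \<in> rainbow_free_colourings H l G \<longrightarrow>
        (\<exists>Ss. length Ss = k \<and>
         (\<forall>S\<in>set Ss. S \<subseteq> graph_of_colouring G c \<and> real (card S) \<le> \<sigma>) \<and>
         graph_of_colouring G c \<subseteq> f Ss \<and> f Ss \<subseteq> edges (complete_graph n) \<times> {1..l} \<and>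
         real (card (SDR_copies H n (template_of (f Ss)))) \<le> \<epsilon>c * real n ^ nv H)"
        by (elim exE) (rule that)
      note f = this[rule_format]
      have "measure_pmf.expectation (gnp n (p n)) (\<lambda>G. real (R H l G) powr s) \<le>
        exp (real k * \<sigma> * ln (1 / z) + z * 2 ^ k * (exp 2 * p n) * (real l * real (n choose 2))
         + p n * (s * (\<Lambda> + \<delta>1) + (s * M)\<^sup>2) * real (n choose 2))"
      proof (rule expectation_rainbow_free_powr[where f = f])
        fix G :: "nat graph" and c
        assume G: "verts G = {1..n}" "edges G \<subseteq> edges (complete_graph n)" "c \<in> rainbow_free_colourings H l G"
        from f[OF G] obtain Ss where Ss: "length Ss = k"
         "\<forall>S\<in>set Ss. S \<subseteq> graph_of_colouring G c \<and> real (card S) \<le> \<sigma>"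
         "graph_of_colouring G c \<subseteq> f Ss" "f Ss \<subseteq> edges (complete_graph n) \<times> {1..l}"
         "real (card (SDR_copies H n (template_of (f Ss)))) \<le> \<epsilon>c * real n ^ nv H" by blast
        have "n1 \<le> n" using n by simp
        from weight[OF this Ss(4,5)] Ss(1-4)
        show "\<exists>Ss. length Ss = k \<and> (\<forall>S\<in>set Ss. S \<subseteq> graph_of_colouring G c \<and> real (card S) \<le> \<sigma>) \<and>
         graph_of_colouring G c \<subseteq> f Ss \<and> f Ss \<subseteq> edges (complete_graph n) \<times> {1..l} \<and>
         (\<Sum>e\<in>edges (complete_graph n). container_weight L (f Ss) e) \<le> (\<Lambda> + \<delta>1) * real (n choose 2)" by blast
      qed (fact pb s(1,3,2) z M(1,2) L l1)+
      also have "\<dots> \<le> exp (s * (\<Lambda> + 4 * \<delta>1) * c)"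
      proof -
        have "real k * \<sigma> * ln (1 / z) \<le> s * \<delta>1 * c"
        proof -
          have "real n ^ 2 * real n powr (- 1 / m2 H) \<le> (4 * real (n choose 2)) * (p n / A)"
            using card_choose_two_bounds(1)[of n] n pn A pb by (intro mult_mono) (auto simp: field_simps)
          then have "real k * 2 * real l * ln (1 / z) * (real n ^ 2 * real n powr (- 1 / m2 H))
              \<le> real k * 2 * real l * ln (1 / z) * ((4 * real (n choose 2)) * (p n / A))"
            using lnz by (intro mult_left_mono) auto
          also have "\<dots> = 8 * real k * real l * ln (1 / z) * (c / A)" by (simp add: c_def)
          also have "\<dots> \<le> s * \<delta>1 * A * (c / A)" using Abound c A by (intro mult_right_mono) auto
          also have "\<dots> = s * \<delta>1 * c" using A by simp
          finally show ?thesis by (simp add: \<sigma>_def mult_ac)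
        qed
        moreover have "z * 2 ^ k * (exp 2 * p n) * (real l * real (n choose 2)) \<le> s * \<delta>1 * c"
          using mult_right_mono[OF zY c] by (simp add: Y_def c_def mult_ac)
        moreover have "p n * (s * (\<Lambda> + \<delta>1) + (s * M)\<^sup>2) * real (n choose 2) \<le> (s * (\<Lambda> + \<delta>1) + s * \<delta>1) * c"
        proof -
          have "(s * (\<Lambda> + \<delta>1) + (s * M)\<^sup>2) * c \<le> (s * (\<Lambda> + \<delta>1) + s * \<delta>1) * c"
            using s(4) c by (intro mult_right_mono) auto
          then show ?thesis by (simp add: c_def mult_ac)
        qed
        ultimately show ?thesis by (simp add: algebra_simps)
      qed
      finally have E: "measure_pmf.expectation (gnp n (p n)) (\<lambda>G. real (R H l G) powr s) \<le> exp (s * (\<Lambda> + 4 * \<delta>1) * c)" .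
      define B where "B = exp (s * (\<Lambda> + 5 * \<delta>1) * c)"
      have "measure_pmf.prob (gnp n (p n)) {G. exp ((\<Lambda> + 5 * \<delta>1) * c) < real (R H l G)}
          \<le> measure_pmf.expectation (gnp n (p n)) (\<lambda>G. real (R H l G) powr s / B)"
      proof (rule prob_gnp_le_expectation)
        fix G assume "exp ((\<Lambda> + 5 * \<delta>1) * c) < real (R H l G)"
        then have "exp ((\<Lambda> + 5 * \<delta>1) * c) powr s \<le> real (R H l G) powr s" using s by (intro powr_mono2) auto
        then have "B \<le> real (R H l G) powr s" by (simp add: B_def powr_def mult_ac)
        then show "1 \<le> real (R H l G) powr s / B" by (simp add: B_def)
      qed (simp add: B_def)
      also have "\<dots> = measure_pmf.expectation (gnp n (p n)) (\<lambda>G. real (R H l G) powr s) / B" by simp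
      also have "\<dots> \<le> exp (s * (\<Lambda> + 4 * \<delta>1) * c) / B" using E by (intro divide_right_mono) (auto simp: B_def)
      also have "\<dots> = exp (- (s * \<delta>1 * c))" by (simp add: B_def exp_diff[symmetric] algebra_simps)
      also have "\<dots> \<le> exp (- ln (2 / \<epsilon>))"
        using big s \<delta>1 by (simp add: c_def divide_le_eq mult_ac)
      also have "\<dots> = \<epsilon> / 2" using \<epsilon> by (simp add: exp_minus)
      finally have upper: "measure_pmf.prob (gnp n (p n)) {G. exp ((\<Lambda> + 5 * \<delta>1) * c) < real (R H l G)} \<le> \<epsilon> / 2" .
      have "measure_pmf.prob (gnp n (p n)) {G. \<not> real (R H l G) \<le> exp ((lambda_H H l + \<delta>) * real (ne G))}
        \<le> measure_pmf.prob (gnp n (p n)) {G. \<eta> * c \<le> \<bar>real (ne G) - c\<bar> \<or> exp ((\<Lambda> + 5 * \<delta>1) * c) < real (R H l G)}"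
      proof (rule prob_gnp_mono, rule ccontr)
        fix G assume 1: "\<not> real (R H l G) \<le> exp ((lambda_H H l + \<delta>) * real (ne G))"
          and 2: "\<not> (\<eta> * c \<le> \<bar>real (ne G) - c\<bar> \<or> exp ((\<Lambda> + 5 * \<delta>1) * c) < real (R H l G))"
        then have "c - \<eta> * c \<le> real (ne G)" by (auto simp: abs_le_iff not_le)
        then have "(\<Lambda> + \<delta>) * (c - \<eta> * c) \<le> (\<Lambda> + \<delta>) * real (ne G)" using \<Lambda> \<delta> by (intro mult_left_mono) auto
        moreover have "(\<Lambda> + \<delta>) * (c - \<eta> * c) = (\<Lambda> + \<delta>) * c - ((\<Lambda> + \<delta>) * \<eta>) * c" by (simp add: algebra_simps)
        moreover have "(\<Lambda> + \<delta>) * \<eta> = \<delta> / 2"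
        proof -
          have "\<Lambda> + \<delta> \<noteq> 0" using \<Lambda> \<delta> by linarith
          then show ?thesis unfolding \<eta>_def by (metis nonzero_mult_div_cancel_left times_divide_eq_right)
        qed
        moreover have "(\<Lambda> + \<delta>) * c - \<delta> / 2 * c = (\<Lambda> + 5 * \<delta>1) * c" by (simp add: \<delta>1_def algebra_simps)
        ultimately have "(\<Lambda> + 5 * \<delta>1) * c \<le> (\<Lambda> + \<delta>) * real (ne G)" by simp
        then have "exp ((\<Lambda> + 5 * \<delta>1) * c) \<le> exp ((\<Lambda> + \<delta>) * real (ne G))" by simp
        then show False using 1 2 unfolding \<Lambda>_def by linarith
      qed
      also have "\<dots> \<le> \<epsilon> / 2 + \<epsilon> / 2"
        by (rule order_trans[OF prob_gnp_disj]) (rule add_mono[OF edge[folded c_def] upper])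
      finally show "measure_pmf.prob (gnp n (p n)) {G. \<not> real (R H l G) \<le> exp ((lambda_H H l + \<delta>) * real (ne G))} \<le> \<epsilon>" by simp
    qed
  qed
qed

section \<open>Below the threshold\<close>

definition copy_count :: "'a graph \<Rightarrow> nat \<Rightarrow> nat graph \<Rightarrow> real" where
  "copy_count J n G = (\<Sum>\<phi>\<in>emb J n. of_bool (emap \<phi> (edges J) \<subseteq> edges G))"

lemma card_emap:
  assumes "simple_graph J" "\<phi> \<in> emb J n"
  shows "card (emap \<phi> (edges J)) = ne J"
proof -
  have "inj_on \<phi> (verts J)" using assms(2) by (simp add: emb_def)
  from card_image[OF inj_on_image_edges[OF assms(1) this]] show ?thesis by (simp add: emap_def)
qed

lemma finite_emap: "simple_graph J \<Longrightarrow> finite (emap \<phi> (edges J))"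
  by (simp add: emap_def simple_graphD)

lemma expectation_copy_count:
  assumes J: "simple_graph J" and p: "0 \<le> p" "p \<le> 1"
  shows "measure_pmf.expectation (gnp n p) (copy_count J n) = real (card (emb J n)) * p ^ ne J"
proof -
  have "measure_pmf.expectation (gnp n p) (copy_count J n) =
      (\<Sum>\<phi>\<in>emb J n. measure_pmf.expectation (gnp n p) (\<lambda>G. of_bool (emap \<phi> (edges J) \<subseteq> edges G)))"
    unfolding copy_count_def by (intro Bochner_Integration.integral_sum integrable_gnp)
  also have "\<dots> = (\<Sum>\<phi>\<in>emb J n. p ^ ne J)"
    using expectation_gnp_contains[OF p emap_complete[OF J]] card_emap[OF J] by (intro sum.cong) auto
  finally show ?thesis by simp
qed

text \<open>Edge-disjoint pairs of embeddings cancel. A pair sharing the edge set \<open>T\<close>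
  has probability \<open>p ^ (2 * ne J - card T)\<close>, and O(n^(v-2) \<tau>^(|T|-1)) embeddings
  contain \<open>T\<close>. Since \<open>\<tau> \<le> p / a\<close>, the result is of order
  \<open>p ^ (2 * ne J - 1)\<close> whatever \<open>T\<close> is: no overlap costs more, up to
  constants, than a single shared edge.\<close>

lemma variance_copy_count:
  assumes J: "simple_graph J" and p: "0 \<le> p" "p \<le> 1" and n: "0 < n" and \<mu>: "0 < \<mu>"
    and L: "\<And>L. L \<subseteq> edges J \<Longrightarrow> L \<noteq> {} \<Longrightarrow> real (card L) - 1 \<le> \<mu> * (real (card (\<Union>L)) - 2)"
    and a: "0 < a" "a \<le> 1" "a * real n powr (- 1 / \<mu>) \<le> p"
  shows "measure_pmf.expectation (gnp n p) (\<lambda>G. (copy_count J n G - real (card (emb J n)) * p ^ ne J)\<^sup>2)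
    \<le> 4 ^ ne J * real (nv J) ^ nv J * (1 / a) ^ ne J * (real n ^ nv J * (real n ^ nv J / real n ^ 2) * p ^ (2 * ne J - 1))"
proof -
  let ?S = "\<lambda>\<phi>. emap \<phi> (edges J)" and ?I = "emb J n"
  define \<tau> where "\<tau> = real n powr (- 1 / \<mu>)"
  define C where "C = 2 ^ ne J * real (nv J) ^ nv J * (real n ^ nv J / real n ^ 2)"
  have C: "0 \<le> C" by (simp add: C_def)
  define B where "B = C * (1 / a) ^ ne J * p ^ (2 * ne J - 1)"
  have B: "0 \<le> B" using C a p by (simp add: B_def)
  have inner: "(\<Sum>\<psi>\<in>?I. p ^ card (?S \<phi> \<union> ?S \<psi>) - p ^ (card (?S \<phi>) + card (?S \<psi>))) \<le> 2 ^ ne J * B" if \<phi>: "\<phi> \<in> ?I" for \<phi>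
  proof -
    let ?P = "Pow (?S \<phi>) - {{}}"
    have finP: "finite ?P" using finite_emap[OF J] by simp
    \<comment> \<open>The true overlap is one of the nonempty subsets \<open>T\<close> of the first
      copy; summing over all of them allows the sums over \<open>T\<close> and \<open>\<psi>\<close>
      to be interchanged.\<close>
    have "(\<Sum>\<psi>\<in>?I. p ^ card (?S \<phi> \<union> ?S \<psi>) - p ^ (card (?S \<phi>) + card (?S \<psi>)))
        \<le> (\<Sum>\<psi>\<in>?I. \<Sum>T\<in>?P. of_bool (T \<subseteq> ?S \<psi>) * p ^ (2 * ne J - card T))"
    proof (rule sum_mono)
      fix \<psi> assume \<psi>: "\<psi> \<in> ?I"
      have c: "card (?S \<phi>) = ne J" "card (?S \<psi>) = ne J" using card_emap[OF J] \<phi> \<psi> by auto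
      have un: "card (?S \<phi> \<union> ?S \<psi>) = 2 * ne J - card (?S \<phi> \<inter> ?S \<psi>)"
        using card_Un_Int[OF finite_emap[OF J] finite_emap[OF J], of \<phi> \<psi>] c by simp
      have nn: "0 \<le> (\<Sum>T\<in>?P. of_bool (T \<subseteq> ?S \<psi>) * p ^ (2 * ne J - card T))" using p by (intro sum_nonneg) auto
      show "p ^ card (?S \<phi> \<union> ?S \<psi>) - p ^ (card (?S \<phi>) + card (?S \<psi>)) \<le> (\<Sum>T\<in>?P. of_bool (T \<subseteq> ?S \<psi>) * p ^ (2 * ne J - card T))"
      proof (cases "?S \<phi> \<inter> ?S \<psi> = {}")
        case True
        then have "card (?S \<phi> \<union> ?S \<psi>) = card (?S \<phi>) + card (?S \<psi>)" using un c by simp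
        then show ?thesis using nn by simp
      next
        case False
        then have "of_bool (?S \<phi> \<inter> ?S \<psi> \<subseteq> ?S \<psi>) * p ^ (2 * ne J - card (?S \<phi> \<inter> ?S \<psi>))
            \<le> (\<Sum>T\<in>?P. of_bool (T \<subseteq> ?S \<psi>) * p ^ (2 * ne J - card T))"
          using finP p by (intro member_le_sum) auto
        moreover have "0 \<le> p ^ (card (?S \<phi>) + card (?S \<psi>))" using p by simp
        ultimately show ?thesis unfolding un by simp
      qed
    qed
    also have "\<dots> = (\<Sum>T\<in>?P. real (card {\<psi> \<in> ?I. T \<subseteq> ?S \<psi>}) * p ^ (2 * ne J - card T))"
      by (subst sum.swap) (simp add: sum_distrib_right[symmetric] J Int_def)
    also have "\<dots> \<le> (\<Sum>T\<in>?P. B)"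
    proof (rule sum_mono)
      fix T assume T: "T \<in> ?P"
      have TS: "T \<subseteq> ?S \<phi>" "T \<noteq> {}" using T by auto
      have "finite T" by (rule finite_subset[OF TS(1) finite_emap[OF J]])
      then have t: "card T \<noteq> 0" "card T \<le> ne J"
        using TS card_mono[OF finite_emap[OF J] TS(1)] card_emap[OF J \<phi>] by auto
      have "real (card {\<psi> \<in> ?I. T \<subseteq> ?S \<psi>}) \<le> C * \<tau> ^ (card T - 1)"
        unfolding C_def \<tau>_def using T by (intro card_emb_containing[OF J L \<mu> n]) auto
      also have "\<tau> ^ (card T - 1) \<le> (p * (1 / a)) ^ (card T - 1)"
        using a by (intro power_mono) (auto simp: \<tau>_def field_simps)
      also have "\<dots> = p ^ (card T - 1) * (1 / a) ^ (card T - 1)" by (rule power_mult_distrib)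
      also have "(1 / a) ^ (card T - 1) \<le> (1 / a) ^ ne J" using a t by (intro power_increasing) auto
      finally have "real (card {\<psi> \<in> ?I. T \<subseteq> ?S \<psi>}) \<le> C * (p ^ (card T - 1) * (1 / a) ^ ne J)"
        using C p a by (simp add: mult_left_mono)
      then have "real (card {\<psi> \<in> ?I. T \<subseteq> ?S \<psi>}) * p ^ (2 * ne J - card T)
          \<le> C * (p ^ (card T - 1) * (1 / a) ^ ne J) * p ^ (2 * ne J - card T)"
        using p by (intro mult_right_mono) auto
      also have "\<dots> = C * (1 / a) ^ ne J * (p ^ (card T - 1) * p ^ (2 * ne J - card T))" by simp
      also have "p ^ (card T - 1) * p ^ (2 * ne J - card T) = p ^ (2 * ne J - 1)"
        using t by (simp add: power_add[symmetric])
      finally show "real (card {\<psi> \<in> ?I. T \<subseteq> ?S \<psi>}) * p ^ (2 * ne J - card T) \<le> B" by (simp add: B_def)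
    qed
    also have "\<dots> \<le> (\<Sum>T\<in>Pow (?S \<phi>). B)" using B finite_emap[OF J] by (intro sum_mono2) auto
    also have "\<dots> = 2 ^ ne J * B" by (simp add: card_Pow[OF finite_emap[OF J]] card_emap[OF J \<phi>])
    finally show ?thesis .
  qed
  have "measure_pmf.expectation (gnp n p) (\<lambda>G. (copy_count J n G - real (card ?I) * p ^ ne J)\<^sup>2)
    = measure_pmf.expectation (gnp n p) (\<lambda>G. ((\<Sum>\<phi>\<in>?I. 1 * of_bool (?S \<phi> \<subseteq> edges G)) - (\<Sum>\<phi>\<in>?I. 1 * p ^ card (?S \<phi>)))\<^sup>2)"
    using card_emap[OF J] by (simp add: copy_count_def)
  also have "\<dots> = (\<Sum>\<phi>\<in>?I. \<Sum>\<psi>\<in>?I. 1 * 1 * (p ^ card (?S \<phi> \<union> ?S \<psi>) - p ^ (card (?S \<phi>) + card (?S \<psi>))))"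
    by (rule second_moment_gnp[OF p emap_complete[OF J]])
  also have "\<dots> \<le> (\<Sum>\<phi>\<in>?I. 2 ^ ne J * B)" using inner by (intro sum_mono) simp
  also have "\<dots> = real (card ?I) * (2 ^ ne J * B)" by simp
  also have "\<dots> \<le> real n ^ nv J * (2 ^ ne J * B)" using B by (intro mult_right_mono card_emb_le[OF J]) auto
  also have "\<dots> = 4 ^ ne J * real (nv J) ^ nv J * (1 / a) ^ ne J * (real n ^ nv J * (real n ^ nv J / real n ^ 2) * p ^ (2 * ne J - 1))"
  proof -
    have "(4::real) ^ ne J = 2 ^ ne J * 2 ^ ne J" by (simp add: power_mult_distrib[symmetric])
    then show ?thesis by (simp add: B_def C_def)
  qed
  finally show ?thesis .
qed

section \<open>Colourings that are constant on the copies of a densest subgraph\<close>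

text \<open>Each copy of \<open>H\<close> contains a copy of \<open>J\<close>, whose edges all
  receive colour 1; as \<open>J\<close> has two edges, the copy of \<open>H\<close> is not rainbow.
  At most \<open>ne J\<close> edges per copy of \<open>J\<close> lose their freedom.\<close>

lemma few_copies_many_colourings:
  assumes H: "simple_graph H" and J: "subgraph J H" "2 \<le> ne J" and l: "1 \<le> l"
    and G: "verts G = {1..n}" "edges G \<subseteq> edges (complete_graph n)"
    and few: "real (ne J) * copy_count J n G \<le> \<delta> * real (ne G)"
  shows "real l powr ((1 - \<delta>) * real (ne G)) \<le> real (R H l G)"
proof -
  have sJ: "simple_graph J" and subJ: "verts J \<subseteq> verts H" "edges J \<subseteq> edges H" using J(1) by (auto simp: subgraph_def)
  have finG: "finite (edges G)" by (rule finite_subset[OF G(2)]) simp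
  define I where "I = {\<phi> \<in> emb J n. emap \<phi> (edges J) \<subseteq> edges G}"
  have finI: "finite I" using sJ by (simp add: I_def)
  define D where "D = (\<Union>\<phi>\<in>I. emap \<phi> (edges J))"
  have DG: "D \<subseteq> edges G" by (auto simp: D_def I_def)
  have finD: "finite D" by (rule finite_subset[OF DG finG])
  have "card D \<le> (\<Sum>\<phi>\<in>I. card (emap \<phi> (edges J)))" unfolding D_def by (rule card_UN_le[OF finI])
  also have "\<dots> = (\<Sum>\<phi>\<in>I. ne J)" using card_emap[OF sJ] by (intro sum.cong) (auto simp: I_def)
  finally have "card D \<le> ne J * card I" by (simp add: mult.commute)
  then have "real (card D) \<le> real (ne J * card I)" by (rule of_nat_mono)
  moreover have "real (card I) = copy_count J n G" using sJ by (simp add: copy_count_def I_def Int_def)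
  ultimately have cD: "real (card D) \<le> \<delta> * real (ne G)" using few by simp
  let ?B = "\<lambda>e. if e \<in> D then {1} else {1..l}"
  have "PiE (edges G) ?B \<subseteq> rainbow_free_colourings H l G"
  proof
    fix c assume c: "c \<in> PiE (edges G) ?B"
    have "\<not> (\<exists>F. is_copy H F G \<and> inj_on c (edges F))"
      unfolding is_copy_emb_iff[OF H G(1), where Q = "inj_on c"]
    proof clarify
      fix \<phi> assume \<phi>: "\<phi> \<in> emb H n" "emap \<phi> (edges H) \<subseteq> edges G" "inj_on c (emap \<phi> (edges H))"
      define \<psi> where "\<psi> = restrict \<phi> (verts J)"
      have "\<phi> \<in> verts H \<rightarrow>\<^sub>E {1..n}" "inj_on \<phi> (verts H)" using \<phi>(1) unfolding emb_def by blast+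
      then have "\<psi> \<in> emb J n" using subJ(1) inj_on_subset unfolding \<psi>_def emb_def by (auto simp: PiE_iff inj_on_restrict_eq)
      moreover have \<psi>: "emap \<psi> (edges J) \<subseteq> emap \<phi> (edges H)"
      proof -
        have "emap \<psi> (edges J) = emap \<phi> (edges J)"
          unfolding emap_def using simple_graphD(3)[OF sJ] by (intro image_cong refl) (auto simp: \<psi>_def)
        then show ?thesis using subJ(2) by (auto simp: emap_def)
      qed
      ultimately have "\<psi> \<in> I" using \<phi>(2) by (auto simp: I_def)
      then have inD: "emap \<psi> (edges J) \<subseteq> D" by (auto simp: D_def)
      have "c f = 1" if "f \<in> emap \<psi> (edges J)" for f
      proof -
        have "f \<in> edges G" "f \<in> D" using that inD DG by auto
        then show ?thesis using PiE_mem[OF c, of f] by simp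
      qed
      then have "card (emap \<psi> (edges J)) \<le> card {1::nat}"
        by (intro card_inj_on_le[OF inj_on_subset[OF \<phi>(3) \<psi>]]) auto
      then show False using card_emap[OF sJ \<open>\<psi> \<in> emb J n\<close>] J(2) by simp
    qed
    moreover have "c \<in> edges G \<rightarrow>\<^sub>E {1..l}" by (rule subsetD[OF PiE_mono c]) (use l in auto)
    ultimately show "c \<in> rainbow_free_colourings H l G" unfolding rainbow_free_colourings_def by blast
  qed
  then have "card (PiE (edges G) ?B) \<le> R H l G"
    unfolding R_def by (rule card_mono[OF finite_rainbow_free[OF finG]])
  moreover have "card (PiE (edges G) ?B) = l ^ card (edges G - D)"
  proof -
    have "card (PiE (edges G) ?B) = (\<Prod>e\<in>edges G. if e \<in> D then 1 else l)"
      using finG by (subst card_PiE) (auto intro!: prod.cong)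
    then show ?thesis using finG by (simp add: prod.If_cases Diff_eq Compl_eq)
  qed
  ultimately have "real (l ^ card (edges G - D)) \<le> real (R H l G)" by (simp only: of_nat_le_iff)
  moreover have "real l powr ((1 - \<delta>) * real (ne G)) \<le> real l powr (real (card (edges G - D)))"
  proof (rule powr_mono)
    have "card (edges G - D) = ne G - card D" "card D \<le> ne G"
      using DG finD finG by (auto simp: card_Diff_subset card_mono)
    then have "real (card (edges G - D)) = real (ne G) - real (card D)" by (simp add: of_nat_diff)
    then show "(1 - \<delta>) * real (ne G) \<le> real (card (edges G - D))" using cD by (simp add: algebra_simps)
  qed (use l in simp)
  moreover have "real l powr (real (card (edges G - D))) = real (l ^ card (edges G - D))"
    using l by (simp add: powr_realpow)
  ultimately show ?thesis by linarith
qed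

text \<open>Three ranges, in terms of \<open>\<rho> = p / \<tau>\<close> and
  \<open>N = n\<^sup>2 * p\<close>. If \<open>N\<close> is bounded, there is typically no copy of
  \<open>J\<close> at all. If \<open>N\<close> is large and \<open>\<rho>\<close> is below a bound
  \<open>b\<close> that depends on the failure probability, Markov's inequality suffices. In
  between, where \<open>b < \<rho> \<le> a\<close>, Chebyshev's inequality applies, because
  \<open>p\<close> is then at least a constant times \<open>\<tau>\<close>.\<close>

lemma colourings_sparse_whp:
  fixes H :: "'a graph" and \<delta> :: real
  assumes H: "simple_graph H" "non_matching H" and l: "1 \<le> l" and \<delta>: "0 < \<delta>"
  shows "\<exists>a>0. \<forall>p. (\<forall>n. 0 \<le> p n \<and> p n \<le> 1) \<longrightarrow>
    (\<forall>\<^sub>F n in sequentially. p n \<le> a * real n powr (- 1 / m2 H)) \<longrightarrow>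
    (\<forall>\<epsilon>>0. \<forall>\<^sub>F n in sequentially. measure_pmf.prob (gnp n (p n))
     {G. \<not> real l powr ((1 - \<delta>) * real (ne G)) \<le> real (R H l G)} \<le> \<epsilon>)"
proof -
  obtain J where J: "subgraph J H" "3 \<le> nv J" "2 \<le> ne J" "real (ne J) - 1 = m2 H * (real (nv J) - 2)"
    by (rule m2_attained[OF H])
  have sJ: "simple_graph J" and subJ: "edges J \<subseteq> edges H" using J(1) by (auto simp: subgraph_def)
  have m2: "1 \<le> m2 H" by (rule m2_ge_1[OF H])
  have LJ: "real (card L) - 1 \<le> m2 H * (real (card (\<Union>L)) - 2)" if "L \<subseteq> edges J" "L \<noteq> {}" for L
    using that subJ by (intro m2_bound(2)[OF H(1)]) auto
  define v e where "v = nv J" and "e = ne J"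
  \<comment> \<open>This makes the expected number of copies, at most \<open>N * a\<close>, no more
    than half of the tolerated number \<open>t = \<delta> * N / (8 * e)\<close>.\<close>
  define a where "a = min 1 (\<delta> / (16 * real e))"
  have e2: "2 \<le> e" using J(3) by (simp add: e_def)
  have a: "0 < a" "a \<le> 1" "16 * real e * a \<le> \<delta>"
  proof -
    have "16 * real e * a \<le> 16 * real e * (\<delta> / (16 * real e))" by (intro mult_left_mono) (auto simp: a_def)
    then show "16 * real e * a \<le> \<delta>" using e2 by simp
  qed (use \<delta> e2 in \<open>auto simp: a_def\<close>)
  show ?thesis
  proof (rule exI[of _ a], intro conjI a(1) allI impI)
    fix p :: "nat \<Rightarrow> real" and \<epsilon> :: real
    assume p: "\<forall>n. 0 \<le> p n \<and> p n \<le> 1" and pa: "\<forall>\<^sub>F n in sequentially. p n \<le> a * real n powr (- 1 / m2 H)" and \<epsilon>: "0 < \<epsilon>"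
    \<comment> \<open>For \<open>\<rho> \<le> b\<close>, Markov's inequality gives
      \<open>8 * e * b / \<delta>\<close>, which this choice makes at most
      \<open>\<epsilon> / 2\<close>.\<close>
    define b where "b = min a (\<epsilon> * \<delta> / (16 * real e))"
    have b: "0 < b" "b \<le> a" "16 * real e * b \<le> \<epsilon> * \<delta>"
    proof -
      have "16 * real e * b \<le> 16 * real e * (\<epsilon> * \<delta> / (16 * real e))" by (intro mult_left_mono) (auto simp: b_def)
      then show "16 * real e * b \<le> \<epsilon> * \<delta>" using e2 by simp
    qed (use a \<epsilon> \<delta> e2 in \<open>auto simp: b_def\<close>)
    define C where "C = 4 ^ e * real v ^ v * (1 / b) ^ e"
    have C: "0 \<le> C" using b by (simp add: C_def)
    \<comment> \<open>The first summand makes the Chebyshev bound for the edge count at most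
      \<open>\<epsilon> / 2\<close>, the second the one for the copies of \<open>J\<close>.\<close>
    define K where "K = 32 / \<epsilon> + 512 * C * real e ^ 2 / (\<delta>\<^sup>2 * \<epsilon>)"
    have K: "0 < K" unfolding K_def using C \<epsilon> \<delta> by (intro add_pos_nonneg) auto
    obtain n1 :: nat where n1: "K * K / \<epsilon> \<le> real n1" using real_arch_simple by blast
    show "\<forall>\<^sub>F n in sequentially. measure_pmf.prob (gnp n (p n))
     {G. \<not> real l powr ((1 - \<delta>) * real (ne G)) \<le> real (R H l G)} \<le> \<epsilon>"
      using pa eventually_ge_at_top[of "n1 + 2"]
    proof eventually_elim
      fix n assume pn: "p n \<le> a * real n powr (- 1 / m2 H)" and n: "n1 + 2 \<le> n"
      define q where "q = p n"
      have q: "0 \<le> q" "q \<le> 1" using p by (auto simp: q_def)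
      have n0: "0 < real n" using n by simp
      define \<tau> where "\<tau> = real n powr (- 1 / m2 H)"
      have \<tau>: "0 < \<tau>" "1 / real n \<le> \<tau>"
      proof -
        have "real n powr (- 1) \<le> real n powr (- 1 / m2 H)" using n m2 by (intro powr_mono) (auto simp: field_simps)
        then show "1 / real n \<le> \<tau>" using n0 by (simp add: \<tau>_def powr_minus_divide)
      qed (use n0 in \<open>simp add: \<tau>_def\<close>)
      define \<rho> where "\<rho> = q / \<tau>"
      have \<rho>a: "\<rho> \<le> a" using pn \<tau>(1) unfolding \<rho>_def q_def \<tau>_def by (simp add: divide_le_eq)
      have \<rho>: "0 \<le> \<rho>" "\<rho> \<le> a" "\<rho> \<le> 1" "q = \<rho> * \<tau>"
      proof -
        show "\<rho> \<le> 1" using \<rho>a a(2) by linarith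
      qed (use q \<tau> \<rho>a in \<open>auto simp: \<rho>_def\<close>)
      \<comment> \<open>Here it matters that \<open>J\<close> attains \<open>m2 H\<close>: at p =
        \<tau> the quantities n^v p^e and n^2 p are equal, so below \<tau> the copies of
        \<open>J\<close> are fewer than the edges by the factor
        \<open>\<rho> ^ (e - 1)\<close>.\<close>
      have unit: "real n ^ v / real n ^ 2 * \<tau> ^ (e - 1) = 1"
      proof -
        have "\<tau> ^ (e - 1) = real n powr (real (e - 1) * (- 1 / m2 H))"
          unfolding \<tau>_def using n0 by (subst powr_power) auto
        also have "real (e - 1) * (- 1 / m2 H) = - (real v - 2)"
        proof -
          have "real (e - 1) = m2 H * (real v - 2)" using J(4) e2 by (simp add: e_def v_def of_nat_diff)
          then show ?thesis using m2 by simp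
        qed
        finally have 1: "\<tau> ^ (e - 1) = real n powr (- (real v - 2))" .
        have "real n ^ v / real n ^ 2 = real n powr (real v - 2)"
          using n0 by (simp add: powr_diff powr_realpow)
        then show ?thesis unfolding 1 using n0 by (simp add: powr_add[symmetric])
      qed
      have qe: "real n ^ v / real n ^ 2 * q ^ (e - 1) = \<rho> ^ (e - 1)"
      proof -
        have "real n ^ v / real n ^ 2 * q ^ (e - 1) = (real n ^ v / real n ^ 2 * \<tau> ^ (e - 1)) * \<rho> ^ (e - 1)"
          unfolding \<rho>(4) by (simp add: power_mult_distrib)
        then show ?thesis unfolding unit by simp
      qed
      have \<rho>e: "\<rho> ^ (e - 1) \<le> \<rho>" using power_decreasing[of 1 "e - 1" \<rho>] \<rho> e2 by simp
      define N where "N = real n ^ 2 * q"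
      have N: "0 \<le> N" using q by (simp add: N_def)
      define \<mu> where "\<mu> = real (card (emb J n)) * q ^ e"
      have \<mu>N: "\<mu> \<le> N * \<rho>"
      proof -
        have "\<mu> \<le> real n ^ v * q ^ e"
          unfolding \<mu>_def v_def using q by (intro mult_right_mono card_emb_le[OF sJ]) auto
        also have "q ^ e = q * q ^ (e - 1)" using e2 by (cases e) auto
        also have "real n ^ v * (q * q ^ (e - 1)) = N * (real n ^ v / real n ^ 2 * q ^ (e - 1))"
          using n0 by (simp add: N_def)
        also have "\<dots> \<le> N * \<rho>" unfolding qe using \<rho>e N by (rule mult_left_mono)
        finally show ?thesis .
      qed
      have EX: "measure_pmf.expectation (gnp n q) (copy_count J n) = \<mu>"
        unfolding \<mu>_def e_def by (rule expectation_copy_count[OF sJ q])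
      have X0: "0 \<le> copy_count J n G" for G by (simp add: copy_count_def sum_nonneg)
      have Markov: "measure_pmf.prob (gnp n q) {G. t \<le> copy_count J n G} \<le> \<mu> / t" if t: "0 < t" for t
      proof -
        have "measure_pmf.prob (gnp n q) {G. t \<le> copy_count J n G} \<le> measure_pmf.expectation (gnp n q) (\<lambda>G. copy_count J n G / t)"
          using t X0 by (intro prob_gnp_le_expectation) auto
        then show ?thesis using EX by simp
      qed
      define Q where "Q = (\<lambda>G. real e * copy_count J n G \<le> \<delta> * real (ne G))"
      have reduce: "measure_pmf.prob (gnp n q) {G. \<not> real l powr ((1 - \<delta>) * real (ne G)) \<le> real (R H l G)}
          \<le> measure_pmf.prob (gnp n q) {G. \<not> Q G}"
        using few_copies_many_colourings[OF H(1) J(1,3) l gnp_support]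
        by (intro prob_gnp_mono) (auto simp: Q_def e_def)
      have "measure_pmf.prob (gnp n q) {G. \<not> Q G} \<le> \<epsilon>"
      proof (cases "N \<le> K")
        case True
        \<comment> \<open>\<open>copy_count\<close> takes integer values, so failure of
          \<open>Q\<close> requires at least one copy, while the expected number is at most
          \<open>N * \<rho> \<le> K * K / n\<close>.\<close>
        have "measure_pmf.prob (gnp n q) {G. \<not> Q G} \<le> measure_pmf.prob (gnp n q) {G. 1 \<le> copy_count J n G}"
        proof (rule prob_gnp_mono, rule ccontr)
          fix G assume nQ: "\<not> Q G" and less: "\<not> 1 \<le> copy_count J n G"
          have "\<exists>j::nat. copy_count J n G = real j"
            unfolding copy_count_def by (rule exI[of _ "\<Sum>\<phi>\<in>emb J n. of_bool (emap \<phi> (edges J) \<subseteq> edges G)"]) simp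
          then obtain j :: nat where "copy_count J n G = real j" by blast
          with less have "copy_count J n G = 0" by simp
          then show False using nQ \<delta> by (simp add: Q_def)
        qed
        also have "\<dots> \<le> \<mu>" using Markov[of 1] by simp
        also have "\<dots> \<le> N * \<rho>" by (rule \<mu>N)
        also have "\<dots> \<le> K * (K / real n)"
        proof (rule mult_mono[OF True])
          have "\<rho> \<le> q / (1 / real n)" unfolding \<rho>_def using q \<tau> n0 by (intro divide_left_mono) auto
          also have "\<dots> = N / real n" using n0 by (simp add: N_def power2_eq_square)
          also have "\<dots> \<le> K / real n" using True n0 by (intro divide_right_mono) auto
          finally show "\<rho> \<le> K / real n" .
        qed (use K \<rho> in auto)
        also have "\<dots> \<le> \<epsilon>"
        proof -
          have "K * K / \<epsilon> \<le> real n" using n1 n by linarith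
          then have "K * K \<le> real n * \<epsilon>" using \<epsilon> by (simp add: divide_le_eq)
          then show ?thesis using n0 by (simp add: divide_le_eq mult_ac)
        qed
        finally show ?thesis .
      next
        case False
        then have NK: "K < N" by simp
        then have N0: "0 < N" using K by simp
        \<comment> \<open>Typically \<open>G\<close> has at least \<open>N / 8\<close> edges, and
          then \<open>t\<close> copies of \<open>J\<close> spoil at most
          \<open>e * t = \<delta> * N / 8\<close> of them.\<close>
        define t where "t = \<delta> * N / (8 * real e)"
        have t: "0 < t" using \<delta> N0 e2 by (simp add: t_def)
        have KN: "32 / \<epsilon> \<le> N" "512 * C * real e ^ 2 / (\<delta>\<^sup>2 * \<epsilon>) \<le> N"
        proof -
          have "0 \<le> 512 * C * real e ^ 2 / (\<delta>\<^sup>2 * \<epsilon>)" "0 \<le> 32 / \<epsilon>" using C \<epsilon> by auto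
          then show "32 / \<epsilon> \<le> N" "512 * C * real e ^ 2 / (\<delta>\<^sup>2 * \<epsilon>) \<le> N" using NK unfolding K_def by linarith+
        qed
        define c where "c = q * real (n choose 2)"
        have cN: "N / 4 \<le> c"
          using mult_left_mono[OF card_choose_two_bounds(1)[of n] q(1)] n by (simp add: c_def N_def mult_ac)
        then have c0: "0 < c" using N0 by linarith
        have few_edges: "measure_pmf.prob (gnp n q) {G. c / 2 \<le> \<bar>real (ne G) - c\<bar>} \<le> \<epsilon> / 2"
        proof -
          have "measure_pmf.prob (gnp n q) {G. c / 2 \<le> \<bar>(\<Sum>e\<in>edges G. 1) - q * (\<Sum>e\<in>edges (complete_graph n). 1)\<bar>}
            \<le> q * 1\<^sup>2 * real (n choose 2) / (c / 2)\<^sup>2"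
            using c0 by (intro edge_sum_Chebyshev[OF q]) auto
          also have "\<dots> = 4 / c" using c0 by (simp add: c_def[symmetric] power2_eq_square)
          also have "\<dots> \<le> 4 / (N / 4)" using cN N0 c0 by (intro divide_left_mono) auto
          also have "\<dots> \<le> \<epsilon> / 2" using KN(1) \<epsilon> N0 by (simp add: field_simps)
          finally show ?thesis by (simp add: card_edges_complete_graph c_def)
        qed
        have many: "measure_pmf.prob (gnp n q) {G. t \<le> copy_count J n G} \<le> \<epsilon> / 2"
        proof (cases "\<rho> \<le> b")
          case True
          have "measure_pmf.prob (gnp n q) {G. t \<le> copy_count J n G} \<le> \<mu> / t" by (rule Markov[OF t])
          also have "\<dots> \<le> (N * b) / t" using \<mu>N mult_left_mono[OF True N] t by (intro divide_right_mono) auto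
          also have "\<dots> = 8 * real e * b / \<delta>" using N0 \<delta> e2 by (simp add: t_def)
          also have "\<dots> \<le> \<epsilon> / 2" using b(3) \<delta> by (simp add: divide_le_eq)
          finally show ?thesis .
        next
          case False
          \<comment> \<open>This lower bound on \<open>q\<close> is what the variance estimate
            needs; its constant depends on \<open>\<epsilon>\<close> only through
            \<open>b\<close>.\<close>
          then have bq: "b * \<tau> \<le> q" unfolding \<rho>(4) using \<tau> by (intro mult_right_mono) auto
          have "\<mu> \<le> t / 2"
          proof -
            have "\<mu> \<le> N * a" using \<mu>N mult_left_mono[OF \<rho>(2) N] by linarith
            also have "\<dots> \<le> t / 2" using mult_right_mono[OF a(3) N] e2 by (simp add: t_def field_simps)
            finally show ?thesis .
          qed
          then have "t / 2 \<le> \<bar>copy_count J n G - \<mu>\<bar>" if "t \<le> copy_count J n G" for G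
            using that by linarith
          then have "measure_pmf.prob (gnp n q) {G. t \<le> copy_count J n G} \<le> measure_pmf.prob (gnp n q) {G. t / 2 \<le> \<bar>copy_count J n G - \<mu>\<bar>}"
            by (intro prob_gnp_mono)
          also have "\<dots> \<le> measure_pmf.expectation (gnp n q) (\<lambda>G. (copy_count J n G - \<mu>)\<^sup>2) / (t / 2)\<^sup>2"
            using t by (intro prob_gnp_Chebyshev) simp
          also have "\<dots> \<le> C * N / (t / 2)\<^sup>2"
          proof (rule divide_right_mono)
            have "measure_pmf.expectation (gnp n q) (\<lambda>G. (copy_count J n G - \<mu>)\<^sup>2)
              \<le> C * (real n ^ v * (real n ^ v / real n ^ 2) * q ^ (2 * e - 1))"
              unfolding \<mu>_def C_def e_def v_def using n m2 b a bq
              by (intro variance_copy_count[OF sJ q _ _ LJ]) (auto simp: \<tau>_def)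
            also have "real n ^ v * (real n ^ v / real n ^ 2) * q ^ (2 * e - 1)
                = N * (real n ^ v / real n ^ 2 * q ^ (e - 1)) * (real n ^ v / real n ^ 2 * q ^ (e - 1))"
            proof -
              have "2 * e - 1 = 1 + (e - 1) + (e - 1)" using e2 by simp
              then have "q ^ (2 * e - 1) = q * q ^ (e - 1) * q ^ (e - 1)" by (simp only: power_add power_one_right)
              then show ?thesis using n0 by (simp add: N_def power2_eq_square)
            qed
            also have "\<dots> = N * \<rho> ^ (e - 1) * \<rho> ^ (e - 1)" unfolding qe ..
            also have "\<dots> \<le> N * 1 * 1" using \<rho> N by (intro mult_mono power_le_one) auto
            finally show "measure_pmf.expectation (gnp n q) (\<lambda>G. (copy_count J n G - \<mu>)\<^sup>2) \<le> C * N"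
              using C by (simp add: mult_left_mono)
          qed simp
          also have "\<dots> = 256 * C * real e ^ 2 / (\<delta>\<^sup>2 * N)"
            using N0 \<delta> e2 by (simp add: t_def power2_eq_square field_simps)
          also have "\<dots> \<le> \<epsilon> / 2"
          proof -
            have "512 * C * real e ^ 2 \<le> N * (\<delta>\<^sup>2 * \<epsilon>)" using KN(2) \<delta> \<epsilon> by (simp add: divide_le_eq)
            then show ?thesis using \<delta> N0 by (simp add: divide_le_eq mult_ac)
          qed
          finally show ?thesis .
        qed
        have "measure_pmf.prob (gnp n q) {G. \<not> Q G} \<le> measure_pmf.prob (gnp n q) {G. c / 2 \<le> \<bar>real (ne G) - c\<bar> \<or> t \<le> copy_count J n G}"
        proof (rule prob_gnp_mono, rule ccontr)
          fix G assume nQ: "\<not> Q G" and "\<not> (c / 2 \<le> \<bar>real (ne G) - c\<bar> \<or> t \<le> copy_count J n G)"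
          then have "c / 2 \<le> real (ne G)" and X: "copy_count J n G \<le> t" by linarith+
          then have ge: "N / 8 \<le> real (ne G)" using cN by linarith
          have "real e * copy_count J n G \<le> real e * t" using X by (intro mult_left_mono) auto
          also have "\<dots> = \<delta> * (N / 8)" using e2 by (simp add: t_def)
          also have "\<dots> \<le> \<delta> * real (ne G)" using ge \<delta> by (intro mult_left_mono) auto
          finally show False using nQ by (simp add: Q_def)
        qed
        also have "\<dots> \<le> \<epsilon> / 2 + \<epsilon> / 2" by (rule order_trans[OF prob_gnp_disj]) (rule add_mono[OF few_edges many])
        finally show ?thesis by simp
      qed
      then show "measure_pmf.prob (gnp n (p n)) {G. \<not> real l powr ((1 - \<delta>) * real (ne G)) \<le> real (R H l G)} \<le> \<epsilon>"
        using reduce unfolding q_def by linarith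
    qed
  qed
qed

section \<open>Combining the two regimes\<close>

lemma R_le_power: "finite (edges G) \<Longrightarrow> R H l G \<le> l ^ ne G"
proof -
  assume fin: "finite (edges G)"
  have "R H l G \<le> card (edges G \<rightarrow>\<^sub>E {1..l})"
    unfolding R_def using fin by (intro card_mono finite_PiE) (auto simp: rainbow_free_colourings_def)
  then show ?thesis using fin by (simp add: card_PiE)
qed

theorem theorem1p2:
  fixes H :: "'a graph" and l :: nat and \<delta> :: real
  assumes "simple_graph H" and "no_isolated_vertices H" and "non_matching H"
    and "ne H \<ge> 3" and "l \<ge> ne H" and "\<delta> > 0"
  shows "\<exists>a>0. \<exists>A>0. \<forall>p :: nat \<Rightarrow> real. (\<forall>n. 0 \<le> p n \<and> p n \<le> 1) \<longrightarrow>
    ((\<forall>\<^sub>F n in sequentially. p n \<le> a * real n powr (- 1 / m2 H)) \<longrightarrow>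
      whp_gnp p (\<lambda>G.
        real l powr ((1 - \<delta>) * real (ne G)) \<le> real (R H l G) \<and>
        R H l G \<le> l ^ ne G)) \<and>
    ((\<forall>\<^sub>F n in sequentially. p n \<ge> A * real n powr (- 1 / m2 H)) \<longrightarrow>
      whp_gnp p (\<lambda>G.
        exp ((lambda_H H l - \<delta>) * real (ne G)) \<le> real (R H l G) \<and>
        real (R H l G) \<le> exp ((lambda_H H l + \<delta>) * real (ne G))))"
proof -
  have l1: "1 \<le> l" and e2: "2 \<le> ne H" using assms(4,5) by auto
  obtain a where a: "0 < a" and sparse: "\<And>p \<epsilon>. (\<forall>n. 0 \<le> p n \<and> p n \<le> 1) \<Longrightarrow>
    (\<forall>\<^sub>F n in sequentially. p n \<le> a * real n powr (- 1 / m2 H)) \<Longrightarrow> 0 < \<epsilon> \<Longrightarrow>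
    \<forall>\<^sub>F n in sequentially. measure_pmf.prob (gnp n (p n))
     {G. \<not> real l powr ((1 - \<delta>) * real (ne G)) \<le> real (R H l G)} \<le> \<epsilon>"
    using colourings_sparse_whp[OF assms(1,3) l1 assms(6)] by blast
  obtain A where A: "0 < A" and dense: "\<And>p \<epsilon>. (\<forall>n. 0 \<le> p n \<and> p n \<le> 1) \<Longrightarrow>
    (\<forall>\<^sub>F n in sequentially. A * real n powr (- 1 / m2 H) \<le> p n) \<Longrightarrow> 0 < \<epsilon> \<Longrightarrow>
    \<forall>\<^sub>F n in sequentially. measure_pmf.prob (gnp n (p n))
     {G. \<not> real (R H l G) \<le> exp ((lambda_H H l + \<delta>) * real (ne G))} \<le> \<epsilon>"
    using colourings_upper_whp[OF assms(1,3) e2 assms(5,6)] by blast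
  have m2: "1 \<le> m2 H" by (rule m2_ge_1[OF assms(1,3)])
  show ?thesis
  proof (rule exI[of _ a], intro conjI a, rule exI[of _ A], intro conjI A allI impI)
    fix p :: "nat \<Rightarrow> real"
    assume p: "\<forall>n. 0 \<le> p n \<and> p n \<le> 1"
    show "whp_gnp p (\<lambda>G. real l powr ((1 - \<delta>) * real (ne G)) \<le> real (R H l G) \<and> R H l G \<le> l ^ ne G)"
      if pa: "\<forall>\<^sub>F n in sequentially. p n \<le> a * real n powr (- 1 / m2 H)"
    proof (rule whp_gnpI)
      fix \<epsilon> :: real assume \<epsilon>: "0 < \<epsilon>"
      from sparse[OF p pa this]
      show "\<forall>\<^sub>F n in sequentially. measure_pmf.prob (gnp n (p n))
        {G. \<not> (real l powr ((1 - \<delta>) * real (ne G)) \<le> real (R H l G) \<and> R H l G \<le> l ^ ne G)} \<le> \<epsilon>"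
      proof (rule eventually_mono)
        fix n assume le: "measure_pmf.prob (gnp n (p n)) {G. \<not> real l powr ((1 - \<delta>) * real (ne G)) \<le> real (R H l G)} \<le> \<epsilon>"
        have "R H l G \<le> l ^ ne G" if "G \<in> set_pmf (gnp n (p n))" for G
          by (rule R_le_power, rule finite_subset[OF gnp_support(2)[OF that]]) simp
        then have "measure_pmf.prob (gnp n (p n)) {G. \<not> (real l powr ((1 - \<delta>) * real (ne G)) \<le> real (R H l G) \<and> R H l G \<le> l ^ ne G)}
          \<le> measure_pmf.prob (gnp n (p n)) {G. \<not> real l powr ((1 - \<delta>) * real (ne G)) \<le> real (R H l G)}"
          by (intro prob_gnp_mono) blast
        then show "measure_pmf.prob (gnp n (p n)) {G. \<not> (real l powr ((1 - \<delta>) * real (ne G)) \<le> real (R H l G) \<and> R H l G \<le> l ^ ne G)} \<le> \<epsilon>"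
          using le by linarith
      qed
    qed
    show "whp_gnp p (\<lambda>G. exp ((lambda_H H l - \<delta>) * real (ne G)) \<le> real (R H l G) \<and>
        real (R H l G) \<le> exp ((lambda_H H l + \<delta>) * real (ne G)))"
      if pA: "\<forall>\<^sub>F n in sequentially. p n \<ge> A * real n powr (- 1 / m2 H)"
    proof (rule whp_gnpI)
      fix \<epsilon> :: real assume \<epsilon>: "0 < \<epsilon>"
      have "\<forall>\<^sub>F n in sequentially. measure_pmf.prob (gnp n (p n))
        {G. \<not> exp ((lambda_H H l - \<delta>) * real (ne G)) \<le> real (R H l G)} \<le> \<epsilon> / 2"
        using p \<epsilon> by (intro colourings_lower_whp[OF assms(1) e2 l1 assms(6)] choose_two_expected_at_top[OF A m2 pA]) auto
      moreover have "\<forall>\<^sub>F n in sequentially. measure_pmf.prob (gnp n (p n))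
        {G. \<not> real (R H l G) \<le> exp ((lambda_H H l + \<delta>) * real (ne G))} \<le> \<epsilon> / 2"
        by (rule dense[OF p pA]) (use \<epsilon> in simp)
      ultimately show "\<forall>\<^sub>F n in sequentially. measure_pmf.prob (gnp n (p n))
        {G. \<not> (exp ((lambda_H H l - \<delta>) * real (ne G)) \<le> real (R H l G) \<and>
          real (R H l G) \<le> exp ((lambda_H H l + \<delta>) * real (ne G)))} \<le> \<epsilon>"
      proof eventually_elim
        case (elim n)
        then show ?case
          using prob_gnp_disj[of n "p n" "\<lambda>G. \<not> exp ((lambda_H H l - \<delta>) * real (ne G)) \<le> real (R H l G)"
            "\<lambda>G. \<not> real (R H l G) \<le> exp ((lambda_H H l + \<delta>) * real (ne G))"]
          unfolding de_Morgan_conj by linarith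
      qed
    qed
  qed
qed

end
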